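(* Let $k$ be a field, $\mathfrak{g}$ a Lie algebra over $k$, $\mathfrak{h}$ an ideal of $\mathfrak{g}$ and $M$ a $\mathfrak{g}$-module. Let $H^2(\mathfrak{g},M)_1$ be the kernel of the restriction map $H^2(\mathfrak{g},M)\to H^2(\mathfrak{h},M)$. Then the sequence $$0\to H^1(\mathfrak{g}/\mathfrak{h},M^{\mathfrak{h}})\xrightarrow{\ \inf\ }H^1(\mathfrak{g},M)\xrightarrow{\ \mathrm{res}\ }H^1(\mathfrak{h},M)^{\mathfrak{g}/\mathfrak{h}}\xrightarrow{\ \mathrm{tr}\ }H^2(\mathfrak{g}/\mathfrak{h},M^{\mathfrak{h}})\xrightarrow{\ \inf\ }H^2(\mathfrak{g},M)_1\xrightarrow{\ \rho\ }H^1(\mathfrak{g}/\mathfrak{h},H^1(\mathfrak{h},M))$$ is exact, where $\inf$, $\mathrm{res}$, $\mathrm{tr}$ and $\rho$ are the maps described in the context.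
   Context: Derivations and $H^1$: for a Lie algebra $\mathfrak{a}$ over $k$ and an $\mathfrak{a}$-module $N$, $\mathrm{Der}(\mathfrak{a},N)$ is the space of $k$-linear maps $d:\mathfrak{a}\to N$ with $d[x,y]=x\cdot d(y)-y\cdot d(x)$; $\delta(n)$ denotes the inner derivation $x\mapsto x\cdot n$; $\mathrm{Inn}(\mathfrak{a},N)=\{\delta(n):n\in N\}$ and $H^1(\mathfrak{a},N)=\mathrm{Der}(\mathfrak{a},N)/\mathrm{Inn}(\mathfrak{a},N)$. $M^{\mathfrak{h}}=\{m\in M: z\cdot m=0\ \forall z\in\mathfrak{h}\}$, a $\mathfrak{g}/\mathfrak{h}$-module. $\mathfrak{g}$ acts on $\mathrm{Der}(\mathfrak{h},M)$ by $({}^xd)(z)=x\cdot d(z)-d[x,z]$; this induces an action of $\mathfrak{g}/\mathfrak{h}$ on $H^1(\mathfrak{h},M)$, and $H^1(\mathfrak{h},M)^{\mathfrak{g}/\mathfrak{h}}$ is the subspace of elements annihilated by $\mathfrak{g}/\mathfrak{h}$. $\mathrm{Der}(\mathfrak{h},M)^{\mathfrak{g}/\mathfrak{h}}$ denotes the preimage of $H^1(\mathfrak{h},M)^{\mathfrak{g}/\mathfrak{h}}$ in $\mathrm{Der}(\mathfrak{h},M)$. $H^2$: $H^2(\mathfrak{a},N)$ is identified with equivalence classes of Lie algebra extensions $0\to N\xrightarrow{i}\mathfrak{e}\to\mathfrak{a}\to0$ ($N$ abelian) whose induced action $i(x\cdot n)=[\tilde x,i(n)]$ ($\tilde x$ a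 lift of $x$) is the given module structure; the class of an extension corresponds to that of the 2-cocycle $f(x,y)=[s(x),s(y)]-s[x,y]$ for a linear section $s$. The maps $\inf$ and $\mathrm{res}$: in degrees 1 and 2, $\inf$ is the map on cohomology induced by the projection $\mathfrak{g}\to\mathfrak{g}/\mathfrak{h}$ and the inclusion $M^{\mathfrak{h}}\hookrightarrow M$; in degree 2 its image lies in $H^2(\mathfrak{g},M)_1$. The restriction maps are induced by the inclusion $\mathfrak{h}\hookrightarrow\mathfrak{g}$; in degree 1, $\mathrm{res}$ sends the class of a derivation $\mathfrak{g}\to M$ to the class of its restriction to $\mathfrak{h}$, which lies in $H^1(\mathfrak{h},M)^{\mathfrak{g}/\mathfrak{h}}$. The map $\mathrm{tr}$: $M\rtimes\mathfrak{g}$ has bracket $[(m,x),(m',x')]=(x\cdot m'-x'\cdot m,[x,x'])$. For $d\in\mathrm{Der}(\mathfrak{h},M)^{\mathfrak{g}/\mathfrak{h}}$ let $s_d:\mathfrak{h}\to M\rtimes\mathfrak{g}$, $s_d(z)=(d(z),z)$, a Lie algebra homomorphism, and $I=\{y\in M\rtimes\mathfrak{g}:[y,s_d(\mathfrak{h})]\subset s_d(\mathfrak{h})\}$. Then $0\to M^{\mathfrak{h}}\to I/s_d(\mathfrak{h})\to\mathfrak{g}/\mathfrak{h}\to0$ (maps induced by $m\mapsto(m,0)$ and $(m,x)\mapsto x$) is an extension, and $\mathrm{tr}[d]\in H^2(\mathfrak{g}/\mathfrak{h},M^{\mathfrak{h}})$ is its class (which depends only on $[d]$). The map $\rho$: the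 class of an extension $\underline{e}:0\to M\xrightarrow{i}\mathfrak{e}\xrightarrow{p}\mathfrak{g}\to0$ lies in $H^2(\mathfrak{g},M)_1$ iff there is a partial splitting, i.e. a Lie algebra homomorphism $s_0:\mathfrak{h}\to\mathfrak{e}$ with $p\circ s_0=\mathrm{id}_{\mathfrak{h}}$. Fix such $s_0$. For $y\in\mathfrak{e}$ let $d_y:\mathfrak{h}\to M$ be the derivation $d_y(z)=i^{-1}([y,s_0(z)]-s_0[p(y),z])$. The class $[d_y]\in H^1(\mathfrak{h},M)$ depends only on the image of $y$ in $\mathfrak{g}/\mathfrak{h}$, so $\overline{\rho}(\underline{e}):\mathfrak{g}/\mathfrak{h}\to H^1(\mathfrak{h},M)$, $p(y)+\mathfrak{h}\mapsto[d_y]$, is a well-defined map; it is a derivation, whose class in $H^1(\mathfrak{g}/\mathfrak{h},H^1(\mathfrak{h},M))$ does not depend on $s_0$ nor on the representative $\underline{e}$ of $[\underline{e}]$. Then $\rho[\underline{e}]:=[\overline{\rho}(\underline{e})]$. *)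

theory Defs
  imports "HOL-Algebra.Module" "HOL-Algebra.QuotRing" "HOL-Library.FuncSet"
begin

section \<open>Lie algebras, modules, quotients\<close>

text \<open>
  As for the library locale \<^locale>\<open>algebra\<close>, an algebra over \<open>K\<close> is a \<open>module\<close> record whose
  \<open>mult\<close> field is the product: for a Lie algebra \<open>L\<close>, \<open>x \<otimes>\<^bsub>L\<^esub> y\<close> is the bracket \<open>[x, y]\<close>.
  The field \<open>one\<close> of a Lie algebra, and the fields \<open>mult\<close> and \<open>one\<close> of a mere vector space,
  carry no information and are never constrained.
\<close>

locale lie_algebra = K?: field K + L?: module K L for K (structure) and L (structure) +
  assumes bracket_closed:
      "\<lbrakk>x \<in> carrier L; y \<in> carrier L\<rbrakk> \<Longrightarrow> x \<otimes>\<^bsub>L\<^esub> y \<in> carrier L"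
    and bracket_l_distr:
      "\<lbrakk>x \<in> carrier L; y \<in> carrier L; z \<in> carrier L\<rbrakk> \<Longrightarrow>
        (x \<oplus>\<^bsub>L\<^esub> y) \<otimes>\<^bsub>L\<^esub> z = x \<otimes>\<^bsub>L\<^esub> z \<oplus>\<^bsub>L\<^esub> y \<otimes>\<^bsub>L\<^esub> z"
    and bracket_r_distr:
      "\<lbrakk>x \<in> carrier L; y \<in> carrier L; z \<in> carrier L\<rbrakk> \<Longrightarrow>
        x \<otimes>\<^bsub>L\<^esub> (y \<oplus>\<^bsub>L\<^esub> z) = x \<otimes>\<^bsub>L\<^esub> y \<oplus>\<^bsub>L\<^esub> x \<otimes>\<^bsub>L\<^esub> z"
    and bracket_smult_l:
      "\<lbrakk>a \<in> carrier K; x \<in> carrier L; y \<in> carrier L\<rbrakk> \<Longrightarrow>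
        (a \<odot>\<^bsub>L\<^esub> x) \<otimes>\<^bsub>L\<^esub> y = a \<odot>\<^bsub>L\<^esub> (x \<otimes>\<^bsub>L\<^esub> y)"
    and bracket_smult_r:
      "\<lbrakk>a \<in> carrier K; x \<in> carrier L; y \<in> carrier L\<rbrakk> \<Longrightarrow>
        x \<otimes>\<^bsub>L\<^esub> (a \<odot>\<^bsub>L\<^esub> y) = a \<odot>\<^bsub>L\<^esub> (x \<otimes>\<^bsub>L\<^esub> y)"
    and bracket_self:
      "x \<in> carrier L \<Longrightarrow> x \<otimes>\<^bsub>L\<^esub> x = \<zero>\<^bsub>L\<^esub>"
    and jacobi:
      "\<lbrakk>x \<in> carrier L; y \<in> carrier L; z \<in> carrier L\<rbrakk> \<Longrightarrow>
        x \<otimes>\<^bsub>L\<^esub> (y \<otimes>\<^bsub>L\<^esub> z) \<oplus>\<^bsub>L\<^esub> y \<otimes>\<^bsub>L\<^esub> (z \<otimes>\<^bsub>L\<^esub> x) \<oplus>\<^bsub>L\<^esub> z \<otimes>\<^bsub>L\<^esub> (x \<otimes>\<^bsub>L\<^esub> y) = \<zero>\<^bsub>L\<^esub>"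

locale lie_ideal = lie_algebra K L + submodule H K L
  for K (structure) and L (structure) and H +
  assumes ideal_closed: "\<lbrakk>x \<in> carrier L; z \<in> H\<rbrakk> \<Longrightarrow> x \<otimes>\<^bsub>L\<^esub> z \<in> H"

locale lie_module = lie_algebra K L + M?: module K M
  for K (structure) and L (structure) and M (structure) +
  fixes act :: "'c \<Rightarrow> 'e \<Rightarrow> 'e"
  assumes act_closed:
      "\<lbrakk>x \<in> carrier L; m \<in> carrier M\<rbrakk> \<Longrightarrow> act x m \<in> carrier M"
    and act_l_distr:
      "\<lbrakk>x \<in> carrier L; y \<in> carrier L; m \<in> carrier M\<rbrakk> \<Longrightarrow>
        act (x \<oplus>\<^bsub>L\<^esub> y) m = act x m \<oplus>\<^bsub>M\<^esub> act y m"
    and act_r_distr: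
      "\<lbrakk>x \<in> carrier L; m \<in> carrier M; n \<in> carrier M\<rbrakk> \<Longrightarrow>
        act x (m \<oplus>\<^bsub>M\<^esub> n) = act x m \<oplus>\<^bsub>M\<^esub> act x n"
    and act_smult_l:
      "\<lbrakk>a \<in> carrier K; x \<in> carrier L; m \<in> carrier M\<rbrakk> \<Longrightarrow>
        act (a \<odot>\<^bsub>L\<^esub> x) m = a \<odot>\<^bsub>M\<^esub> act x m"
    and act_smult_r:
      "\<lbrakk>a \<in> carrier K; x \<in> carrier L; m \<in> carrier M\<rbrakk> \<Longrightarrow>
        act x (a \<odot>\<^bsub>M\<^esub> m) = a \<odot>\<^bsub>M\<^esub> act x m"
    and act_bracket:
      "\<lbrakk>x \<in> carrier L; y \<in> carrier L; m \<in> carrier M\<rbrakk> \<Longrightarrow>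
        act (x \<otimes>\<^bsub>L\<^esub> y) m = act x (act y m) \<ominus>\<^bsub>M\<^esub> act y (act x m)"

definition module_homs ::
    "('k, 'r) ring_scheme \<Rightarrow> ('k, 'a) module \<Rightarrow> ('k, 'b) module \<Rightarrow> ('a \<Rightarrow> 'b) set" where
  "module_homs K V W = {f \<in> carrier V \<rightarrow> carrier W.
     (\<forall>x\<in>carrier V. \<forall>y\<in>carrier V. f (x \<oplus>\<^bsub>V\<^esub> y) = f x \<oplus>\<^bsub>W\<^esub> f y) \<and>
     (\<forall>a\<in>carrier K. \<forall>x\<in>carrier V. f (a \<odot>\<^bsub>V\<^esub> x) = a \<odot>\<^bsub>W\<^esub> f x)}"

definition lie_homs ::
    "('k, 'r) ring_scheme \<Rightarrow> ('k, 'a) module \<Rightarrow> ('k, 'b) module \<Rightarrow> ('a \<Rightarrow> 'b) set" where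
  "lie_homs K L E = {f \<in> module_homs K L E.
     \<forall>x\<in>carrier L. \<forall>y\<in>carrier L. f (x \<otimes>\<^bsub>L\<^esub> y) = f x \<otimes>\<^bsub>E\<^esub> f y}"

text \<open>
  \<open>quot_alg V W\<close> is \<open>V / W\<close>, for subspaces of vector spaces as well as for ideals of Lie
  algebras. For \<open>a = \<zero>\<close> the set \<open>{a \<odot> x | x \<in> X}\<close> need not be a whole coset, hence the union.
\<close>

definition quot_alg :: "('k, 'a) module \<Rightarrow> 'a set \<Rightarrow> ('k, 'a set) module" where
  "quot_alg V W = ring.extend (V Quot W) (module.fields (\<lambda>a X. \<Union>x\<in>X. W +>\<^bsub>V\<^esub> (a \<odot>\<^bsub>V\<^esub> x)))"

text \<open>The map \<open>V / V' \<rightarrow> W / W'\<close> induced by a linear map \<open>f : V \<rightarrow> W\<close> with \<open>f V' \<subseteq> W'\<close>.\<close>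

definition induced :: "('k, 'b) module \<Rightarrow> 'b set \<Rightarrow> ('a \<Rightarrow> 'b) \<Rightarrow> 'a set \<Rightarrow> 'b set" where
  "induced W W' f C = (\<Union>v\<in>C. W' +>\<^bsub>W\<^esub> f v)"

text \<open>
  Functions are extensional, so that subspaces of \<open>fun_space X N\<close> (derivations, cochains) have
  a unique zero element and equality of elements is equality on \<open>X\<close>.
\<close>

definition fun_space :: "'x set \<Rightarrow> ('k, 'n) module \<Rightarrow> ('k, 'x \<Rightarrow> 'n) module" where
  "fun_space X N =
    \<lparr>carrier = X \<rightarrow>\<^sub>E carrier N, mult = undefined, one = undefined,
     zero = (\<lambda>x\<in>X. \<zero>\<^bsub>N\<^esub>), add = (\<lambda>f g. \<lambda>x\<in>X. f x \<oplus>\<^bsub>N\<^esub> g x),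
     smult = (\<lambda>a f. \<lambda>x\<in>X. a \<odot>\<^bsub>N\<^esub> f x)\<rparr>"

definition invariants ::
    "('k, 'a) module \<Rightarrow> ('k, 'n) module \<Rightarrow> ('a \<Rightarrow> 'n \<Rightarrow> 'n) \<Rightarrow> 'n set" where
  "invariants L N act = {n \<in> carrier N. \<forall>x\<in>carrier L. act x n = \<zero>\<^bsub>N\<^esub>}"

abbreviation subalg :: "('k, 'a) module \<Rightarrow> 'a set \<Rightarrow> ('k, 'a) module" where
  "subalg V W \<equiv> V\<lparr>carrier := W\<rparr>"


section \<open>First cohomology\<close>

definition ders ::
    "('k, 'r) ring_scheme \<Rightarrow> ('k, 'a) module \<Rightarrow> ('k, 'n) module \<Rightarrow> ('a \<Rightarrow> 'n \<Rightarrow> 'n) \<Rightarrow>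
     ('a \<Rightarrow> 'n) set" where
  "ders K L N act = {d \<in> module_homs K L N \<inter> extensional (carrier L).
     \<forall>x\<in>carrier L. \<forall>y\<in>carrier L. d (x \<otimes>\<^bsub>L\<^esub> y) = act x (d y) \<ominus>\<^bsub>N\<^esub> act y (d x)}"

definition inner_der :: "('k, 'a) module \<Rightarrow> ('a \<Rightarrow> 'n \<Rightarrow> 'n) \<Rightarrow> 'n \<Rightarrow> 'a \<Rightarrow> 'n" where
  "inner_der L act n = (\<lambda>x\<in>carrier L. act x n)"

definition inner_ders ::
    "('k, 'a) module \<Rightarrow> ('k, 'n) module \<Rightarrow> ('a \<Rightarrow> 'n \<Rightarrow> 'n) \<Rightarrow> ('a \<Rightarrow> 'n) set" where
  "inner_ders L N act = inner_der L act ` carrier N"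

definition der_space ::
    "('k, 'r) ring_scheme \<Rightarrow> ('k, 'a) module \<Rightarrow> ('k, 'n) module \<Rightarrow> ('a \<Rightarrow> 'n \<Rightarrow> 'n) \<Rightarrow>
     ('k, 'a \<Rightarrow> 'n) module" where
  "der_space K L N act = subalg (fun_space (carrier L) N) (ders K L N act)"

definition H1 ::
    "('k, 'r) ring_scheme \<Rightarrow> ('k, 'a) module \<Rightarrow> ('k, 'n) module \<Rightarrow> ('a \<Rightarrow> 'n \<Rightarrow> 'n) \<Rightarrow>
     ('k, ('a \<Rightarrow> 'n) set) module" where
  "H1 K L N act = quot_alg (der_space K L N act) (inner_ders L N act)"


section \<open>Second cohomology and extensions\<close>

definition cocycles2 ::
    "('k, 'r) ring_scheme \<Rightarrow> ('k, 'a) module \<Rightarrow> ('k, 'n) module \<Rightarrow> ('a \<Rightarrow> 'n \<Rightarrow> 'n) \<Rightarrow>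
     ('a \<times> 'a \<Rightarrow> 'n) set" where
  "cocycles2 K L N act = {f \<in> carrier L \<times> carrier L \<rightarrow>\<^sub>E carrier N.
     (\<forall>x\<in>carrier L. (\<lambda>y. f (x, y)) \<in> module_homs K L N) \<and>
     (\<forall>y\<in>carrier L. (\<lambda>x. f (x, y)) \<in> module_homs K L N) \<and>
     (\<forall>x\<in>carrier L. f (x, x) = \<zero>\<^bsub>N\<^esub>) \<and>
     (\<forall>x\<in>carrier L. \<forall>y\<in>carrier L. \<forall>z\<in>carrier L.
        act x (f (y, z)) \<oplus>\<^bsub>N\<^esub> act y (f (z, x)) \<oplus>\<^bsub>N\<^esub> act z (f (x, y))
        = f (x \<otimes>\<^bsub>L\<^esub> y, z) \<oplus>\<^bsub>N\<^esub> f (y \<otimes>\<^bsub>L\<^esub> z, x) \<oplus>\<^bsub>N\<^esub> f (z \<otimes>\<^bsub>L\<^esub> x, y))}"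

definition coboundary2 ::
    "('k, 'a) module \<Rightarrow> ('k, 'n) module \<Rightarrow> ('a \<Rightarrow> 'n \<Rightarrow> 'n) \<Rightarrow> ('a \<Rightarrow> 'n) \<Rightarrow> 'a \<times> 'a \<Rightarrow> 'n" where
  "coboundary2 L N act b = (\<lambda>(x, y)\<in>carrier L \<times> carrier L.
     act x (b y) \<ominus>\<^bsub>N\<^esub> act y (b x) \<ominus>\<^bsub>N\<^esub> b (x \<otimes>\<^bsub>L\<^esub> y))"

definition coboundaries2 ::
    "('k, 'r) ring_scheme \<Rightarrow> ('k, 'a) module \<Rightarrow> ('k, 'n) module \<Rightarrow> ('a \<Rightarrow> 'n \<Rightarrow> 'n) \<Rightarrow>
     ('a \<times> 'a \<Rightarrow> 'n) set" where
  "coboundaries2 K L N act = coboundary2 L N act ` module_homs K L N"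

definition cocycle_space ::
    "('k, 'r) ring_scheme \<Rightarrow> ('k, 'a) module \<Rightarrow> ('k, 'n) module \<Rightarrow> ('a \<Rightarrow> 'n \<Rightarrow> 'n) \<Rightarrow>
     ('k, 'a \<times> 'a \<Rightarrow> 'n) module" where
  "cocycle_space K L N act = subalg (fun_space (carrier L \<times> carrier L) N) (cocycles2 K L N act)"

definition H2 ::
    "('k, 'r) ring_scheme \<Rightarrow> ('k, 'a) module \<Rightarrow> ('k, 'n) module \<Rightarrow> ('a \<Rightarrow> 'n \<Rightarrow> 'n) \<Rightarrow>
     ('k, ('a \<times> 'a \<Rightarrow> 'n) set) module" where
  "H2 K L N act = quot_alg (cocycle_space K L N act) (coboundaries2 K L N act)"

text \<open>
  An extension \<open>0 \<rightarrow> N \<rightarrow> E \<rightarrow> L \<rightarrow> 0\<close> with maps \<open>i\<close>, \<open>p\<close>, abelian kernel and induced action \<open>act\<close>;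
  every \<open>e \<in> E\<close> serves as a lift of \<open>p e\<close>.
\<close>

definition lie_extension ::
    "('k, 'r) ring_scheme \<Rightarrow> ('k, 'a) module \<Rightarrow> ('k, 'n) module \<Rightarrow> ('a \<Rightarrow> 'n \<Rightarrow> 'n) \<Rightarrow>
     ('k, 'e) module \<Rightarrow> ('n \<Rightarrow> 'e) \<Rightarrow> ('e \<Rightarrow> 'a) \<Rightarrow> bool" where
  "lie_extension K L N act E i p \<longleftrightarrow>
     lie_algebra K E \<and>
     i \<in> module_homs K N E \<and> inj_on i (carrier N) \<and>
     (\<forall>m\<in>carrier N. \<forall>n\<in>carrier N. i m \<otimes>\<^bsub>E\<^esub> i n = \<zero>\<^bsub>E\<^esub>) \<and>
     p \<in> lie_homs K E L \<and> p ` carrier E = carrier L \<and>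
     a_kernel E L p = i ` carrier N \<and>
     (\<forall>e\<in>carrier E. \<forall>n\<in>carrier N. i (act (p e) n) = e \<otimes>\<^bsub>E\<^esub> i n)"

definition section_cocycle ::
    "('k, 'a) module \<Rightarrow> ('k, 'n) module \<Rightarrow> ('k, 'e) module \<Rightarrow> ('n \<Rightarrow> 'e) \<Rightarrow> ('a \<Rightarrow> 'e) \<Rightarrow>
     'a \<times> 'a \<Rightarrow> 'n" where
  "section_cocycle L N E i s = (\<lambda>(x, y)\<in>carrier L \<times> carrier L.
     inv_into (carrier N) i ((s x \<otimes>\<^bsub>E\<^esub> s y) \<ominus>\<^bsub>E\<^esub> s (x \<otimes>\<^bsub>L\<^esub> y)))"

definition ext_class ::
    "('k, 'r) ring_scheme \<Rightarrow> ('k, 'a) module \<Rightarrow> ('k, 'n) module \<Rightarrow> ('a \<Rightarrow> 'n \<Rightarrow> 'n) \<Rightarrow>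
     ('k, 'e) module \<Rightarrow> ('n \<Rightarrow> 'e) \<Rightarrow> ('e \<Rightarrow> 'a) \<Rightarrow> ('a \<times> 'a \<Rightarrow> 'n) set" where
  "ext_class K L N act E i p = (THE c. \<exists>s\<in>module_homs K L E.
     (\<forall>x\<in>carrier L. p (s x) = x) \<and>
     c = coboundaries2 K L N act +>\<^bsub>cocycle_space K L N act\<^esub> section_cocycle L N E i s)"


section \<open>The objects attached to an ideal\<close>

text \<open>Throughout, \<open>L\<close> is the Lie algebra, \<open>H\<close> an ideal of it and \<open>M\<close> an \<open>L\<close>-module via \<open>act\<close>.\<close>

definition inv_module ::
    "('k, 'a) module \<Rightarrow> 'a set \<Rightarrow> ('k, 'm) module \<Rightarrow> ('a \<Rightarrow> 'm \<Rightarrow> 'm) \<Rightarrow> ('k, 'm) module" where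
  "inv_module L H M act = subalg M (invariants (subalg L H) M act)"

text \<open>The action of \<open>L / H\<close> on \<open>M\<^sup>H\<close>: all elements of a coset \<open>X\<close> act equally on \<open>m \<in> M\<^sup>H\<close>.\<close>

definition inv_act :: "('a \<Rightarrow> 'm \<Rightarrow> 'm) \<Rightarrow> 'a set \<Rightarrow> 'm \<Rightarrow> 'm" where
  "inv_act act X m = the_elem ((\<lambda>x. act x m) ` X)"

definition der_act ::
    "('k, 'a) module \<Rightarrow> 'a set \<Rightarrow> ('k, 'm) module \<Rightarrow> ('a \<Rightarrow> 'm \<Rightarrow> 'm) \<Rightarrow>
     'a \<Rightarrow> ('a \<Rightarrow> 'm) \<Rightarrow> 'a \<Rightarrow> 'm" where
  "der_act L H M act x d = (\<lambda>z\<in>H. act x (d z) \<ominus>\<^bsub>M\<^esub> d (x \<otimes>\<^bsub>L\<^esub> z))"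

definition H1_act ::
    "('k, 'r) ring_scheme \<Rightarrow> ('k, 'a) module \<Rightarrow> 'a set \<Rightarrow> ('k, 'm) module \<Rightarrow> ('a \<Rightarrow> 'm \<Rightarrow> 'm) \<Rightarrow>
     'a set \<Rightarrow> ('a \<Rightarrow> 'm) set \<Rightarrow> ('a \<Rightarrow> 'm) set" where
  "H1_act K L H M act X C = (\<Union>x\<in>X. \<Union>d\<in>C.
     inner_ders (subalg L H) M act +>\<^bsub>der_space K (subalg L H) M act\<^esub> der_act L H M act x d)"

definition H1_inv ::
    "('k, 'r) ring_scheme \<Rightarrow> ('k, 'a) module \<Rightarrow> 'a set \<Rightarrow> ('k, 'm) module \<Rightarrow> ('a \<Rightarrow> 'm \<Rightarrow> 'm) \<Rightarrow>
     ('k, ('a \<Rightarrow> 'm) set) module" where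
  "H1_inv K L H M act = subalg (H1 K (subalg L H) M act)
     (invariants (quot_alg L H) (H1 K (subalg L H) M act) (H1_act K L H M act))"


section \<open>The maps of the sequence\<close>

definition inf1 ::
    "('k, 'r) ring_scheme \<Rightarrow> ('k, 'a) module \<Rightarrow> 'a set \<Rightarrow> ('k, 'm) module \<Rightarrow> ('a \<Rightarrow> 'm \<Rightarrow> 'm) \<Rightarrow>
     ('a set \<Rightarrow> 'm) set \<Rightarrow> ('a \<Rightarrow> 'm) set" where
  "inf1 K L H M act = induced (der_space K L M act) (inner_ders L M act)
     (\<lambda>d. \<lambda>x\<in>carrier L. d (H +>\<^bsub>L\<^esub> x))"

definition inf2 ::
    "('k, 'r) ring_scheme \<Rightarrow> ('k, 'a) module \<Rightarrow> 'a set \<Rightarrow> ('k, 'm) module \<Rightarrow> ('a \<Rightarrow> 'm \<Rightarrow> 'm) \<Rightarrow>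
     ('a set \<times> 'a set \<Rightarrow> 'm) set \<Rightarrow> ('a \<times> 'a \<Rightarrow> 'm) set" where
  "inf2 K L H M act = induced (cocycle_space K L M act) (coboundaries2 K L M act)
     (\<lambda>f. \<lambda>(x, y)\<in>carrier L \<times> carrier L. f (H +>\<^bsub>L\<^esub> x, H +>\<^bsub>L\<^esub> y))"

definition res1 ::
    "('k, 'r) ring_scheme \<Rightarrow> ('k, 'a) module \<Rightarrow> 'a set \<Rightarrow> ('k, 'm) module \<Rightarrow> ('a \<Rightarrow> 'm \<Rightarrow> 'm) \<Rightarrow>
     ('a \<Rightarrow> 'm) set \<Rightarrow> ('a \<Rightarrow> 'm) set" where
  "res1 K L H M act =
     induced (der_space K (subalg L H) M act) (inner_ders (subalg L H) M act) (\<lambda>d. restrict d H)"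

definition res2 ::
    "('k, 'r) ring_scheme \<Rightarrow> ('k, 'a) module \<Rightarrow> 'a set \<Rightarrow> ('k, 'm) module \<Rightarrow> ('a \<Rightarrow> 'm \<Rightarrow> 'm) \<Rightarrow>
     ('a \<times> 'a \<Rightarrow> 'm) set \<Rightarrow> ('a \<times> 'a \<Rightarrow> 'm) set" where
  "res2 K L H M act =
     induced (cocycle_space K (subalg L H) M act) (coboundaries2 K (subalg L H) M act)
       (\<lambda>f. restrict f (H \<times> H))"

definition H2_1 ::
    "('k, 'r) ring_scheme \<Rightarrow> ('k, 'a) module \<Rightarrow> 'a set \<Rightarrow> ('k, 'm) module \<Rightarrow> ('a \<Rightarrow> 'm \<Rightarrow> 'm) \<Rightarrow>
     ('k, ('a \<times> 'a \<Rightarrow> 'm) set) module" where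
  "H2_1 K L H M act = subalg (H2 K L M act)
     (a_kernel (H2 K L M act) (H2 K (subalg L H) M act) (res2 K L H M act))"

definition semidirect ::
    "('k, 'a) module \<Rightarrow> ('k, 'm) module \<Rightarrow> ('a \<Rightarrow> 'm \<Rightarrow> 'm) \<Rightarrow> ('k, 'm \<times> 'a) module" where
  "semidirect L M act =
    \<lparr>carrier = carrier M \<times> carrier L,
     mult = (\<lambda>(m, x) (n, y). (act x n \<ominus>\<^bsub>M\<^esub> act y m, x \<otimes>\<^bsub>L\<^esub> y)), one = undefined,
     zero = (\<zero>\<^bsub>M\<^esub>, \<zero>\<^bsub>L\<^esub>), add = (\<lambda>(m, x) (n, y). (m \<oplus>\<^bsub>M\<^esub> n, x \<oplus>\<^bsub>L\<^esub> y)),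
     smult = (\<lambda>a (m, x). (a \<odot>\<^bsub>M\<^esub> m, a \<odot>\<^bsub>L\<^esub> x))\<rparr>"

definition graph_map :: "('a \<Rightarrow> 'm) \<Rightarrow> 'a \<Rightarrow> 'm \<times> 'a" where
  "graph_map d z = (d z, z)"

definition tr_idealizer ::
    "('k, 'a) module \<Rightarrow> 'a set \<Rightarrow> ('k, 'm) module \<Rightarrow> ('a \<Rightarrow> 'm \<Rightarrow> 'm) \<Rightarrow> ('a \<Rightarrow> 'm) \<Rightarrow>
     ('m \<times> 'a) set" where
  "tr_idealizer L H M act d = {y \<in> carrier (semidirect L M act).
     \<forall>z\<in>H. y \<otimes>\<^bsub>semidirect L M act\<^esub> graph_map d z \<in> graph_map d ` H}"

definition tr_der ::
    "('k, 'r) ring_scheme \<Rightarrow> ('k, 'a) module \<Rightarrow> 'a set \<Rightarrow> ('k, 'm) module \<Rightarrow> ('a \<Rightarrow> 'm \<Rightarrow> 'm) \<Rightarrow>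
     ('a \<Rightarrow> 'm) \<Rightarrow> ('a set \<times> 'a set \<Rightarrow> 'm) set" where
  "tr_der K L H M act d =
     ext_class K (quot_alg L H) (inv_module L H M act) (inv_act act)
       (quot_alg (subalg (semidirect L M act) (tr_idealizer L H M act d)) (graph_map d ` H))
       (\<lambda>m. graph_map d ` H +>\<^bsub>semidirect L M act\<^esub> (m, \<zero>\<^bsub>L\<^esub>))
       (induced L H snd)"

definition tr ::
    "('k, 'r) ring_scheme \<Rightarrow> ('k, 'a) module \<Rightarrow> 'a set \<Rightarrow> ('k, 'm) module \<Rightarrow> ('a \<Rightarrow> 'm \<Rightarrow> 'm) \<Rightarrow>
     ('a \<Rightarrow> 'm) set \<Rightarrow> ('a set \<times> 'a set \<Rightarrow> 'm) set" where
  "tr K L H M act C = (THE c. \<exists>d\<in>C. c = tr_der K L H M act d)"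

definition partial_splittings ::
    "('k, 'r) ring_scheme \<Rightarrow> ('k, 'a) module \<Rightarrow> 'a set \<Rightarrow> ('k, 'e) module \<Rightarrow> ('e \<Rightarrow> 'a) \<Rightarrow>
     ('a \<Rightarrow> 'e) set" where
  "partial_splittings K L H E p = {s \<in> lie_homs K (subalg L H) E. \<forall>z\<in>H. p (s z) = z}"

definition ext_der ::
    "('k, 'a) module \<Rightarrow> 'a set \<Rightarrow> ('k, 'm) module \<Rightarrow> ('k, 'e) module \<Rightarrow> ('m \<Rightarrow> 'e) \<Rightarrow>
     ('e \<Rightarrow> 'a) \<Rightarrow> ('a \<Rightarrow> 'e) \<Rightarrow> 'e \<Rightarrow> 'a \<Rightarrow> 'm" where
  "ext_der L H M E i p s y = (\<lambda>z\<in>H.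
     inv_into (carrier M) i ((y \<otimes>\<^bsub>E\<^esub> s z) \<ominus>\<^bsub>E\<^esub> s (p y \<otimes>\<^bsub>L\<^esub> z)))"

definition rho_bar ::
    "('k, 'r) ring_scheme \<Rightarrow> ('k, 'a) module \<Rightarrow> 'a set \<Rightarrow> ('k, 'm) module \<Rightarrow> ('a \<Rightarrow> 'm \<Rightarrow> 'm) \<Rightarrow>
     ('k, 'e) module \<Rightarrow> ('m \<Rightarrow> 'e) \<Rightarrow> ('e \<Rightarrow> 'a) \<Rightarrow> ('a \<Rightarrow> 'e) \<Rightarrow> 'a set \<Rightarrow> ('a \<Rightarrow> 'm) set" where
  "rho_bar K L H M act E i p s = (\<lambda>X\<in>carrier (quot_alg L H).
     THE C. \<exists>y\<in>carrier E. H +>\<^bsub>L\<^esub> p y = X \<and>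
       C = inner_ders (subalg L H) M act +>\<^bsub>der_space K (subalg L H) M act\<^esub>
             ext_der L H M E i p s y)"

text \<open>
  The extensions are taken with underlying type \<open>'m \<times> 'a\<close>. This is no restriction: a choice of
  linear section identifies the space of any extension of \<open>L\<close> by \<open>M\<close> with
  \<open>carrier M \<times> carrier L\<close>, so each equivalence class has a representative of this type.
\<close>

definition rho ::
    "('k, 'r) ring_scheme \<Rightarrow> ('k, 'a) module \<Rightarrow> 'a set \<Rightarrow> ('k, 'm) module \<Rightarrow> ('a \<Rightarrow> 'm \<Rightarrow> 'm) \<Rightarrow>
     ('a \<times> 'a \<Rightarrow> 'm) set \<Rightarrow> ('a set \<Rightarrow> ('a \<Rightarrow> 'm) set) set" where
  "rho K L H M act c = (THE r. \<exists>(E :: ('k, 'm \<times> 'a) module) i p s.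
     lie_extension K L M act E i p \<and> ext_class K L M act E i p = c \<and>
     s \<in> partial_splittings K L H E p \<and>
     r = inner_ders (quot_alg L H) (H1 K (subalg L H) M act) (H1_act K L H M act)
           +>\<^bsub>der_space K (quot_alg L H) (H1 K (subalg L H) M act) (H1_act K L H M act)\<^esub>
         rho_bar K L H M act E i p s)"


section \<open>Exactness\<close>

definition exact_at ::
    "('k, 'r) ring_scheme \<Rightarrow> ('k, 'a) module \<Rightarrow> ('a \<Rightarrow> 'b) \<Rightarrow> ('k, 'b) module \<Rightarrow>
     ('b \<Rightarrow> 'c) \<Rightarrow> ('k, 'c) module \<Rightarrow> bool" where
  "exact_at K U f V g W \<longleftrightarrow> f \<in> module_homs K U V \<and> g \<in> module_homs K V W \<and>
     f ` carrier U = a_kernel V W g"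

end

theory Submission
  imports Defs
begin

text \<open>
  A linear section turns an extension into a 2-cocycle, so that all maps are described by
  cochains.

  If \<open>[d]\<close> is an invariant class in \<open>H\<^sup>1(H, M)\<close>, then \<open>d\<close> extends to a linear map \<open>t : L \<rightarrow> M\<close> such
  that the derivation \<open>x \<cdot> d\<close> of \<open>H\<close> is inner with respect to \<open>t x\<close>, for all \<open>x\<close>. This says that the
  coboundary of \<open>t\<close> vanishes on \<open>L \<times> H\<close>, so it is inflated from a cocycle of \<open>L / H\<close> with values in
  \<open>M\<^sup>H\<close>. That cocycle represents \<open>tr [d]\<close>, as \<open>x \<mapsto> (t x, x)\<close> induces a linear section of the
  extension defining \<open>tr [d]\<close>.

  A partial splitting extends to a linear section, whose cocycle \<open>f\<close> vanishes on \<open>H \<times> H\<close>; then \<open>\<rho>\<close>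
  maps \<open>[f]\<close> to the class of \<open>x \<mapsto> [f(x, -)]\<close>. If this derivation is inner, given by \<open>[d]\<close>, then
  subtracting the coboundary of a linear extension of \<open>d\<close> makes all \<open>f(x, -)\<close> inner on \<open>H\<close>, say
  given by \<open>t x\<close> with \<open>t\<close> linear and zero on \<open>H\<close>, and adding the coboundary of \<open>t\<close> makes \<open>f\<close>
  vanish on \<open>L \<times> H\<close>, so that \<open>f\<close> is inflated.

  The linear choices exist because subspaces have complements.
\<close>

text \<open>The maps \<open>tr\<close> and \<open>rho\<close> are definite descriptions ranging over
  representatives, extensions, sections and splittings, so nothing can be computed before each
  choice is shown to be immaterial. Both are therefore replaced by relations between cochains,
  \<open>tr_datum\<close> and \<open>rho_der\<close>: a solution exists, any two give the same
  class, and linearity and exactness are checked on cochains. For \<open>rho\<close> the description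
  must also be inhabited: every 2-cocycle is realised by a twisted bracket on M \<times> L. The
  delicate point is to choose t linearly while prescribing it on \<open>H\<close>. The element m
  with x \<cdot> d = \<delta>(m) is determined only up to M^H, so it is taken through a linear
  section of \<delta> : M \<rightarrow> Inn(H, M); but such a section knows nothing about d. Hence
  \<delta>(b x) is subtracted beforehand, where b is a linear extension of d: the rest of x \<cdot>
  d is still inner, and it vanishes for x in \<open>H\<close> because z \<cdot> d = \<delta>(d z)
  for z in \<open>H\<close>. A linear section keeps this zero. The same lemma on linear choices
  serves the last step for \<open>rho\<close>.\<close>

lemma (in abelian_group) minus_zero_eq: "\<ominus> \<zero> = \<zero>"
  by simp

text \<open>Registers the additive laws with the \<open>algebra\<close> method. The bracket and the
  module action are added to the same normalisation later, in \<open>lie_alg\<close> and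
  \<open>lie_rep\<close>, so that additive identities between brackets and action terms are decided
  by normal forms.\<close>

lemmas (in abelian_group) abelian_group_simprules
  [algebra add: abelian_group "zero G" "add G" "a_inv G" "a_minus G"] =
  a_closed zero_closed a_inv_closed minus_closed a_assoc l_zero l_neg a_comm
  minus_eq r_zero r_neg r_neg2 r_neg1 minus_add minus_minus minus_zero_eq a_lcomm

lemma (in abelian_group) minus_eq_zero_iff:
  "\<lbrakk>x \<in> carrier G; y \<in> carrier G\<rbrakk> \<Longrightarrow> x \<ominus> y = \<zero> \<longleftrightarrow> x = y"
  by (metis add.inv_closed minus_equality minus_minus minus_eq r_neg)

lemma (in abelian_group) eq_minus_iff:
  "\<lbrakk>x \<in> carrier G; y \<in> carrier G; z \<in> carrier G\<rbrakk> \<Longrightarrow> x = y \<ominus> z \<longleftrightarrow> x \<oplus> z = y"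
  by (auto simp: minus_eq a_assoc l_neg r_neg)

section \<open>Linear maps\<close>

text \<open>
  The library locale \<^locale>\<open>module\<close> allows extensions of the record type, which the definitions of
  the cohomology spaces do not.
\<close>

locale linear_space = module K V
  for K :: "('k, 'r) ring_scheme" (structure) and V :: "('k, 'v) module" (structure)

lemma linear_space_iff: "linear_space K V \<longleftrightarrow> module K V"
  by (simp add: linear_space_def)

lemma module_homsI:
  assumes "\<And>x. x \<in> carrier V \<Longrightarrow> f x \<in> carrier W"
    and "\<And>x y. \<lbrakk>x \<in> carrier V; y \<in> carrier V\<rbrakk> \<Longrightarrow> f (x \<oplus>\<^bsub>V\<^esub> y) = f x \<oplus>\<^bsub>W\<^esub> f y"
    and "\<And>a x. \<lbrakk>a \<in> carrier K; x \<in> carrier V\<rbrakk> \<Longrightarrow> f (a \<odot>\<^bsub>V\<^esub> x) = a \<odot>\<^bsub>W\<^esub> f x"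
  shows "f \<in> module_homs K V W"
  using assms by (auto simp: module_homs_def)

lemma module_homs_closed: "\<lbrakk>f \<in> module_homs K V W; x \<in> carrier V\<rbrakk> \<Longrightarrow> f x \<in> carrier W"
  by (auto simp: module_homs_def)

lemma module_homs_add:
  "\<lbrakk>f \<in> module_homs K V W; x \<in> carrier V; y \<in> carrier V\<rbrakk> \<Longrightarrow> f (x \<oplus>\<^bsub>V\<^esub> y) = f x \<oplus>\<^bsub>W\<^esub> f y"
  by (auto simp: module_homs_def)

lemma module_homs_smult:
  "\<lbrakk>f \<in> module_homs K V W; a \<in> carrier K; x \<in> carrier V\<rbrakk> \<Longrightarrow> f (a \<odot>\<^bsub>V\<^esub> x) = a \<odot>\<^bsub>W\<^esub> f x"
  by (auto simp: module_homs_def)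

lemma module_homs_zero:
  assumes "f \<in> module_homs K V W" "module K V" "module K W"
  shows "f \<zero>\<^bsub>V\<^esub> = \<zero>\<^bsub>W\<^esub>"
proof -
  interpret V: linear_space K V unfolding linear_space_iff by fact
  interpret W: linear_space K W unfolding linear_space_iff by fact
  have "f \<zero>\<^bsub>V\<^esub> = f (\<zero>\<^bsub>K\<^esub> \<odot>\<^bsub>V\<^esub> \<zero>\<^bsub>V\<^esub>)" by simp
  also have "\<dots> = \<zero>\<^bsub>W\<^esub>"
    using assms(1) by (subst module_homs_smult) (auto simp: module_homs_closed)
  finally show ?thesis .
qed

lemma module_homs_neg:
  assumes "f \<in> module_homs K V W" "module K V" "module K W" "x \<in> carrier V"
  shows "f (\<ominus>\<^bsub>V\<^esub> x) = \<ominus>\<^bsub>W\<^esub> f x"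
proof -
  interpret V: linear_space K V unfolding linear_space_iff by fact
  interpret W: linear_space K W unfolding linear_space_iff by fact
  have "f (\<ominus>\<^bsub>V\<^esub> x) \<oplus>\<^bsub>W\<^esub> f x = f (\<ominus>\<^bsub>V\<^esub> x \<oplus>\<^bsub>V\<^esub> x)"
    using assms by (simp add: module_homs_add)
  also have "\<dots> = \<zero>\<^bsub>W\<^esub>"
    using assms by (simp add: V.l_neg module_homs_zero)
  finally show ?thesis
    using assms by (metis W.minus_equality module_homs_closed V.a_inv_closed)
qed

lemma module_homs_minus:
  assumes "f \<in> module_homs K V W" "module K V" "module K W" "x \<in> carrier V" "y \<in> carrier V"
  shows "f (x \<ominus>\<^bsub>V\<^esub> y) = f x \<ominus>\<^bsub>W\<^esub> f y"
proof -
  interpret V: linear_space K V unfolding linear_space_iff by fact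
  show ?thesis
    using assms by (simp add: a_minus_def module_homs_add module_homs_neg)
qed

lemma module_homs_comp:
  "\<lbrakk>f \<in> module_homs K U V; g \<in> module_homs K V W\<rbrakk> \<Longrightarrow> (\<lambda>x. g (f x)) \<in> module_homs K U W"
  by (auto simp: module_homs_def Pi_def)

text \<open>Membership depends only on the values on the carrier. This is invoked whenever a linear
  map is restricted in order to become an extensional element of a function space.\<close>

lemma module_homs_cong:
  assumes "f \<in> module_homs K V W" "module K V" "\<And>x. x \<in> carrier V \<Longrightarrow> f x = g x"
  shows "g \<in> module_homs K V W"
proof -
  interpret V: linear_space K V unfolding linear_space_iff by fact
  show ?thesis
    using assms(1)
    by (auto simp: module_homs_def Pi_def assms(3)[symmetric])
qed

lemma module_homs_sum:
  assumes "f \<in> module_homs K V W" "g \<in> module_homs K V W" "module K W"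
  shows "(\<lambda>x. f x \<oplus>\<^bsub>W\<^esub> g x) \<in> module_homs K V W"
proof -
  interpret W: linear_space K W unfolding linear_space_iff by fact
  show ?thesis
  proof (rule module_homsI)
    fix x y assume xy: "x \<in> carrier V" "y \<in> carrier V"
    note c = xy[THEN module_homs_closed[OF assms(1)]] xy[THEN module_homs_closed[OF assms(2)]]
    show "f (x \<oplus>\<^bsub>V\<^esub> y) \<oplus>\<^bsub>W\<^esub> g (x \<oplus>\<^bsub>V\<^esub> y) = f x \<oplus>\<^bsub>W\<^esub> g x \<oplus>\<^bsub>W\<^esub> (f y \<oplus>\<^bsub>W\<^esub> g y)"
      unfolding module_homs_add[OF assms(1) xy] module_homs_add[OF assms(2) xy] using c by algebra
  qed (use assms in \<open>auto simp: module_homs_closed module_homs_smult W.smult_r_distr\<close>)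
qed

lemma module_homs_diff:
  assumes "f \<in> module_homs K V W" "g \<in> module_homs K V W" "module K W"
  shows "(\<lambda>x. f x \<ominus>\<^bsub>W\<^esub> g x) \<in> module_homs K V W"
proof -
  interpret W: linear_space K W unfolding linear_space_iff by fact
  show ?thesis
  proof (rule module_homsI)
    fix x y assume xy: "x \<in> carrier V" "y \<in> carrier V"
    note c = xy[THEN module_homs_closed[OF assms(1)]] xy[THEN module_homs_closed[OF assms(2)]]
    show "f (x \<oplus>\<^bsub>V\<^esub> y) \<ominus>\<^bsub>W\<^esub> g (x \<oplus>\<^bsub>V\<^esub> y) = f x \<ominus>\<^bsub>W\<^esub> g x \<oplus>\<^bsub>W\<^esub> (f y \<ominus>\<^bsub>W\<^esub> g y)"
      unfolding module_homs_add[OF assms(1) xy] module_homs_add[OF assms(2) xy] using c by algebra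
  qed (use assms in \<open>auto simp: module_homs_closed module_homs_smult W.smult_r_distr a_minus_def
        W.smult_r_minus\<close>)
qed

lemma module_homs_scale:
  assumes "f \<in> module_homs K V W" "a \<in> carrier K" "module K W"
  shows "(\<lambda>x. a \<odot>\<^bsub>W\<^esub> f x) \<in> module_homs K V W"
proof -
  interpret W: linear_space K W unfolding linear_space_iff by fact
  show ?thesis
    by (rule module_homsI)
      (use assms in \<open>auto simp: module_homs_closed module_homs_smult module_homs_add W.smult_r_distr
         W.smult_assoc1[symmetric] W.R.m_comm\<close>)
qed

lemma module_homs_const_zero: "module K W \<Longrightarrow> (\<lambda>x. \<zero>\<^bsub>W\<^esub>) \<in> module_homs K V W"
  by (rule module_homsI) (auto simp: module.smult_r_null abelian_groupE(2,5) module_def)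

lemma module_homs_subalg: "f \<in> module_homs K V W \<Longrightarrow> S \<subseteq> carrier V \<Longrightarrow> f \<in> module_homs K (subalg V S) W"
  by (auto simp: module_homs_def Pi_def subset_eq)

lemma module_homs_into_subalg:
  "f \<in> module_homs K V (subalg W S) \<longleftrightarrow> f \<in> module_homs K V W \<and> f ` carrier V \<subseteq> S"
  if "S \<subseteq> carrier W"
  using that by (auto simp: module_homs_def Pi_def subset_eq)

section \<open>Subspaces and quotients\<close>

lemma submodule_abelian_subgroup:
  assumes "submodule W K V" "module K V" shows "abelian_subgroup W V"
  using assms by (auto intro!: abelian_subgroupI3 additive_subgroupI simp: submodule_def module_def)

lemma (in module) submodule_minus_closed:
  "\<lbrakk>submodule W R M; v \<in> W; w \<in> W\<rbrakk> \<Longrightarrow> v \<ominus>\<^bsub>M\<^esub> w \<in> W"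
  using submoduleE by (metis a_minus_def)

lemma (in module) submodule_zero: "submodule W R M \<Longrightarrow> \<zero>\<^bsub>M\<^esub> \<in> W"
  by (metis submodule_def subgroup.one_closed monoid.select_convs(2))

lemma (in module) submodule_carrier: "submodule W R M \<Longrightarrow> w \<in> W \<Longrightarrow> w \<in> carrier M"
  using submoduleE(1) by blast

lemma module_subalg: "\<lbrakk>submodule W K V; module K V\<rbrakk> \<Longrightarrow> module K (subalg V W)"
  by (rule submodule.submodule_is_module)

text \<open>The additive inverse of a record is a definite description over its carrier, so
  shrinking the carrier could change it. Since \<open>W\<close> contains the inverse taken in
  \<open>V\<close>, uniqueness of inverses identifies the two.\<close>

lemma a_inv_subalg:
  assumes "submodule W K V" "module K V" "v \<in> W"
  shows "\<ominus>\<^bsub>subalg V W\<^esub> v = \<ominus>\<^bsub>V\<^esub> v"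
proof -
  interpret V: linear_space K V unfolding linear_space_iff by fact
  interpret W: linear_space K "subalg V W" using assms by (simp add: module_subalg linear_space_iff)
  have "\<ominus>\<^bsub>V\<^esub> v \<in> W" "v \<in> carrier V" using assms V.submoduleE by blast+
  then show ?thesis
    using W.minus_equality[of "\<ominus>\<^bsub>V\<^esub> v" v] assms by (simp add: V.l_neg)
qed

lemma a_minus_subalg:
  "\<lbrakk>submodule W K V; module K V; w \<in> W\<rbrakk> \<Longrightarrow> v \<ominus>\<^bsub>subalg V W\<^esub> w = v \<ominus>\<^bsub>V\<^esub> w"
  by (simp add: a_minus_def a_inv_subalg)

lemma submodule_subalg:
  assumes "submodule B K V" "submodule Z K V" "B \<subseteq> Z" "module K V"
  shows "submodule B K (subalg V Z)"
proof -
  interpret V: linear_space K V unfolding linear_space_iff by fact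
  interpret W: linear_space K "subalg V Z" using assms by (simp add: module_subalg linear_space_iff)
  show ?thesis
    using assms by (intro W.submoduleI)
      (auto simp: V.submoduleE a_inv_subalg subset_eq V.submodule_zero)
qed

lemma (in linear_space) submodule_kernel:
  assumes "f \<in> module_homs K V W" "module K W"
  shows "submodule (a_kernel V W f) K V"
proof -
  interpret W: linear_space K W unfolding linear_space_iff by fact
  show ?thesis
    by (rule submoduleI)
      (use assms module_axioms in \<open>auto simp: a_kernel_def' module_homs_add module_homs_neg
        module_homs_smult module_homs_zero
         module_homs_closed\<close>)
qed

lemma submodule_image:
  assumes "f \<in> module_homs K V W" "module K V" "module K W" "submodule S K V"
  shows "submodule (f ` S) K W"
proof -
  interpret V: linear_space K V unfolding linear_space_iff by fact
  interpret W: linear_space K W unfolding linear_space_iff by fact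
  note [simp] = V.submodule_carrier[OF assms(4)] V.submoduleE(3-5)[OF assms(4)]
  show ?thesis
  proof (rule W.submoduleI)
    show "\<zero>\<^bsub>W\<^esub> \<in> f ` S"
      using V.submodule_zero[OF assms(4)] module_homs_zero[OF assms(1-3)] by (metis imageI)
    fix a b assume "a \<in> f ` S" "b \<in> f ` S"
    then obtain x y where xy: "x \<in> S" "y \<in> S" "a = f x" "b = f y" by auto
    show "\<ominus>\<^bsub>W\<^esub> a \<in> f ` S"
      unfolding xy by (rule image_eqI[of _ _ "\<ominus>\<^bsub>V\<^esub> x"]) (use assms(1-3) xy in \<open>auto simp:
        module_homs_neg\<close>)
    show "a \<oplus>\<^bsub>W\<^esub> b \<in> f ` S"
      unfolding xy by (rule image_eqI[of _ _ "x \<oplus>\<^bsub>V\<^esub> y"]) (use assms(1) xy in \<open>auto simp: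
        module_homs_add\<close>)
  next
    fix a b assume "a \<in> carrier K" "b \<in> f ` S"
    then obtain y where xy: "y \<in> S" "b = f y" by auto
    show "a \<odot>\<^bsub>W\<^esub> b \<in> f ` S"
      unfolding xy
      by (rule image_eqI[of _ _ "a \<odot>\<^bsub>V\<^esub> y"]) (use assms(1) xy \<open>a \<in> carrier K\<close> in \<open>auto simp:
        module_homs_smult\<close>)
  qed (use assms(1) in \<open>auto simp: module_homs_closed\<close>)
qed

text \<open>Forming a coset uses the addition of the record only, never its carrier. Hence the
  elements of a quotient of \<open>subalg V S\<close> may be written with the cosets of
  \<open>V\<close>.\<close>

lemma a_r_coset_subalg [simp]: "W +>\<^bsub>subalg V S\<^esub> v = W +>\<^bsub>V\<^esub> v"
  by (simp add: a_r_coset_def')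

lemma quot_alg_simps [simp]:
  "carrier (quot_alg V W) = (\<lambda>v. W +>\<^bsub>V\<^esub> v) ` carrier V"
  "zero (quot_alg V W) = W"
  "add (quot_alg V W) = set_add V"
  "mult (quot_alg V W) = rcoset_mult V W"
  "smult (quot_alg V W) = (\<lambda>a X. \<Union>x\<in>X. W +>\<^bsub>V\<^esub> (a \<odot>\<^bsub>V\<^esub> x))"
  by (auto simp: quot_alg_def ring.extend_def module.fields_def FactRing_def A_RCOSETS_def'
    a_r_coset_def')

context linear_space
begin

lemma mem_rcos_iff:
  assumes "submodule W K V" "v \<in> carrier V" "w \<in> carrier V"
  shows "w \<in> W +>\<^bsub>V\<^esub> v \<longleftrightarrow> w \<ominus>\<^bsub>V\<^esub> v \<in> W"
proof -
  interpret abelian_subgroup W V using assms module_axioms by (simp add: submodule_abelian_subgroup)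
  show ?thesis using assms a_rcos_module by (simp add: minus_eq)
qed

lemma rcos_eq_iff:
  assumes "submodule W K V" "v \<in> carrier V" "w \<in> carrier V"
  shows "W +>\<^bsub>V\<^esub> v = W +>\<^bsub>V\<^esub> w \<longleftrightarrow> v \<ominus>\<^bsub>V\<^esub> w \<in> W"
proof -
  interpret abelian_subgroup W V using assms module_axioms by (simp add: submodule_abelian_subgroup)
  show ?thesis
    using assms a_repr_independence' a_repr_independenceD mem_rcos_iff by metis
qed

lemma rcos_mem:
  assumes "submodule W K V" "v \<in> carrier V" "w \<in> W +>\<^bsub>V\<^esub> v"
  shows "w \<in> carrier V" "W +>\<^bsub>V\<^esub> w = W +>\<^bsub>V\<^esub> v"
proof -
  interpret abelian_subgroup W V using assms module_axioms by (simp add: submodule_abelian_subgroup)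
  show "w \<in> carrier V" "W +>\<^bsub>V\<^esub> w = W +>\<^bsub>V\<^esub> v"
    using assms a_elemrcos_carrier a_repr_independence' by auto
qed

lemma rcos_self: "\<lbrakk>submodule W K V; v \<in> carrier V\<rbrakk> \<Longrightarrow> v \<in> W +>\<^bsub>V\<^esub> v"
  by (simp add: mem_rcos_iff r_neg minus_eq submodule_zero)

lemma rcos_zero: "submodule W K V \<Longrightarrow> W +>\<^bsub>V\<^esub> \<zero>\<^bsub>V\<^esub> = W"
  by (simp add: submoduleE(1))

lemma rcos_absorb: "\<lbrakk>submodule W K V; w \<in> W\<rbrakk> \<Longrightarrow> W +>\<^bsub>V\<^esub> w = W"
  using rcos_eq_iff[of W w "\<zero>\<^bsub>V\<^esub>"] rcos_zero[of W] submodule_carrier[of W w]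
  by (simp add: minus_eq minus_zero_eq)

text \<open>Scalar multiples and brackets in \<open>quot_alg\<close>, as well as
  \<open>induced\<close> and \<open>H1_act\<close>, are written as unions over representatives. Such
  a union collapses when all representatives contribute the same set; the well-definedness proofs
  for these constructions pass through here.\<close>

lemma Union_rcos_const:
  assumes "submodule W K V" "v \<in> carrier V"
    and "\<And>w. \<lbrakk>w \<in> carrier V; W +>\<^bsub>V\<^esub> w = W +>\<^bsub>V\<^esub> v\<rbrakk> \<Longrightarrow> F w = X"
  shows "(\<Union>w\<in>W +>\<^bsub>V\<^esub> v. F w) = X"
  using assms rcos_mem[OF assms(1,2)] rcos_self[OF assms(1,2)] by blast

lemma quot_add:
  assumes "submodule W K V" "v \<in> carrier V" "w \<in> carrier V"
  shows "(W +>\<^bsub>V\<^esub> v) \<oplus>\<^bsub>quot_alg V W\<^esub> (W +>\<^bsub>V\<^esub> w) = W +>\<^bsub>V\<^esub> (v \<oplus>\<^bsub>V\<^esub> w)"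
proof -
  interpret abelian_subgroup W V using assms module_axioms by (simp add: submodule_abelian_subgroup)
  show ?thesis using assms by (simp add: a_rcos_sum)
qed

lemma quot_smult:
  assumes "submodule W K V" "v \<in> carrier V" "a \<in> carrier K"
  shows "a \<odot>\<^bsub>quot_alg V W\<^esub> (W +>\<^bsub>V\<^esub> v) = W +>\<^bsub>V\<^esub> (a \<odot>\<^bsub>V\<^esub> v)"
  unfolding quot_alg_simps
proof (rule Union_rcos_const)
  fix w assume w: "w \<in> carrier V" "W +>\<^bsub>V\<^esub> w = W +>\<^bsub>V\<^esub> v"
  then have "a \<odot>\<^bsub>V\<^esub> (w \<ominus>\<^bsub>V\<^esub> v) \<in> W"
    using assms rcos_eq_iff submoduleE(4) by blast
  then show "W +>\<^bsub>V\<^esub> (a \<odot>\<^bsub>V\<^esub> w) = W +>\<^bsub>V\<^esub> (a \<odot>\<^bsub>V\<^esub> v)"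
    using assms w by (simp add: rcos_eq_iff minus_eq smult_r_distr smult_r_minus)
qed (use assms in auto)

lemma module_quot:
  assumes W: "submodule W K V"
  shows "module K (quot_alg V W)"
proof -
  note [simp] = quot_add[OF W] quot_smult[OF W]
  \<comment> \<open>The operations stay folded, so that \<open>quot_add\<close> and
    \<open>quot_smult\<close> turn each axiom into the same axiom for representatives.\<close>
  note [simp del] = quot_alg_simps(2-5)
  have Z: "\<zero>\<^bsub>quot_alg V W\<^esub> = W +>\<^bsub>V\<^esub> \<zero>\<^bsub>V\<^esub>" using W by (simp add: rcos_zero quot_alg_simps(2))
  have "abelian_group (quot_alg V W)"
  proof (rule abelian_groupI)
    fix x assume "x \<in> carrier (quot_alg V W)"
    then obtain v where v: "v \<in> carrier V" "x = W +>\<^bsub>V\<^esub> v" by auto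
    then show "\<exists>y\<in>carrier (quot_alg V W). y \<oplus>\<^bsub>quot_alg V W\<^esub> x = \<zero>\<^bsub>quot_alg V W\<^esub>"
      by (auto intro!: bexI[of _ "\<ominus>\<^bsub>V\<^esub> v"] simp: Z l_neg)
  qed (auto simp: Z M.a_assoc M.a_comm M.a_lcomm simp del: a_coset_add_zero)
  then show ?thesis
    by (intro moduleI) (auto simp: is_cring R.is_cring smult_l_distr smult_r_distr smult_assoc1)
qed

lemma quot_proj_hom: "submodule W K V \<Longrightarrow> (\<lambda>v. W +>\<^bsub>V\<^esub> v) \<in> module_homs K V (quot_alg V W)"
  by (rule module_homsI) (auto simp: quot_add quot_smult simp del: quot_alg_simps(2-5))

lemma quot_minus:
  "\<lbrakk>submodule W K V; v \<in> carrier V; w \<in> carrier V\<rbrakk> \<Longrightarrow>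
    (W +>\<^bsub>V\<^esub> v) \<ominus>\<^bsub>quot_alg V W\<^esub> (W +>\<^bsub>V\<^esub> w) = W +>\<^bsub>V\<^esub> (v \<ominus>\<^bsub>V\<^esub> w)"
  using module_homs_minus[OF quot_proj_hom _ module_quot, of W v w] module_axioms by simp

text \<open>Every element of the quotient is the coset of some v, so a formula for \<open>F\<close>
  on cosets by a linear f is enough; well-definedness is hidden in the assumption that
  \<open>F\<close> satisfies such a formula.\<close>

lemma quot_homI:
  assumes W: "submodule W K V" and f: "f \<in> module_homs K V N"
    and F: "\<And>v. v \<in> carrier V \<Longrightarrow> F (W +>\<^bsub>V\<^esub> v) = f v"
  shows "F \<in> module_homs K (quot_alg V W) N"
  by (rule module_homsI)
    (use f in \<open>auto simp: quot_add[OF W] quot_smult[OF W] F module_homs_closed module_homs_add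
      module_homs_smult
        simp del: quot_alg_simps(2-5)\<close>)

text \<open>Two representatives differ by an element of \<open>W\<close>, which f carries into
  \<open>W'\<close>.\<close>

lemma induced_rcos:
  assumes W: "submodule W K V" and f: "f \<in> module_homs K V N" and "module K N"
    and W': "submodule W' K N" and sub: "f ` W \<subseteq> W'" and v: "v \<in> carrier V"
  shows "induced N W' f (W +>\<^bsub>V\<^esub> v) = W' +>\<^bsub>N\<^esub> f v"
  unfolding induced_def
proof (rule Union_rcos_const[OF W v])
  interpret N: linear_space K N unfolding linear_space_iff by fact
  fix w assume w: "w \<in> carrier V" "W +>\<^bsub>V\<^esub> w = W +>\<^bsub>V\<^esub> v"
  then have "f (w \<ominus>\<^bsub>V\<^esub> v) \<in> W'"
    using rcos_eq_iff[OF W] v sub by blast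
  then show "W' +>\<^bsub>N\<^esub> f w = W' +>\<^bsub>N\<^esub> f v"
    using w v f by (simp add: N.rcos_eq_iff[OF W'] module_homs_minus[OF f module_axioms assms(3)]
      module_homs_closed)
qed

lemma induced_hom:
  assumes W: "submodule W K V" and f: "f \<in> module_homs K V N" and "module K N"
    and W': "submodule W' K N" and sub: "f ` W \<subseteq> W'"
  shows "induced N W' f \<in> module_homs K (quot_alg V W) (quot_alg N W')"
proof (rule quot_homI[OF W module_homs_comp[OF f]])
  interpret N: linear_space K N unfolding linear_space_iff by fact
  show "(+>\<^bsub>N\<^esub>) W' \<in> module_homs K N (quot_alg N W')" by (rule N.quot_proj_hom[OF W'])
qed (rule induced_rcos[OF assms])

end

section \<open>Spaces of functions with values in a vector space\<close>

lemma fun_space_simps [simp]: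
  "carrier (fun_space X N) = X \<rightarrow>\<^sub>E carrier N"
  "zero (fun_space X N) = (\<lambda>x\<in>X. \<zero>\<^bsub>N\<^esub>)"
  "add (fun_space X N) = (\<lambda>f g. \<lambda>x\<in>X. f x \<oplus>\<^bsub>N\<^esub> g x)"
  "smult (fun_space X N) = (\<lambda>a f. \<lambda>x\<in>X. a \<odot>\<^bsub>N\<^esub> f x)"
  by (simp_all add: fun_space_def)

lemma module_fun_space:
  assumes "module K N"
  shows "module K (fun_space X N)"
proof -
  interpret N: linear_space K N unfolding linear_space_iff by fact
  have "abelian_group (fun_space X N)"
  proof (rule abelian_groupI)
    fix f assume "f \<in> carrier (fun_space X N)"
    then show "\<exists>g\<in>carrier (fun_space X N). g \<oplus>\<^bsub>fun_space X N\<^esub> f = \<zero>\<^bsub>fun_space X N\<^esub>"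
      by (intro bexI[of _ "\<lambda>x\<in>X. \<ominus>\<^bsub>N\<^esub> f x"]) (auto simp: N.l_neg PiE_iff intro!: restrict_ext)
  next
    fix f assume "f \<in> carrier (fun_space X N)"
    then show "\<zero>\<^bsub>fun_space X N\<^esub> \<oplus>\<^bsub>fun_space X N\<^esub> f = f"
      by (auto simp: fun_eq_iff PiE_iff extensional_def)
  qed (auto simp: fun_eq_iff PiE_iff extensional_def N.a_assoc N.a_comm N.a_lcomm)
  then show ?thesis
    by (intro moduleI) (auto simp: N.R.is_cring N.smult_l_distr N.smult_r_distr N.smult_assoc1
       PiE_iff extensional_def fun_eq_iff)
qed

lemma fun_space_neg:
  assumes "module K N" "f \<in> X \<rightarrow>\<^sub>E carrier N"
  shows "\<ominus>\<^bsub>fun_space X N\<^esub> f = (\<lambda>x\<in>X. \<ominus>\<^bsub>N\<^esub> f x)"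
proof -
  interpret N: linear_space K N unfolding linear_space_iff by fact
  interpret F: linear_space K "fun_space X N" unfolding linear_space_iff
    by (rule module_fun_space) fact
  show ?thesis
    using assms(2) by (intro F.minus_equality) (auto simp: N.l_neg PiE_iff intro!: restrict_ext)
qed

lemma fun_space_minus:
  assumes "module K N" "f \<in> X \<rightarrow>\<^sub>E carrier N" "g \<in> X \<rightarrow>\<^sub>E carrier N"
  shows "f \<ominus>\<^bsub>fun_space X N\<^esub> g = (\<lambda>x\<in>X. f x \<ominus>\<^bsub>N\<^esub> g x)"
  using assms by (auto simp: a_minus_def fun_space_neg intro!: restrict_ext)

text \<open>Negation is scaling by -1, so closure under zero, sums and multiples suffices.\<close>

lemma fun_space_submoduleI:
  assumes N: "module K N" and sub: "S \<subseteq> X \<rightarrow>\<^sub>E carrier N"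
    and zero: "(\<lambda>x\<in>X. \<zero>\<^bsub>N\<^esub>) \<in> S"
    and add: "\<And>f g. \<lbrakk>f \<in> S; g \<in> S\<rbrakk> \<Longrightarrow> (\<lambda>x\<in>X. f x \<oplus>\<^bsub>N\<^esub> g x) \<in> S"
    and smult: "\<And>a f. \<lbrakk>a \<in> carrier K; f \<in> S\<rbrakk> \<Longrightarrow> (\<lambda>x\<in>X. a \<odot>\<^bsub>N\<^esub> f x) \<in> S"
  shows "submodule S K (fun_space X N)"
proof -
  interpret N: linear_space K N unfolding linear_space_iff by fact
  interpret F: linear_space K "fun_space X N" unfolding linear_space_iff
    by (rule module_fun_space) fact
  show ?thesis
  proof (rule F.submoduleI)
    fix f assume f: "f \<in> S"
    then have fc: "f \<in> X \<rightarrow>\<^sub>E carrier N" using sub by blast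
    have "\<ominus>\<^bsub>fun_space X N\<^esub> f = (\<lambda>x\<in>X. (\<ominus>\<^bsub>K\<^esub> \<one>\<^bsub>K\<^esub>) \<odot>\<^bsub>N\<^esub> f x)"
      unfolding fun_space_neg[OF N fc]
      by (rule restrict_ext) (use fc in \<open>auto simp: N.smult_l_minus PiE_iff\<close>)
    then show "\<ominus>\<^bsub>fun_space X N\<^esub> f \<in> S"
      using smult[OF _ f, of "\<ominus>\<^bsub>K\<^esub> \<one>\<^bsub>K\<^esub>"] by simp
  qed (use assms in auto)
qed

section \<open>Complements\<close>

text \<open>By Zorn there is a subspace \<open>C\<close> maximal among those meeting
  \<open>W\<close> only in zero. If some v were not in W + C, then C + K v would still meet
  \<open>W\<close> trivially and be strictly larger.\<close>

lemma (in linear_space) submodule_complement: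
  assumes field: "field K" and W: "submodule W K V"
  obtains C where "submodule C K V" "W \<inter> C = {\<zero>\<^bsub>V\<^esub>}"
    "\<And>v. v \<in> carrier V \<Longrightarrow> \<exists>w\<in>W. \<exists>c\<in>C. v = w \<oplus>\<^bsub>V\<^esub> c"
proof -
  define A where "A = {C. submodule C K V \<and> W \<inter> C \<subseteq> {\<zero>\<^bsub>V\<^esub>}}"
  have "submodule {\<zero>\<^bsub>V\<^esub>} K V"
    by (rule submoduleI) (auto simp: minus_zero_eq)
  then have ne: "A \<noteq> {}" by (auto simp: A_def)
  have "\<exists>C\<in>A. \<forall>X\<in>A. C \<subseteq> X \<longrightarrow> X = C"
  proof (rule subset_Zorn_nonempty[OF ne])
    fix \<C> assume \<C>: "\<C> \<noteq> {}" "subset.chain A \<C>"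
    then have sub: "submodule X K V" "W \<inter> X \<subseteq> {\<zero>\<^bsub>V\<^esub>}" if "X \<in> \<C>" for X
      using that by (auto simp: A_def subset.chain_def)
    have "submodule (\<Union>\<C>) K V"
    proof (rule submoduleI)
      show "\<Union>\<C> \<subseteq> carrier V" using sub submoduleE(1) by blast
      show "\<zero>\<^bsub>V\<^esub> \<in> \<Union>\<C>" using sub \<C>(1) submodule_zero by blast
      show "\<ominus>\<^bsub>V\<^esub> a \<in> \<Union>\<C>" if "a \<in> \<Union>\<C>" for a
        using that sub submoduleE(3) by blast
      show "a \<odot>\<^bsub>V\<^esub> x \<in> \<Union>\<C>" if "a \<in> carrier K" "x \<in> \<Union>\<C>" for a x
        using that sub submoduleE(4) by blast
      fix a b assume "a \<in> \<Union>\<C>" "b \<in> \<Union>\<C>"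
      then obtain X Y where XY: "X \<in> \<C>" "Y \<in> \<C>" "a \<in> X" "b \<in> Y" by blast
      with \<C>(2) have "X \<subseteq> Y \<or> Y \<subseteq> X" by (auto simp: subset.chain_def)
      then have "\<exists>Z\<in>\<C>. a \<in> Z \<and> b \<in> Z" using XY by blast
      then show "a \<oplus>\<^bsub>V\<^esub> b \<in> \<Union>\<C>" using sub submoduleE(5) by blast
    qed
    then show "\<Union>\<C> \<in> A" using sub(2) by (auto simp: A_def)
  qed
  then obtain C where C: "submodule C K V" "W \<inter> C \<subseteq> {\<zero>\<^bsub>V\<^esub>}"
    and max: "\<And>X. \<lbrakk>submodule X K V; W \<inter> X \<subseteq> {\<zero>\<^bsub>V\<^esub>}; C \<subseteq> X\<rbrakk> \<Longrightarrow> X = C"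
    by (auto simp: A_def)
  have "\<exists>w\<in>W. \<exists>c\<in>C. v = w \<oplus>\<^bsub>V\<^esub> c" if v: "v \<in> carrier V" for v
  proof (rule ccontr)
    assume "\<not> ?thesis"
    then have nv: "v \<noteq> w \<oplus>\<^bsub>V\<^esub> c" if "w \<in> W" "c \<in> C" for w c
      using that by blast
    \<comment> \<open>The span of \<open>C\<close> and v, which contradicts maximality once it is
      shown to meet \<open>W\<close> only in zero.\<close>
    define X where "X = {c \<oplus>\<^bsub>V\<^esub> a \<odot>\<^bsub>V\<^esub> v |c a. c \<in> C \<and> a \<in> carrier K}"
    have XI: "x \<in> X" if "x = c \<oplus>\<^bsub>V\<^esub> a \<odot>\<^bsub>V\<^esub> v" "c \<in> C" "a \<in> carrier K" for x c a
      using that by (auto simp: X_def)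
    note [simp] = submodule_carrier[OF C(1)] submoduleE(3-5)[OF C(1)] submodule_zero[OF C(1)]
    have "submodule X K V"
    proof (rule submoduleI)
      show "X \<subseteq> carrier V" using v by (auto simp: X_def)
      show "\<zero>\<^bsub>V\<^esub> \<in> X" by (rule XI[of _ "\<zero>\<^bsub>V\<^esub>" "\<zero>\<^bsub>K\<^esub>"]) (use v in auto)
      show "\<ominus>\<^bsub>V\<^esub> x \<in> X" if "x \<in> X" for x
      proof -
        from that obtain c a where "x = c \<oplus>\<^bsub>V\<^esub> a \<odot>\<^bsub>V\<^esub> v" "c \<in> C" "a \<in> carrier K" by (auto simp: X_def)
        then show ?thesis
          by (intro XI[of _ "\<ominus>\<^bsub>V\<^esub> c" "\<ominus>\<^bsub>K\<^esub> a"]) (use v in \<open>auto simp: smult_l_minus M.minus_add\<close>)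
      qed
      show "b \<odot>\<^bsub>V\<^esub> x \<in> X" if "b \<in> carrier K" "x \<in> X" for b x
      proof -
        from that obtain c a where "x = c \<oplus>\<^bsub>V\<^esub> a \<odot>\<^bsub>V\<^esub> v" "c \<in> C" "a \<in> carrier K" by (auto simp: X_def)
        then show ?thesis using that v
          by (intro XI[of _ "b \<odot>\<^bsub>V\<^esub> c" "b \<otimes>\<^bsub>K\<^esub> a"]) (auto simp: smult_assoc1 smult_r_distr)
      qed
      show "x \<oplus>\<^bsub>V\<^esub> y \<in> X" if "x \<in> X" "y \<in> X" for x y
      proof -
        from that obtain c a d b where *: "x = c \<oplus>\<^bsub>V\<^esub> a \<odot>\<^bsub>V\<^esub> v" "c \<in> C" "a \<in> carrier K"
          "y = d \<oplus>\<^bsub>V\<^esub> b \<odot>\<^bsub>V\<^esub> v" "d \<in> C" "b \<in> carrier K" by (auto simp: X_def)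
        show ?thesis
          by (rule XI[of _ "c \<oplus>\<^bsub>V\<^esub> d" "a \<oplus>\<^bsub>K\<^esub> b"])
            (use * v in \<open>auto simp: smult_l_distr M.a_assoc M.a_lcomm\<close>)
      qed
    qed
    moreover have "W \<inter> X \<subseteq> {\<zero>\<^bsub>V\<^esub>}"
    proof
      fix w assume "w \<in> W \<inter> X"
      then obtain c a where w: "w \<in> W" "w = c \<oplus>\<^bsub>V\<^esub> a \<odot>\<^bsub>V\<^esub> v" "c \<in> C" "a \<in> carrier K"
        by (auto simp: X_def)
      show "w \<in> {\<zero>\<^bsub>V\<^esub>}"
      \<comment> \<open>A common element w = c + a v either lies in \<open>C\<close>, and is then
        zero, or division by a exhibits v as a sum from \<open>W\<close> and
        \<open>C\<close>.\<close>
      proof (cases "a = \<zero>\<^bsub>K\<^esub>")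
        case True
        then show ?thesis using w v C(2) by auto
      next
        case False
        interpret F: field K by fact
        define b where "b = inv\<^bsub>K\<^esub> a"
        have b: "b \<in> carrier K" "b \<otimes>\<^bsub>K\<^esub> a = \<one>\<^bsub>K\<^esub>"
          using False w(4) by (auto simp: b_def F.field_Units)
        have wV: "w \<in> carrier V" using w(1) submodule_carrier[OF W] by blast
        have "b \<odot>\<^bsub>V\<^esub> (w \<ominus>\<^bsub>V\<^esub> c) = b \<odot>\<^bsub>V\<^esub> (a \<odot>\<^bsub>V\<^esub> v)"
          using w(3,4) v by (intro arg_cong[of _ _ "smult V b"]) (simp add: w(2) M.minus_eq M.a_ac
            M.r_neg1 M.r_neg2)
        also have "\<dots> = v" using b w(4) v by (simp add: smult_assoc1[symmetric])
        finally have "v = b \<odot>\<^bsub>V\<^esub> w \<oplus>\<^bsub>V\<^esub> b \<odot>\<^bsub>V\<^esub> (\<ominus>\<^bsub>V\<^esub> c)"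
          using b w(3) wV by (simp add: M.minus_eq smult_r_distr)
        moreover have "b \<odot>\<^bsub>V\<^esub> w \<in> W" "b \<odot>\<^bsub>V\<^esub> (\<ominus>\<^bsub>V\<^esub> c) \<in> C"
          using w b submoduleE(4)[OF W] by auto
        ultimately show ?thesis using nv[of "b \<odot>\<^bsub>V\<^esub> w" "b \<odot>\<^bsub>V\<^esub> (\<ominus>\<^bsub>V\<^esub> c)"] by simp
      qed
    qed
    moreover have "C \<subseteq> X"
      by (auto intro!: XI[of _ _ "\<zero>\<^bsub>K\<^esub>"] simp: v)
    ultimately have "X = C" by (rule max)
    moreover have "v \<in> X" by (rule XI[of _ "\<zero>\<^bsub>V\<^esub>" "\<one>\<^bsub>K\<^esub>"]) (use v in auto)
    ultimately have "v = \<zero>\<^bsub>V\<^esub> \<oplus>\<^bsub>V\<^esub> v" "v \<in> C" using v by auto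
    then show False using nv[OF submodule_zero[OF W], of v] by simp
  qed
  moreover have "W \<inter> C = {\<zero>\<^bsub>V\<^esub>}" using C submodule_zero W by blast
  ultimately show ?thesis using that C(1) by blast
qed

text \<open>Extension by zero along a complement: g is f after the projection of V = W + C onto
  \<open>W\<close>.\<close>

lemma module_homs_extend:
  assumes "field K" and V: "module K V" and U: "module K U" and W: "submodule W K V"
    and f: "f \<in> module_homs K (subalg V W) U"
  obtains g where "g \<in> module_homs K V U" "\<And>w. w \<in> W \<Longrightarrow> g w = f w"
proof -
  interpret V: linear_space K V unfolding linear_space_iff by fact
  interpret U: linear_space K U unfolding linear_space_iff by fact
  obtain C where C: "submodule C K V" "W \<inter> C = {\<zero>\<^bsub>V\<^esub>}"
    "\<And>v. v \<in> carrier V \<Longrightarrow> \<exists>w\<in>W. \<exists>c\<in>C. v = w \<oplus>\<^bsub>V\<^esub> c"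
    using V.submodule_complement[OF assms(1) W] by blast
  note [simp] = V.submodule_carrier[OF C(1)] V.submodule_carrier[OF W]
    V.submoduleE(3-5)[OF C(1)] V.submoduleE(3-5)[OF W] V.submodule_zero[OF C(1)] V.submodule_zero[OF
      W]
  \<comment> \<open>The \<open>W\<close>-component of v. It is unique because the difference of two
    candidates equals a difference of elements of \<open>C\<close> and so lies in the trivial
    intersection.\<close>
  define \<pi> where "\<pi> v = (THE w. w \<in> W \<and> (\<exists>c\<in>C. v = w \<oplus>\<^bsub>V\<^esub> c))" for v
  have \<pi>: "\<pi> (w \<oplus>\<^bsub>V\<^esub> c) = w" if wc: "w \<in> W" "c \<in> C" for w c
    unfolding \<pi>_def
  proof (rule the_equality)
    fix w' assume w': "w' \<in> W \<and> (\<exists>c'\<in>C. w \<oplus>\<^bsub>V\<^esub> c = w' \<oplus>\<^bsub>V\<^esub> c')"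
    then obtain c' where c': "c' \<in> C" "w \<oplus>\<^bsub>V\<^esub> c = w' \<oplus>\<^bsub>V\<^esub> c'" by blast
    have cl: "w \<in> carrier V" "w' \<in> carrier V" "c \<in> carrier V" "c' \<in> carrier V"
      using wc w' c' by auto
    have "w' \<ominus>\<^bsub>V\<^esub> w = (w' \<oplus>\<^bsub>V\<^esub> c') \<ominus>\<^bsub>V\<^esub> c' \<ominus>\<^bsub>V\<^esub> w" using cl by algebra
    also have "\<dots> = c \<ominus>\<^bsub>V\<^esub> c'" unfolding c'(2)[symmetric] using cl by algebra
    finally have "w' \<ominus>\<^bsub>V\<^esub> w = c \<ominus>\<^bsub>V\<^esub> c'" .
    moreover have "w' \<ominus>\<^bsub>V\<^esub> w \<in> W" "c \<ominus>\<^bsub>V\<^esub> c' \<in> C"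
      using wc w' c'(1) V.submodule_minus_closed[OF W] V.submodule_minus_closed[OF C(1)] by blast+
    ultimately have "w' \<ominus>\<^bsub>V\<^esub> w \<in> W \<inter> C" by simp
    then show "w' = w" using C(2) cl by (simp add: V.minus_eq_zero_iff)
  qed (use wc in auto)
  define g where "g v = f (\<pi> v)" for v
  have g: "g (w \<oplus>\<^bsub>V\<^esub> c) = f w" if "w \<in> W" "c \<in> C" for w c
    using \<pi>[OF that] by (simp add: g_def)
  have "g \<in> module_homs K V U"
  proof (rule module_homsI)
    fix x assume x: "x \<in> carrier V"
    then obtain w c where wc: "x = w \<oplus>\<^bsub>V\<^esub> c" "w \<in> W" "c \<in> C" using C(3) by blast
    show "g x \<in> carrier U" using wc g f by (auto simp: module_homs_closed)
    show "g (a \<odot>\<^bsub>V\<^esub> x) = a \<odot>\<^bsub>U\<^esub> g x" if "a \<in> carrier K" for a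
      using wc that f by (simp add: V.smult_r_distr g module_homs_smult[of f K "subalg V W" U,
        simplified])
    fix y assume "y \<in> carrier V"
    then obtain w' c' where wc': "y = w' \<oplus>\<^bsub>V\<^esub> c'" "w' \<in> W" "c' \<in> C" using C(3) by blast
    have cl: "w \<in> carrier V" "w' \<in> carrier V" "c \<in> carrier V" "c' \<in> carrier V"
      using wc wc' by auto
    have "x \<oplus>\<^bsub>V\<^esub> y = (w \<oplus>\<^bsub>V\<^esub> w') \<oplus>\<^bsub>V\<^esub> (c \<oplus>\<^bsub>V\<^esub> c')"
      unfolding wc wc' using cl by algebra
    then show "g (x \<oplus>\<^bsub>V\<^esub> y) = g x \<oplus>\<^bsub>U\<^esub> g y"
      using wc wc' f by (simp add: g module_homs_add[of f K "subalg V W" U, simplified])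
  qed
  moreover have "g w = f w" if "w \<in> W" for w
    using g[of w "\<zero>\<^bsub>V\<^esub>"] that by simp
  ultimately show ?thesis using that by blast
qed

text \<open>On a complement \<open>C\<close> of the kernel the surjection p is bijective; s is the
  inverse of this restriction.\<close>

lemma module_homs_section:
  assumes "field K" and V: "module K V" and U: "module K U"
    and p: "p \<in> module_homs K V U" "p ` carrier V = carrier U"
  obtains s where "s \<in> module_homs K U V" "\<And>u. u \<in> carrier U \<Longrightarrow> p (s u) = u"
proof -
  interpret V: linear_space K V unfolding linear_space_iff by fact
  interpret U: linear_space K U unfolding linear_space_iff by fact
  define W where "W = a_kernel V U p"
  have W: "submodule W K V" unfolding W_def by (rule V.submodule_kernel[OF p(1) U])
  obtain C where C: "submodule C K V" "W \<inter> C = {\<zero>\<^bsub>V\<^esub>}"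
    "\<And>v. v \<in> carrier V \<Longrightarrow> \<exists>w\<in>W. \<exists>c\<in>C. v = w \<oplus>\<^bsub>V\<^esub> c"
    using V.submodule_complement[OF assms(1) W] by blast
  note [simp] = V.submodule_carrier[OF C(1)] V.submoduleE(3-5)[OF C(1)]
  have inj: "c = c'" if "c \<in> C" "c' \<in> C" "p c = p c'" for c c'
  proof -
    have cl: "c \<in> carrier V" "c' \<in> carrier V" using that by simp_all
    then have "p (c \<ominus>\<^bsub>V\<^esub> c') = \<zero>\<^bsub>U\<^esub>"
      using that(3) by (simp add: module_homs_minus[OF p(1) V U] U.minus_eq_zero_iff
        module_homs_closed[OF p(1)])
    then have "c \<ominus>\<^bsub>V\<^esub> c' \<in> W \<inter> C"
      using cl V.submodule_minus_closed[OF C(1) that(1,2)] by (simp add: W_def a_kernel_def')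
    then show ?thesis using C(2) V.minus_eq_zero_iff[OF cl] by blast
  qed
  have "\<exists>c\<in>C. p c = u" if "u \<in> carrier U" for u
  proof -
    obtain v where v: "v \<in> carrier V" "p v = u" using p(2) \<open>u \<in> carrier U\<close> by (metis imageE)
    obtain w c where wc: "v = w \<oplus>\<^bsub>V\<^esub> c" "w \<in> W" "c \<in> C" using C(3)[OF v(1)] by blast
    then have "p v = p c"
      using p(1) module_homs_add[OF p(1), of w c] V.submodule_carrier[OF W wc(2)]
        by (simp add: W_def a_kernel_def' module_homs_closed)
    then show ?thesis using v wc by auto
  qed
  then obtain s where s: "\<And>u. u \<in> carrier U \<Longrightarrow> s u \<in> C \<and> p (s u) = u" by metis
  \<comment> \<open>Linearity comes from injectivity on \<open>C\<close>: the two sides of each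
    equation lie in \<open>C\<close> and have the same image under p.\<close>
  then have "s \<in> module_homs K U V"
    by (intro module_homsI) (auto intro!: inj simp: module_homs_add[OF p(1)] module_homs_smult[OF
      p(1)])
  then show ?thesis using that s by blast
qed

section \<open>Lie algebras and their modules\<close>

locale lie_alg = lie_algebra K L
  for K :: "('k, 'r) ring_scheme" (structure) and L :: "('k, 'a) module" (structure)

sublocale lie_alg \<subseteq> L: linear_space K L ..

context lie_alg
begin

lemma bracket_hom_l: "y \<in> carrier L \<Longrightarrow> (\<lambda>x. x \<otimes>\<^bsub>L\<^esub> y) \<in> module_homs K L L"
  by (rule module_homsI) (auto simp: bracket_closed bracket_l_distr bracket_smult_l)

lemma bracket_hom_r: "x \<in> carrier L \<Longrightarrow> (\<lambda>y. x \<otimes>\<^bsub>L\<^esub> y) \<in> module_homs K L L"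
  by (rule module_homsI) (auto simp: bracket_closed bracket_r_distr bracket_smult_r)

lemmas L_module = L.module_axioms

lemma bracket_neg_l: "\<lbrakk>x \<in> carrier L; y \<in> carrier L\<rbrakk> \<Longrightarrow> (\<ominus>\<^bsub>L\<^esub> x) \<otimes>\<^bsub>L\<^esub> y = \<ominus>\<^bsub>L\<^esub> (x \<otimes>\<^bsub>L\<^esub> y)"
  using module_homs_neg[OF bracket_hom_l L_module L_module] by simp

lemma bracket_neg_r: "\<lbrakk>x \<in> carrier L; y \<in> carrier L\<rbrakk> \<Longrightarrow> x \<otimes>\<^bsub>L\<^esub> (\<ominus>\<^bsub>L\<^esub> y) = \<ominus>\<^bsub>L\<^esub> (x \<otimes>\<^bsub>L\<^esub> y)"
  using module_homs_neg[OF bracket_hom_r L_module L_module] by simp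

lemma bracket_zero_l: "y \<in> carrier L \<Longrightarrow> \<zero>\<^bsub>L\<^esub> \<otimes>\<^bsub>L\<^esub> y = \<zero>\<^bsub>L\<^esub>"
  using module_homs_zero[OF bracket_hom_l L_module L_module] by simp

lemma bracket_zero_r: "x \<in> carrier L \<Longrightarrow> x \<otimes>\<^bsub>L\<^esub> \<zero>\<^bsub>L\<^esub> = \<zero>\<^bsub>L\<^esub>"
  using module_homs_zero[OF bracket_hom_r L_module L_module] by simp

lemmas lie_alg_simprules
  [algebra add: lie_alg "zero L" "add L" "a_inv L" "a_minus L"] =
  L.M.abelian_group_simprules bracket_closed bracket_l_distr bracket_r_distr
  bracket_neg_l bracket_neg_r bracket_zero_l bracket_zero_r

text \<open>Polarisation: expand [x + y, x + y] = 0.\<close>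

lemma bracket_antisym:
  assumes "x \<in> carrier L" "y \<in> carrier L"
  shows "y \<otimes>\<^bsub>L\<^esub> x = \<ominus>\<^bsub>L\<^esub> (x \<otimes>\<^bsub>L\<^esub> y)"
proof -
  have "\<zero>\<^bsub>L\<^esub> = (x \<oplus>\<^bsub>L\<^esub> y) \<otimes>\<^bsub>L\<^esub> (x \<oplus>\<^bsub>L\<^esub> y)" using assms by (simp add: bracket_self)
  also have "\<dots> = x \<otimes>\<^bsub>L\<^esub> x \<oplus>\<^bsub>L\<^esub> y \<otimes>\<^bsub>L\<^esub> y \<oplus>\<^bsub>L\<^esub> (y \<otimes>\<^bsub>L\<^esub> x \<oplus>\<^bsub>L\<^esub> x \<otimes>\<^bsub>L\<^esub> y)"
    using assms by algebra
  also have "\<dots> = y \<otimes>\<^bsub>L\<^esub> x \<oplus>\<^bsub>L\<^esub> x \<otimes>\<^bsub>L\<^esub> y"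
    using assms by (simp add: bracket_self bracket_closed)
  finally show ?thesis
    using assms L.M.minus_equality[of "y \<otimes>\<^bsub>L\<^esub> x" "x \<otimes>\<^bsub>L\<^esub> y"] by (simp add: bracket_closed)
qed

lemma jacobi_left:
  assumes "x \<in> carrier L" "y \<in> carrier L" "z \<in> carrier L"
  shows "(x \<otimes>\<^bsub>L\<^esub> y) \<otimes>\<^bsub>L\<^esub> z \<oplus>\<^bsub>L\<^esub> (y \<otimes>\<^bsub>L\<^esub> z) \<otimes>\<^bsub>L\<^esub> x \<oplus>\<^bsub>L\<^esub> (z \<otimes>\<^bsub>L\<^esub> x) \<otimes>\<^bsub>L\<^esub> y = \<zero>\<^bsub>L\<^esub>"
proof -
  note c = bracket_closed[OF assms(1,2)] bracket_closed[OF assms(2,3)] bracket_closed[OF assms(3,1)]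
  have "(x \<otimes>\<^bsub>L\<^esub> y) \<otimes>\<^bsub>L\<^esub> z \<oplus>\<^bsub>L\<^esub> (y \<otimes>\<^bsub>L\<^esub> z) \<otimes>\<^bsub>L\<^esub> x \<oplus>\<^bsub>L\<^esub> (z \<otimes>\<^bsub>L\<^esub> x) \<otimes>\<^bsub>L\<^esub> y
    = \<ominus>\<^bsub>L\<^esub> (x \<otimes>\<^bsub>L\<^esub> (y \<otimes>\<^bsub>L\<^esub> z) \<oplus>\<^bsub>L\<^esub> y \<otimes>\<^bsub>L\<^esub> (z \<otimes>\<^bsub>L\<^esub> x) \<oplus>\<^bsub>L\<^esub> z \<otimes>\<^bsub>L\<^esub> (x \<otimes>\<^bsub>L\<^esub> y))"
    unfolding bracket_antisym[OF assms(3) c(1)] bracket_antisym[OF assms(1) c(2)] bracket_antisym[OF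
      assms(2) c(3)]
    using assms by algebra
  then show ?thesis using assms by (simp add: jacobi L.M.minus_zero_eq)
qed

text \<open>The Jacobi identity in the form ad [x, y] = [ad x, ad y]. It is parallel to
  \<open>act_bracket\<close>: an iterated bracket is unfolded just as the action of a bracket
  is.\<close>

lemma leibniz:
  assumes "x \<in> carrier L" "y \<in> carrier L" "z \<in> carrier L"
  shows "(x \<otimes>\<^bsub>L\<^esub> y) \<otimes>\<^bsub>L\<^esub> z = x \<otimes>\<^bsub>L\<^esub> (y \<otimes>\<^bsub>L\<^esub> z) \<ominus>\<^bsub>L\<^esub> y \<otimes>\<^bsub>L\<^esub> (x \<otimes>\<^bsub>L\<^esub> z)"
proof -
  note c = bracket_closed[OF assms(1,2)] bracket_closed[OF assms(2,3)] bracket_closed[OF assms(1,3)]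
  note cc = bracket_closed[OF assms(1) c(2)] bracket_closed[OF assms(2) c(3)] bracket_closed[OF
    assms(3) c(1)]
  have "z \<otimes>\<^bsub>L\<^esub> x = \<ominus>\<^bsub>L\<^esub> (x \<otimes>\<^bsub>L\<^esub> z)" by (rule bracket_antisym[OF assms(1,3)])
  then have "x \<otimes>\<^bsub>L\<^esub> (y \<otimes>\<^bsub>L\<^esub> z) \<ominus>\<^bsub>L\<^esub> y \<otimes>\<^bsub>L\<^esub> (x \<otimes>\<^bsub>L\<^esub> z) \<oplus>\<^bsub>L\<^esub> z \<otimes>\<^bsub>L\<^esub> (x \<otimes>\<^bsub>L\<^esub> y) = \<zero>\<^bsub>L\<^esub>"
    using jacobi[OF assms] assms c by (simp add: bracket_neg_r a_minus_def)
  then have "x \<otimes>\<^bsub>L\<^esub> (y \<otimes>\<^bsub>L\<^esub> z) \<ominus>\<^bsub>L\<^esub> y \<otimes>\<^bsub>L\<^esub> (x \<otimes>\<^bsub>L\<^esub> z) = \<ominus>\<^bsub>L\<^esub> (z \<otimes>\<^bsub>L\<^esub> (x \<otimes>\<^bsub>L\<^esub> y))"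
    using cc by (metis L.M.minus_closed L.M.minus_equality)
  then show ?thesis using bracket_antisym[OF assms(3) c(1)] by simp
qed

lemma subalgebra:
  assumes "submodule S K L" "\<And>x y. \<lbrakk>x \<in> S; y \<in> S\<rbrakk> \<Longrightarrow> x \<otimes>\<^bsub>L\<^esub> y \<in> S"
  shows "lie_alg K (subalg L S)"
proof -
  interpret S: linear_space K "subalg L S"
    unfolding linear_space_iff by (rule module_subalg[OF assms(1) L_module])
  note [simp] = L.submodule_carrier[OF assms(1)]
  show ?thesis
    by unfold_locales (auto simp: assms(2) bracket_l_distr bracket_r_distr bracket_smult_l
      bracket_smult_r bracket_self jacobi)
qed

lemma ideal_closed_r:
  assumes "submodule I K L" "\<And>x z. \<lbrakk>x \<in> carrier L; z \<in> I\<rbrakk> \<Longrightarrow> x \<otimes>\<^bsub>L\<^esub> z \<in> I" "x \<in> carrier L" "z \<in> I"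
  shows "z \<otimes>\<^bsub>L\<^esub> x \<in> I"
  using assms bracket_antisym[of x z] L.submodule_carrier L.submoduleE(3) by metis

lemma quot_bracket:
  assumes I: "submodule I K L" "\<And>x z. \<lbrakk>x \<in> carrier L; z \<in> I\<rbrakk> \<Longrightarrow> x \<otimes>\<^bsub>L\<^esub> z \<in> I"
    and xy: "x \<in> carrier L" "y \<in> carrier L"
  shows "(I +>\<^bsub>L\<^esub> x) \<otimes>\<^bsub>quot_alg L I\<^esub> (I +>\<^bsub>L\<^esub> y) = I +>\<^bsub>L\<^esub> (x \<otimes>\<^bsub>L\<^esub> y)"
  unfolding quot_alg_simps rcoset_mult_def
proof (rule L.Union_rcos_const[OF I(1) xy(1)], rule L.Union_rcos_const[OF I(1) xy(2)])
  fix x' y' assume x': "x' \<in> carrier L" "I +>\<^bsub>L\<^esub> x' = I +>\<^bsub>L\<^esub> x" and y': "y' \<in> carrier L" "I +>\<^bsub>L\<^esub> y' =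
    I +>\<^bsub>L\<^esub> y"
  have i: "x' \<ominus>\<^bsub>L\<^esub> x \<in> I" "y' \<ominus>\<^bsub>L\<^esub> y \<in> I" using x' y' xy I(1) L.rcos_eq_iff by auto
  \<comment> \<open>Changing one factor at a time splits the difference into two brackets, each with
    one factor in \<open>I\<close>.\<close>
  have "x' \<otimes>\<^bsub>L\<^esub> y' \<ominus>\<^bsub>L\<^esub> x \<otimes>\<^bsub>L\<^esub> y = (x' \<ominus>\<^bsub>L\<^esub> x) \<otimes>\<^bsub>L\<^esub> y \<oplus>\<^bsub>L\<^esub> x' \<otimes>\<^bsub>L\<^esub> (y' \<ominus>\<^bsub>L\<^esub> y)"
    using x'(1) y'(1) xy by algebra
  also have "\<dots> \<in> I"
    using ideal_closed_r[OF I xy(2) i(1)] I(2)[OF x'(1) i(2)] L.submoduleE(5)[OF I(1)] by blast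
  finally show "I +>\<^bsub>L\<^esub> x' \<otimes>\<^bsub>L\<^esub> y' = I +>\<^bsub>L\<^esub> x \<otimes>\<^bsub>L\<^esub> y"
    using x' y' xy by (simp add: L.rcos_eq_iff[OF I(1)] bracket_closed)
qed

lemma quot_lie_alg:
  assumes I: "submodule I K L" "\<And>x z. \<lbrakk>x \<in> carrier L; z \<in> I\<rbrakk> \<Longrightarrow> x \<otimes>\<^bsub>L\<^esub> z \<in> I"
  shows "lie_alg K (quot_alg L I)"
proof -
  interpret Q: linear_space K "quot_alg L I"
    unfolding linear_space_iff by (rule L.module_quot[OF I(1)])
  note [simp] = quot_bracket[OF I] L.quot_add[OF I(1)] L.quot_smult[OF I(1)] bracket_closed
  note [simp del] = quot_alg_simps(2-5)
  have Z: "\<zero>\<^bsub>quot_alg L I\<^esub> = I +>\<^bsub>L\<^esub> \<zero>\<^bsub>L\<^esub>" using I(1) by (simp add: L.rcos_zero quot_alg_simps(2))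
  show ?thesis
    by unfold_locales (auto simp: Z bracket_l_distr bracket_r_distr bracket_smult_l
      bracket_smult_r bracket_self jacobi simp del: L.M.a_coset_add_zero)
qed

end

locale lie_rep = lie_module K L M act
  for K :: "('k, 'r) ring_scheme" (structure) and L :: "('k, 'a) module" (structure)
    and M :: "('k, 'm) module" (structure) and act :: "'a \<Rightarrow> 'm \<Rightarrow> 'm"

sublocale lie_rep \<subseteq> lie_alg K L ..
sublocale lie_rep \<subseteq> M: linear_space K M ..

abbreviation H1_class ::
    "('k, 'r) ring_scheme \<Rightarrow> ('k, 'a) module \<Rightarrow> ('k, 'n) module \<Rightarrow> ('a \<Rightarrow> 'n \<Rightarrow> 'n) \<Rightarrow>
     ('a \<Rightarrow> 'n) \<Rightarrow> ('a \<Rightarrow> 'n) set" where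
  "H1_class K L N act d \<equiv> inner_ders L N act +>\<^bsub>der_space K L N act\<^esub> d"

abbreviation H2_class ::
    "('k, 'r) ring_scheme \<Rightarrow> ('k, 'a) module \<Rightarrow> ('k, 'n) module \<Rightarrow> ('a \<Rightarrow> 'n \<Rightarrow> 'n) \<Rightarrow>
     ('a \<times> 'a \<Rightarrow> 'n) \<Rightarrow> ('a \<times> 'a \<Rightarrow> 'n) set" where
  "H2_class K L N act f \<equiv> coboundaries2 K L N act +>\<^bsub>cocycle_space K L N act\<^esub> f"

text \<open>
  Here and in the similar identities below, the name of a variable indicates the term for which it
  stands: \<open>xyz\<close> is \<open>x \<cdot> (y \<cdot> b z)\<close>, \<open>bx\<close> is \<open>x \<cdot> b [y, z]\<close> and \<open>\<ominus> (j2 \<oplus> j3)\<close> is \<open>b [[x, y], z]\<close>,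
  by the Jacobi identity.
\<close>

lemma (in abelian_group) coboundary_sum:
  assumes "xyz \<in> carrier G" "xzy \<in> carrier G" "yzx \<in> carrier G" "yxz \<in> carrier G" "zxy \<in> carrier G"
    "zyx \<in> carrier G"
    "bx \<in> carrier G" "by \<in> carrier G" "bz \<in> carrier G" "j2 \<in> carrier G" "j3 \<in> carrier G"
  shows "(xyz \<ominus> xzy \<ominus> bx) \<oplus> (yzx \<ominus> yxz \<ominus> by) \<oplus> (zxy \<ominus> zyx \<ominus> bz) =
    ((xyz \<ominus> yxz) \<ominus> bz \<ominus> (\<ominus> (j2 \<oplus> j3))) \<oplus> ((yzx \<ominus> zyx) \<ominus> bx \<ominus> j2) \<oplus> ((zxy \<ominus> xzy) \<ominus> by \<ominus> j3)"
  using assms by algebra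

context lie_rep
begin

lemmas M_module = M.module_axioms

lemma act_hom: "x \<in> carrier L \<Longrightarrow> act x \<in> module_homs K M M"
  by (rule module_homsI) (auto simp: act_closed act_r_distr act_smult_r)

lemma act_hom_l: "m \<in> carrier M \<Longrightarrow> (\<lambda>x. act x m) \<in> module_homs K L M"
  by (rule module_homsI) (auto simp: act_closed act_l_distr act_smult_l)

lemma act_neg: "\<lbrakk>x \<in> carrier L; m \<in> carrier M\<rbrakk> \<Longrightarrow> act x (\<ominus>\<^bsub>M\<^esub> m) = \<ominus>\<^bsub>M\<^esub> (act x m)"
  using module_homs_neg[OF act_hom M_module M_module] .

lemma act_neg_l: "\<lbrakk>x \<in> carrier L; m \<in> carrier M\<rbrakk> \<Longrightarrow> act (\<ominus>\<^bsub>L\<^esub> x) m = \<ominus>\<^bsub>M\<^esub> (act x m)"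
  using module_homs_neg[OF act_hom_l L_module M_module] .

lemma act_zero: "x \<in> carrier L \<Longrightarrow> act x \<zero>\<^bsub>M\<^esub> = \<zero>\<^bsub>M\<^esub>"
  using module_homs_zero[OF act_hom M_module M_module] .

lemma act_zero_l: "m \<in> carrier M \<Longrightarrow> act \<zero>\<^bsub>L\<^esub> m = \<zero>\<^bsub>M\<^esub>"
  using module_homs_zero[OF act_hom_l L_module M_module] .

lemma act_minus:
  "\<lbrakk>x \<in> carrier L; m \<in> carrier M; n \<in> carrier M\<rbrakk> \<Longrightarrow> act x (m \<ominus>\<^bsub>M\<^esub> n) = act x m \<ominus>\<^bsub>M\<^esub> act x n"
  using module_homs_minus[OF act_hom M_module M_module] .

lemmas lie_rep_simprules
  [algebra add: lie_rep "zero M" "add M" "a_inv M" "a_minus M"] =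
  M.M.abelian_group_simprules L.M.a_closed L.M.a_inv_closed L.M.zero_closed L.M.minus_closed
    bracket_closed
  act_closed act_l_distr act_r_distr act_neg act_neg_l act_zero act_zero_l act_bracket

subsection \<open>Derivations\<close>

lemma dersI:
  assumes "d \<in> module_homs K L M" "d \<in> extensional (carrier L)"
    and "\<And>x y. \<lbrakk>x \<in> carrier L; y \<in> carrier L\<rbrakk> \<Longrightarrow> d (x \<otimes>\<^bsub>L\<^esub> y) = act x (d y) \<ominus>\<^bsub>M\<^esub> act y (d x)"
  shows "d \<in> ders K L M act"
  using assms by (auto simp: ders_def)

lemma dersD:
  assumes "d \<in> ders K L M act"
  shows "d \<in> module_homs K L M" "d \<in> extensional (carrier L)" "d \<in> carrier L \<rightarrow>\<^sub>E carrier M"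
    "\<And>x. x \<in> carrier L \<Longrightarrow> d x \<in> carrier M"
    "\<And>x y. \<lbrakk>x \<in> carrier L; y \<in> carrier L\<rbrakk> \<Longrightarrow> d (x \<otimes>\<^bsub>L\<^esub> y) = act x (d y) \<ominus>\<^bsub>M\<^esub> act y (d x)"
  using assms by (auto simp: ders_def module_homs_closed PiE_def)

text \<open>Elements of \<open>ders\<close> are extensional; this rule lets the conditions be
  checked on an arbitrary formula, which is restricted afterwards.\<close>

lemma restrict_dersI:
  assumes d: "d \<in> module_homs K L M"
    and "\<And>x y. \<lbrakk>x \<in> carrier L; y \<in> carrier L\<rbrakk> \<Longrightarrow> d (x \<otimes>\<^bsub>L\<^esub> y) = act x (d y) \<ominus>\<^bsub>M\<^esub> act y (d x)"
  shows "(\<lambda>x\<in>carrier L. d x) \<in> ders K L M act"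
  by (rule dersI[OF module_homs_cong[OF d L_module]]) (auto simp: assms(2) bracket_closed)

lemma ders_submodule: "submodule (ders K L M act) K (fun_space (carrier L) M)"
proof (rule fun_space_submoduleI[OF M_module])
  show "ders K L M act \<subseteq> carrier L \<rightarrow>\<^sub>E carrier M" using dersD(3) by blast
  show "(\<lambda>x\<in>carrier L. \<zero>\<^bsub>M\<^esub>) \<in> ders K L M act"
    by (rule restrict_dersI[OF module_homs_const_zero[OF M_module]]) algebra
  fix d assume d: "d \<in> ders K L M act"
  note D = dersD[OF d]
  show "(\<lambda>x\<in>carrier L. d x \<oplus>\<^bsub>M\<^esub> e x) \<in> ders K L M act" if e: "e \<in> ders K L M act" for e
  proof (rule restrict_dersI[OF module_homs_sum[OF D(1) dersD(1)[OF e] M_module]])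
    fix x y assume xy: "x \<in> carrier L" "y \<in> carrier L"
    note c = xy D(4)[OF xy(1)] D(4)[OF xy(2)] dersD(4)[OF e xy(1)] dersD(4)[OF e xy(2)]
    show "d (x \<otimes>\<^bsub>L\<^esub> y) \<oplus>\<^bsub>M\<^esub> e (x \<otimes>\<^bsub>L\<^esub> y) = act x (d y \<oplus>\<^bsub>M\<^esub> e y) \<ominus>\<^bsub>M\<^esub> act y (d x \<oplus>\<^bsub>M\<^esub> e x)"
      unfolding D(5)[OF xy] dersD(5)[OF e xy] using c by algebra
  qed
  show "(\<lambda>x\<in>carrier L. a \<odot>\<^bsub>M\<^esub> d x) \<in> ders K L M act" if a: "a \<in> carrier K" for a
  proof (rule restrict_dersI[OF module_homs_scale[OF D(1) a M_module]])
    fix x y assume xy: "x \<in> carrier L" "y \<in> carrier L"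
    show "a \<odot>\<^bsub>M\<^esub> d (x \<otimes>\<^bsub>L\<^esub> y) = act x (a \<odot>\<^bsub>M\<^esub> d y) \<ominus>\<^bsub>M\<^esub> act y (a \<odot>\<^bsub>M\<^esub> d x)"
      unfolding D(5)[OF xy] using a xy D(4)[OF xy(1)] D(4)[OF xy(2)]
      by (simp add: M.minus_eq M.smult_r_distr M.smult_r_minus act_smult_r act_closed)
  qed
qed

lemma inner_der_ders: "m \<in> carrier M \<Longrightarrow> inner_der L act m \<in> ders K L M act"
  unfolding inner_der_def by (rule restrict_dersI[OF act_hom_l]) (simp_all add: act_bracket)

lemma inner_ders_subset: "inner_ders L M act \<subseteq> ders K L M act"
  by (auto simp: inner_ders_def inner_der_ders)

lemma inner_ders_eq: "inner_ders L M act = {\<lambda>x\<in>carrier L. act x m |m. m \<in> carrier M}"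
  by (auto simp: inner_ders_def inner_der_def)

text \<open>As a linear map \<delta> from \<open>M\<close> to functions on \<open>L\<close>, this
  makes the inner derivations a subspace, namely its image. For the ideal it becomes the surjection
  M \<rightarrow> Inn(H, M) whose linear section drives \<open>linear_choice\<close>.\<close>

lemma inner_der_hom: "inner_der L act \<in> module_homs K M (fun_space (carrier L) M)"
  by (rule module_homsI) (auto simp: inner_der_def act_closed act_r_distr act_smult_r intro!:
    restrict_ext)

lemma fun_space_module: "module K (fun_space X M)"
  by (rule module_fun_space[OF M_module])

lemma inner_ders_submodule_fun: "submodule (inner_ders L M act) K (fun_space (carrier L) M)"
  unfolding inner_ders_def
  by (rule submodule_image[OF inner_der_hom M_module fun_space_module M.carrier_is_submodule])

lemma der_space_linear: "linear_space K (der_space K L M act)"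
  unfolding der_space_def linear_space_iff by (rule module_subalg[OF ders_submodule
    fun_space_module])

lemma inner_ders_submodule: "submodule (inner_ders L M act) K (der_space K L M act)"
  unfolding der_space_def
  by (rule submodule_subalg[OF inner_ders_submodule_fun ders_submodule inner_ders_subset
    fun_space_module])

lemma der_space_simps [simp]:
  "carrier (der_space K L M act) = ders K L M act"
  "\<zero>\<^bsub>der_space K L M act\<^esub> = (\<lambda>x\<in>carrier L. \<zero>\<^bsub>M\<^esub>)"
  "add (der_space K L M act) = (\<lambda>d e. \<lambda>x\<in>carrier L. d x \<oplus>\<^bsub>M\<^esub> e x)"
  "smult (der_space K L M act) = (\<lambda>a d. \<lambda>x\<in>carrier L. a \<odot>\<^bsub>M\<^esub> d x)"
  by (simp_all add: der_space_def)

lemma der_space_minus: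
  "\<lbrakk>d \<in> ders K L M act; e \<in> ders K L M act\<rbrakk> \<Longrightarrow>
    d \<ominus>\<^bsub>der_space K L M act\<^esub> e = (\<lambda>x\<in>carrier L. d x \<ominus>\<^bsub>M\<^esub> e x)"
  unfolding der_space_def
  by (simp add: a_minus_subalg[OF ders_submodule fun_space_module] fun_space_minus[OF M_module]
    dersD(3))

lemma H1_module: "linear_space K (H1 K L M act)"
  unfolding H1_def linear_space_iff by (rule linear_space.module_quot[OF der_space_linear
    inner_ders_submodule])

lemma H1_carrier: "carrier (H1 K L M act) = H1_class K L M act ` ders K L M act"
  by (simp add: H1_def)

lemma H1_zero: "\<zero>\<^bsub>H1 K L M act\<^esub> = H1_class K L M act (\<lambda>x\<in>carrier L. \<zero>\<^bsub>M\<^esub>)"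
  unfolding H1_def using linear_space.rcos_zero[OF der_space_linear inner_ders_submodule] by simp

lemma H1_add:
  "\<lbrakk>d \<in> ders K L M act; e \<in> ders K L M act\<rbrakk> \<Longrightarrow>
   H1_class K L M act d \<oplus>\<^bsub>H1 K L M act\<^esub> H1_class K L M act e =
     H1_class K L M act (\<lambda>x\<in>carrier L. d x \<oplus>\<^bsub>M\<^esub> e x)"
  unfolding H1_def using linear_space.quot_add[OF der_space_linear inner_ders_submodule] by simp

lemma H1_smult:
  "\<lbrakk>d \<in> ders K L M act; a \<in> carrier K\<rbrakk> \<Longrightarrow>
   a \<odot>\<^bsub>H1 K L M act\<^esub> H1_class K L M act d = H1_class K L M act (\<lambda>x\<in>carrier L. a \<odot>\<^bsub>M\<^esub> d x)"
  unfolding H1_def using linear_space.quot_smult[OF der_space_linear inner_ders_submodule] by simp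

lemma H1_minus:
  "\<lbrakk>d \<in> ders K L M act; e \<in> ders K L M act\<rbrakk> \<Longrightarrow>
   H1_class K L M act d \<ominus>\<^bsub>H1 K L M act\<^esub> H1_class K L M act e =
     H1_class K L M act (\<lambda>x\<in>carrier L. d x \<ominus>\<^bsub>M\<^esub> e x)"
  unfolding H1_def using linear_space.quot_minus[OF der_space_linear inner_ders_submodule]
  by (simp add: der_space_minus)

lemma H1_class_hom: "H1_class K L M act \<in> module_homs K (der_space K L M act) (H1 K L M act)"
  unfolding H1_def by (rule linear_space.quot_proj_hom[OF der_space_linear inner_ders_submodule])

text \<open>That the difference is inner is rewritten as a sum, so that equality of classes amounts
  to a witness m and a pointwise identity without subtraction.\<close>

lemma H1_class_eq_iff:
  assumes "d \<in> ders K L M act" "e \<in> ders K L M act"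
  shows "H1_class K L M act d = H1_class K L M act e \<longleftrightarrow>
    (\<exists>m\<in>carrier M. \<forall>x\<in>carrier L. d x = act x m \<oplus>\<^bsub>M\<^esub> e x)"
proof -
  note D = dersD[OF assms(1)] dersD[OF assms(2)]
  have "H1_class K L M act d = H1_class K L M act e \<longleftrightarrow>
      (\<lambda>x\<in>carrier L. d x \<ominus>\<^bsub>M\<^esub> e x) \<in> inner_ders L M act"
    using linear_space.rcos_eq_iff[OF der_space_linear inner_ders_submodule] assms
    by (simp add: der_space_minus)
  also have "\<dots> \<longleftrightarrow> (\<exists>m\<in>carrier M. \<forall>x\<in>carrier L. d x \<ominus>\<^bsub>M\<^esub> e x = act x m)"
    unfolding inner_ders_eq by (auto simp: restrict_def fun_eq_iff)
  also have "\<dots> \<longleftrightarrow> (\<exists>m\<in>carrier M. \<forall>x\<in>carrier L. d x = act x m \<oplus>\<^bsub>M\<^esub> e x)"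
    using D by (intro bex_cong ball_cong refl) (metis M.eq_minus_iff act_closed)
  finally show ?thesis .
qed

lemma H1_class_rep:
  assumes "d \<in> ders K L M act" "e \<in> H1_class K L M act d"
  shows "e \<in> ders K L M act" "H1_class K L M act e = H1_class K L M act d"
  using linear_space.rcos_mem[OF der_space_linear inner_ders_submodule, of d e] assms by auto

lemma H1_class_self: "d \<in> ders K L M act \<Longrightarrow> d \<in> H1_class K L M act d"
  using linear_space.rcos_self[OF der_space_linear inner_ders_submodule, of d] by auto

subsection \<open>Cocycles\<close>

lemma cocyclesD:
  assumes "f \<in> cocycles2 K L M act"
  shows "f \<in> carrier L \<times> carrier L \<rightarrow>\<^sub>E carrier M"
    "\<And>x. x \<in> carrier L \<Longrightarrow> (\<lambda>y. f (x, y)) \<in> module_homs K L M"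
    "\<And>y. y \<in> carrier L \<Longrightarrow> (\<lambda>x. f (x, y)) \<in> module_homs K L M"
    "\<And>x. x \<in> carrier L \<Longrightarrow> f (x, x) = \<zero>\<^bsub>M\<^esub>"
    "\<And>x y z. \<lbrakk>x \<in> carrier L; y \<in> carrier L; z \<in> carrier L\<rbrakk> \<Longrightarrow>
        act x (f (y, z)) \<oplus>\<^bsub>M\<^esub> act y (f (z, x)) \<oplus>\<^bsub>M\<^esub> act z (f (x, y))
        = f (x \<otimes>\<^bsub>L\<^esub> y, z) \<oplus>\<^bsub>M\<^esub> f (y \<otimes>\<^bsub>L\<^esub> z, x) \<oplus>\<^bsub>M\<^esub> f (z \<otimes>\<^bsub>L\<^esub> x, y)"
    "\<And>x y. \<lbrakk>x \<in> carrier L; y \<in> carrier L\<rbrakk> \<Longrightarrow> f (x, y) \<in> carrier M"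
    "\<And>x y z. \<lbrakk>x \<in> carrier L; y \<in> carrier L; z \<in> carrier L\<rbrakk> \<Longrightarrow> f (x, y \<oplus>\<^bsub>L\<^esub> z) = f (x, y) \<oplus>\<^bsub>M\<^esub> f (x, z)"
    "\<And>x y z. \<lbrakk>x \<in> carrier L; y \<in> carrier L; z \<in> carrier L\<rbrakk> \<Longrightarrow> f (x \<oplus>\<^bsub>L\<^esub> y, z) = f (x, z) \<oplus>\<^bsub>M\<^esub> f (y, z)"
  using assms unfolding cocycles2_def by (auto simp: module_homs_def)

text \<open>Polarise f(x + y, x + y) = 0.\<close>

lemma cocycle_antisym:
  assumes f: "f \<in> cocycles2 K L M act" and xy: "x \<in> carrier L" "y \<in> carrier L"
  shows "f (y, x) = \<ominus>\<^bsub>M\<^esub> f (x, y)"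
proof -
  note F = cocyclesD[OF f]
  note c = F(6)[OF xy] F(6)[OF xy(2,1)]
  have "\<zero>\<^bsub>M\<^esub> = f (x \<oplus>\<^bsub>L\<^esub> y, x \<oplus>\<^bsub>L\<^esub> y)" using xy by (simp add: F(4))
  also have "\<dots> = f (x, x) \<oplus>\<^bsub>M\<^esub> f (y, y) \<oplus>\<^bsub>M\<^esub> (f (y, x) \<oplus>\<^bsub>M\<^esub> f (x, y))"
    using xy c F(6)[OF xy(1,1)] F(6)[OF xy(2,2)] by (simp add: F(7,8) M.M.a_ac)
  also have "\<dots> = f (y, x) \<oplus>\<^bsub>M\<^esub> f (x, y)" using xy c by (simp add: F(4))
  finally show ?thesis using c M.M.minus_equality[of "f (y, x)" "f (x, y)"] by simp
qed

lemma cocyclesI: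
  assumes hom: "\<And>y. y \<in> carrier L \<Longrightarrow> (\<lambda>x. f (x, y)) \<in> module_homs K L M"
    "\<And>x. x \<in> carrier L \<Longrightarrow> (\<lambda>y. f (x, y)) \<in> module_homs K L M"
    and alt: "\<And>x. x \<in> carrier L \<Longrightarrow> f (x, x) = \<zero>\<^bsub>M\<^esub>"
    and coc: "\<And>x y z. \<lbrakk>x \<in> carrier L; y \<in> carrier L; z \<in> carrier L\<rbrakk> \<Longrightarrow>
        act x (f (y, z)) \<oplus>\<^bsub>M\<^esub> act y (f (z, x)) \<oplus>\<^bsub>M\<^esub> act z (f (x, y))
        = f (x \<otimes>\<^bsub>L\<^esub> y, z) \<oplus>\<^bsub>M\<^esub> f (y \<otimes>\<^bsub>L\<^esub> z, x) \<oplus>\<^bsub>M\<^esub> f (z \<otimes>\<^bsub>L\<^esub> x, y)"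
  shows "restrict f (carrier L \<times> carrier L) \<in> cocycles2 K L M act"
proof -
  have "(\<lambda>x. restrict f (carrier L \<times> carrier L) (x, y)) \<in> module_homs K L M" if "y \<in> carrier L"
    for y
    by (rule module_homs_cong[OF hom(1)[OF that] L_module]) (use that in simp)
  moreover have "(\<lambda>y. restrict f (carrier L \<times> carrier L) (x, y)) \<in> module_homs K L M"
    if "x \<in> carrier L" for x
    by (rule module_homs_cong[OF hom(2)[OF that] L_module]) (use that in simp)
  moreover have "f (x, y) \<in> carrier M" if "x \<in> carrier L" "y \<in> carrier L" for x y
    using module_homs_closed[OF hom(1)] that by blast
  ultimately show ?thesis
    unfolding cocycles2_def by (auto simp: alt coc bracket_closed)
qed

lemma cocycles_submodule: "submodule (cocycles2 K L M act) K (fun_space (carrier L \<times> carrier L) M)"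
proof (rule fun_space_submoduleI[OF M_module])
  show "cocycles2 K L M act \<subseteq> carrier L \<times> carrier L \<rightarrow>\<^sub>E carrier M" using cocyclesD(1) by blast
  show "(\<lambda>x\<in>carrier L \<times> carrier L. \<zero>\<^bsub>M\<^esub>) \<in> cocycles2 K L M act"
    by (rule cocyclesI) (auto simp: module_homs_const_zero[OF M_module] act_zero)
  fix f assume f: "f \<in> cocycles2 K L M act"
  note F = cocyclesD[OF f]
  show "(\<lambda>x\<in>carrier L \<times> carrier L. f x \<oplus>\<^bsub>M\<^esub> g x) \<in> cocycles2 K L M act"
    if g: "g \<in> cocycles2 K L M act" for g
  proof -
    note G = cocyclesD[OF g]
    show ?thesis
    proof (rule cocyclesI)
      fix x y z assume xyz: "x \<in> carrier L" "y \<in> carrier L" "z \<in> carrier L"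
      note b = bracket_closed[OF xyz(1,2)] bracket_closed[OF xyz(2,3)] bracket_closed[OF xyz(3,1)]
      have "act x (f (y, z) \<oplus>\<^bsub>M\<^esub> g (y, z)) \<oplus>\<^bsub>M\<^esub> act y (f (z, x) \<oplus>\<^bsub>M\<^esub> g (z, x)) \<oplus>\<^bsub>M\<^esub> act z (f (x, y) \<oplus>\<^bsub>M\<^esub> g (x,
        y))
        = (act x (f (y, z)) \<oplus>\<^bsub>M\<^esub> act y (f (z, x)) \<oplus>\<^bsub>M\<^esub> act z (f (x, y)))
        \<oplus>\<^bsub>M\<^esub> (act x (g (y, z)) \<oplus>\<^bsub>M\<^esub> act y (g (z, x)) \<oplus>\<^bsub>M\<^esub> act z (g (x, y)))"
        using xyz F(6) G(6) by algebra
      also have "\<dots> = f (x \<otimes>\<^bsub>L\<^esub> y, z) \<oplus>\<^bsub>M\<^esub> g (x \<otimes>\<^bsub>L\<^esub> y, z) \<oplus>\<^bsub>M\<^esub> (f (y \<otimes>\<^bsub>L\<^esub> z, x) \<oplus>\<^bsub>M\<^esub> g (y \<otimes>\<^bsub>L\<^esub> z, x)) \<oplus>\<^bsub>M\<^esub>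
          (f (z \<otimes>\<^bsub>L\<^esub> x, y) \<oplus>\<^bsub>M\<^esub> g (z \<otimes>\<^bsub>L\<^esub> x, y))"
        unfolding F(5)[OF xyz] G(5)[OF xyz] using xyz b F(6) G(6) by algebra
      finally show "act x (f (y, z) \<oplus>\<^bsub>M\<^esub> g (y, z)) \<oplus>\<^bsub>M\<^esub> act y (f (z, x) \<oplus>\<^bsub>M\<^esub> g (z, x)) \<oplus>\<^bsub>M\<^esub> act z (f (x, y)
        \<oplus>\<^bsub>M\<^esub> g (x, y))
        = f (x \<otimes>\<^bsub>L\<^esub> y, z) \<oplus>\<^bsub>M\<^esub> g (x \<otimes>\<^bsub>L\<^esub> y, z) \<oplus>\<^bsub>M\<^esub> (f (y \<otimes>\<^bsub>L\<^esub> z, x) \<oplus>\<^bsub>M\<^esub> g (y \<otimes>\<^bsub>L\<^esub> z, x)) \<oplus>\<^bsub>M\<^esub>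
          (f (z \<otimes>\<^bsub>L\<^esub> x, y) \<oplus>\<^bsub>M\<^esub> g (z \<otimes>\<^bsub>L\<^esub> x, y))" .
    qed (auto simp: F(4) G(4) intro: module_homs_sum[OF _ _ M_module] F G)
  qed
  show "(\<lambda>x\<in>carrier L \<times> carrier L. a \<odot>\<^bsub>M\<^esub> f x) \<in> cocycles2 K L M act" if a: "a \<in> carrier K" for a
  proof (rule cocyclesI)
    fix x y z assume xyz: "x \<in> carrier L" "y \<in> carrier L" "z \<in> carrier L"
    have "a \<odot>\<^bsub>M\<^esub> (act x (f (y, z)) \<oplus>\<^bsub>M\<^esub> act y (f (z, x)) \<oplus>\<^bsub>M\<^esub> act z (f (x, y)))
        = a \<odot>\<^bsub>M\<^esub> (f (x \<otimes>\<^bsub>L\<^esub> y, z) \<oplus>\<^bsub>M\<^esub> f (y \<otimes>\<^bsub>L\<^esub> z, x) \<oplus>\<^bsub>M\<^esub> f (z \<otimes>\<^bsub>L\<^esub> x, y))"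
      by (simp add: F(5)[OF xyz])
    then show "act x (a \<odot>\<^bsub>M\<^esub> f (y, z)) \<oplus>\<^bsub>M\<^esub> act y (a \<odot>\<^bsub>M\<^esub> f (z, x)) \<oplus>\<^bsub>M\<^esub> act z (a \<odot>\<^bsub>M\<^esub> f (x, y))
        = a \<odot>\<^bsub>M\<^esub> f (x \<otimes>\<^bsub>L\<^esub> y, z) \<oplus>\<^bsub>M\<^esub> a \<odot>\<^bsub>M\<^esub> f (y \<otimes>\<^bsub>L\<^esub> z, x) \<oplus>\<^bsub>M\<^esub> a \<odot>\<^bsub>M\<^esub> f (z \<otimes>\<^bsub>L\<^esub> x, y)"
      using xyz a by (simp add: M.smult_r_distr act_smult_r act_closed bracket_closed F(6))
  qed (auto simp: F(4) a intro: module_homs_scale[OF _ _ M_module] F)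
qed

lemma coboundary2_apply:
  "\<lbrakk>x \<in> carrier L; y \<in> carrier L\<rbrakk> \<Longrightarrow>
    coboundary2 L M act b (x, y) = act x (b y) \<ominus>\<^bsub>M\<^esub> act y (b x) \<ominus>\<^bsub>M\<^esub> b (x \<otimes>\<^bsub>L\<^esub> y)"
  by (simp add: coboundary2_def)

text \<open>This is the vanishing of the square of the differential. The terms in which b meets a
  double bracket cancel by Jacobi, those of the form x \<cdot> b [y, z] occur on both sides, and the
  remaining ones match by \<open>act_bracket\<close>.\<close>

lemma coboundary2_cocycle:
  assumes b: "b \<in> module_homs K L M"
  shows "coboundary2 L M act b \<in> cocycles2 K L M act"
  unfolding coboundary2_def
proof (rule cocyclesI; unfold prod.case)
  note B = module_homs_closed[OF b]
  fix x assume x: "x \<in> carrier L"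
  show "(\<lambda>z. act z (b x) \<ominus>\<^bsub>M\<^esub> act x (b z) \<ominus>\<^bsub>M\<^esub> b (z \<otimes>\<^bsub>L\<^esub> x)) \<in> module_homs K L M"
    by (intro module_homs_diff M_module act_hom_l[OF B[OF x]] module_homs_comp[OF b act_hom[OF x]]
       module_homs_comp[OF bracket_hom_l[OF x] b])
  show "(\<lambda>z. act x (b z) \<ominus>\<^bsub>M\<^esub> act z (b x) \<ominus>\<^bsub>M\<^esub> b (x \<otimes>\<^bsub>L\<^esub> z)) \<in> module_homs K L M"
    by (intro module_homs_diff M_module act_hom_l[OF B[OF x]] module_homs_comp[OF b act_hom[OF x]]
       module_homs_comp[OF bracket_hom_r[OF x] b])
  show "act x (b x) \<ominus>\<^bsub>M\<^esub> act x (b x) \<ominus>\<^bsub>M\<^esub> b (x \<otimes>\<^bsub>L\<^esub> x) = \<zero>\<^bsub>M\<^esub>"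
    unfolding bracket_self[OF x] module_homs_zero[OF b L_module M_module]
    using x B[OF x] by algebra
  fix y z assume yz: "y \<in> carrier L" "z \<in> carrier L"
  note c = bracket_closed[OF x yz(1)] bracket_closed[OF yz] bracket_closed[OF yz(2) x]
  note c2 = bracket_closed[OF c(1) yz(2)] bracket_closed[OF c(2) x] bracket_closed[OF c(3) yz(1)]
  have "b ((x \<otimes>\<^bsub>L\<^esub> y) \<otimes>\<^bsub>L\<^esub> z) \<oplus>\<^bsub>M\<^esub> b ((y \<otimes>\<^bsub>L\<^esub> z) \<otimes>\<^bsub>L\<^esub> x) \<oplus>\<^bsub>M\<^esub> b ((z \<otimes>\<^bsub>L\<^esub> x) \<otimes>\<^bsub>L\<^esub> y) = \<zero>\<^bsub>M\<^esub>"
    using jacobi_left[OF x yz] c2 by (simp add: module_homs_add[OF b, symmetric] module_homs_zero[OF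
      b L_module M_module])
  \<comment> \<open>Jacobi is spent by eliminating one of three terms; what is left is an identity
    between independent elements of an abelian group.\<close>
  then have J: "b ((x \<otimes>\<^bsub>L\<^esub> y) \<otimes>\<^bsub>L\<^esub> z) = \<ominus>\<^bsub>M\<^esub> (b ((y \<otimes>\<^bsub>L\<^esub> z) \<otimes>\<^bsub>L\<^esub> x) \<oplus>\<^bsub>M\<^esub> b ((z \<otimes>\<^bsub>L\<^esub> x) \<otimes>\<^bsub>L\<^esub> y))"
    using B c2 by (metis M.M.a_assoc M.M.a_closed M.M.minus_equality)
  show "act x (act y (b z) \<ominus>\<^bsub>M\<^esub> act z (b y) \<ominus>\<^bsub>M\<^esub> b (y \<otimes>\<^bsub>L\<^esub> z)) \<oplus>\<^bsub>M\<^esub>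
      act y (act z (b x) \<ominus>\<^bsub>M\<^esub> act x (b z) \<ominus>\<^bsub>M\<^esub> b (z \<otimes>\<^bsub>L\<^esub> x)) \<oplus>\<^bsub>M\<^esub>
      act z (act x (b y) \<ominus>\<^bsub>M\<^esub> act y (b x) \<ominus>\<^bsub>M\<^esub> b (x \<otimes>\<^bsub>L\<^esub> y)) =
      act (x \<otimes>\<^bsub>L\<^esub> y) (b z) \<ominus>\<^bsub>M\<^esub> act z (b (x \<otimes>\<^bsub>L\<^esub> y)) \<ominus>\<^bsub>M\<^esub> b ((x \<otimes>\<^bsub>L\<^esub> y) \<otimes>\<^bsub>L\<^esub> z) \<oplus>\<^bsub>M\<^esub>
      (act (y \<otimes>\<^bsub>L\<^esub> z) (b x) \<ominus>\<^bsub>M\<^esub> act x (b (y \<otimes>\<^bsub>L\<^esub> z)) \<ominus>\<^bsub>M\<^esub> b ((y \<otimes>\<^bsub>L\<^esub> z) \<otimes>\<^bsub>L\<^esub> x)) \<oplus>\<^bsub>M\<^esub>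
      (act (z \<otimes>\<^bsub>L\<^esub> x) (b y) \<ominus>\<^bsub>M\<^esub> act y (b (z \<otimes>\<^bsub>L\<^esub> x)) \<ominus>\<^bsub>M\<^esub> b ((z \<otimes>\<^bsub>L\<^esub> x) \<otimes>\<^bsub>L\<^esub> y))"
    unfolding J using x yz
    by (simp add: act_minus act_bracket act_closed B bracket_closed M.M.coboundary_sum)
qed

text \<open>The coboundary formula is linear in b for arbitrary functions b. Taking all functions as
  the domain makes the coboundaries the image of a subspace under a linear map between function
  spaces.\<close>

lemma coboundary2_hom:
  "coboundary2 L M act \<in> module_homs K (fun_space (carrier L) M) (fun_space (carrier L \<times> carrier L)
    M)"
proof (rule module_homsI)
  fix b assume "b \<in> carrier (fun_space (carrier L) M)"
  then have B: "b x \<in> carrier M" if "x \<in> carrier L" for x using that by auto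
  show "coboundary2 L M act b \<in> carrier (fun_space (carrier L \<times> carrier L) M)"
    using B by (auto simp: coboundary2_def act_closed bracket_closed)
  show "coboundary2 L M act (a \<odot>\<^bsub>fun_space (carrier L) M\<^esub> b) =
      a \<odot>\<^bsub>fun_space (carrier L \<times> carrier L) M\<^esub> coboundary2 L M act b" if "a \<in> carrier K" for a
    using B that by (auto simp: coboundary2_def act_smult_r bracket_closed act_closed a_minus_def
       M.smult_r_distr M.smult_r_minus intro!: restrict_ext)
  fix c assume "c \<in> carrier (fun_space (carrier L) M)"
  then have C: "c x \<in> carrier M" if "x \<in> carrier L" for x using that by auto
  have "act x (b y \<oplus>\<^bsub>M\<^esub> c y) \<ominus>\<^bsub>M\<^esub> act y (b x \<oplus>\<^bsub>M\<^esub> c x) \<ominus>\<^bsub>M\<^esub> (b (x \<otimes>\<^bsub>L\<^esub> y) \<oplus>\<^bsub>M\<^esub> c (x \<otimes>\<^bsub>L\<^esub> y))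
    = (act x (b y) \<ominus>\<^bsub>M\<^esub> act y (b x) \<ominus>\<^bsub>M\<^esub> b (x \<otimes>\<^bsub>L\<^esub> y)) \<oplus>\<^bsub>M\<^esub> (act x (c y) \<ominus>\<^bsub>M\<^esub> act y (c x) \<ominus>\<^bsub>M\<^esub> c (x \<otimes>\<^bsub>L\<^esub> y))"
    if "x \<in> carrier L" "y \<in> carrier L" for x y
    using that B[OF that(1)] B[OF that(2)] C[OF that(1)] C[OF that(2)]
      B[OF bracket_closed[OF that]] C[OF bracket_closed[OF that]] by algebra
  then show "coboundary2 L M act (b \<oplus>\<^bsub>fun_space (carrier L) M\<^esub> c) =
     coboundary2 L M act b \<oplus>\<^bsub>fun_space (carrier L \<times> carrier L) M\<^esub> coboundary2 L M act c"
    by (auto simp: coboundary2_def bracket_closed intro!: restrict_ext)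
qed

lemma linear_maps_submodule:
  "submodule (module_homs K L M \<inter> extensional (carrier L)) K (fun_space (carrier L) M)"
proof (rule fun_space_submoduleI[OF M_module])
  have r: "restrict f (carrier L) \<in> module_homs K L M \<inter> extensional (carrier L)"
    if "f \<in> module_homs K L M" for f
    using module_homs_cong[OF that L_module, of "restrict f (carrier L)"] by auto
  show "module_homs K L M \<inter> extensional (carrier L) \<subseteq> carrier L \<rightarrow>\<^sub>E carrier M"
    by (auto simp: module_homs_def PiE_def)
  show "(\<lambda>x\<in>carrier L. \<zero>\<^bsub>M\<^esub>) \<in> module_homs K L M \<inter> extensional (carrier L)"
    by (rule r) (rule module_homs_const_zero[OF M_module])
  show "(\<lambda>x\<in>carrier L. f x \<oplus>\<^bsub>M\<^esub> g x) \<in> module_homs K L M \<inter> extensional (carrier L)"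
    if "f \<in> module_homs K L M \<inter> extensional (carrier L)" "g \<in> module_homs K L M \<inter> extensional
      (carrier L)" for f g
    by (rule r, rule module_homs_sum[OF _ _ M_module]) (use that in simp_all)
  show "(\<lambda>x\<in>carrier L. a \<odot>\<^bsub>M\<^esub> f x) \<in> module_homs K L M \<inter> extensional (carrier L)"
    if "a \<in> carrier K" "f \<in> module_homs K L M \<inter> extensional (carrier L)" for a f
    by (rule r, rule module_homs_scale[OF _ that(1) M_module]) (use that in simp)
qed

lemma coboundary2_cong:
  "(\<And>x. x \<in> carrier L \<Longrightarrow> b x = c x) \<Longrightarrow> coboundary2 L M act b = coboundary2 L M act c"
  unfolding coboundary2_def by (rule restrict_ext) (auto simp: bracket_closed)

text \<open>Members of \<open>module_homs\<close> may take any values off the carrier and are then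
  not elements of \<open>fun_space\<close>. Restricting them does not change the coboundary, so the
  coboundaries are the image of a genuine subspace.\<close>

lemma coboundaries2_eq:
  "coboundaries2 K L M act = coboundary2 L M act ` (module_homs K L M \<inter> extensional (carrier L))"
proof (intro equalityI subsetI)
  fix f assume "f \<in> coboundaries2 K L M act"
  then obtain b where b: "b \<in> module_homs K L M" "f = coboundary2 L M act b"
    by (auto simp: coboundaries2_def)
  show "f \<in> coboundary2 L M act ` (module_homs K L M \<inter> extensional (carrier L))"
  proof (rule image_eqI[of _ _ "restrict b (carrier L)"])
    show "f = coboundary2 L M act (restrict b (carrier L))"
      unfolding b(2) by (rule coboundary2_cong) simp
    show "restrict b (carrier L) \<in> module_homs K L M \<inter> extensional (carrier L)"
      using module_homs_cong[OF b(1) L_module, of "restrict b (carrier L)"] by simp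
  qed
qed (auto simp: coboundaries2_def)

lemma coboundaries2_subset: "coboundaries2 K L M act \<subseteq> cocycles2 K L M act"
  by (auto simp: coboundaries2_def coboundary2_cocycle)

lemma coboundaries2_submodule_fun:
  "submodule (coboundaries2 K L M act) K (fun_space (carrier L \<times> carrier L) M)"
  unfolding coboundaries2_eq
  by (rule submodule_image[OF coboundary2_hom fun_space_module fun_space_module
    linear_maps_submodule])

lemma cocycle_space_linear: "linear_space K (cocycle_space K L M act)"
  unfolding cocycle_space_def linear_space_iff
    by (rule module_subalg[OF cocycles_submodule fun_space_module])

lemma coboundaries2_submodule: "submodule (coboundaries2 K L M act) K (cocycle_space K L M act)"
  unfolding cocycle_space_def
  by (rule submodule_subalg[OF coboundaries2_submodule_fun cocycles_submodule coboundaries2_subset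
    fun_space_module])

lemma cocycle_space_simps [simp]:
  "carrier (cocycle_space K L M act) = cocycles2 K L M act"
  "\<zero>\<^bsub>cocycle_space K L M act\<^esub> = (\<lambda>x\<in>carrier L \<times> carrier L. \<zero>\<^bsub>M\<^esub>)"
  "add (cocycle_space K L M act) = (\<lambda>d e. \<lambda>x\<in>carrier L \<times> carrier L. d x \<oplus>\<^bsub>M\<^esub> e x)"
  "smult (cocycle_space K L M act) = (\<lambda>a d. \<lambda>x\<in>carrier L \<times> carrier L. a \<odot>\<^bsub>M\<^esub> d x)"
  by (simp_all add: cocycle_space_def)

lemma cocycle_space_minus:
  "\<lbrakk>d \<in> cocycles2 K L M act; e \<in> cocycles2 K L M act\<rbrakk> \<Longrightarrow>
    d \<ominus>\<^bsub>cocycle_space K L M act\<^esub> e = (\<lambda>x\<in>carrier L \<times> carrier L. d x \<ominus>\<^bsub>M\<^esub> e x)"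
  unfolding cocycle_space_def
  by (simp add: a_minus_subalg[OF cocycles_submodule fun_space_module] fun_space_minus[OF M_module]
    cocyclesD(1))

lemma H2_carrier: "carrier (H2 K L M act) = H2_class K L M act ` cocycles2 K L M act"
  by (simp add: H2_def)

lemma H2_zero: "\<zero>\<^bsub>H2 K L M act\<^esub> = H2_class K L M act (\<lambda>x\<in>carrier L \<times> carrier L. \<zero>\<^bsub>M\<^esub>)"
  unfolding H2_def using linear_space.rcos_zero[OF cocycle_space_linear coboundaries2_submodule]
    by simp

lemma H2_add:
  "\<lbrakk>d \<in> cocycles2 K L M act; e \<in> cocycles2 K L M act\<rbrakk> \<Longrightarrow>
   H2_class K L M act d \<oplus>\<^bsub>H2 K L M act\<^esub> H2_class K L M act e
    = H2_class K L M act (\<lambda>x\<in>carrier L \<times> carrier L. d x \<oplus>\<^bsub>M\<^esub> e x)"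
  unfolding H2_def using linear_space.quot_add[OF cocycle_space_linear coboundaries2_submodule]
    by simp

lemma H2_smult:
  "\<lbrakk>d \<in> cocycles2 K L M act; a \<in> carrier K\<rbrakk> \<Longrightarrow>
   a \<odot>\<^bsub>H2 K L M act\<^esub> H2_class K L M act d = H2_class K L M act (\<lambda>x\<in>carrier L \<times> carrier L. a \<odot>\<^bsub>M\<^esub> d x)"
  unfolding H2_def using linear_space.quot_smult[OF cocycle_space_linear coboundaries2_submodule]
    by simp

lemma H2_class_eq_iff:
  assumes "f \<in> cocycles2 K L M act" "g \<in> cocycles2 K L M act"
  shows "H2_class K L M act f = H2_class K L M act g \<longleftrightarrow>
    (\<exists>b\<in>module_homs K L M. \<forall>x\<in>carrier L. \<forall>y\<in>carrier L.
       f (x, y) = (act x (b y) \<ominus>\<^bsub>M\<^esub> act y (b x) \<ominus>\<^bsub>M\<^esub> b (x \<otimes>\<^bsub>L\<^esub> y)) \<oplus>\<^bsub>M\<^esub> g (x, y))"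
proof -
  have "H2_class K L M act f = H2_class K L M act g \<longleftrightarrow>
      (\<lambda>x\<in>carrier L \<times> carrier L. f x \<ominus>\<^bsub>M\<^esub> g x) \<in> coboundaries2 K L M act"
    using linear_space.rcos_eq_iff[OF cocycle_space_linear coboundaries2_submodule] assms
    by (simp add: cocycle_space_minus)
  also have "\<dots> \<longleftrightarrow> (\<exists>b\<in>module_homs K L M. \<forall>x\<in>carrier L. \<forall>y\<in>carrier L.
       f (x, y) \<ominus>\<^bsub>M\<^esub> g (x, y) = act x (b y) \<ominus>\<^bsub>M\<^esub> act y (b x) \<ominus>\<^bsub>M\<^esub> b (x \<otimes>\<^bsub>L\<^esub> y))"
    unfolding coboundaries2_def coboundary2_def image_iff
    by (intro bex_cong refl) (auto simp: restrict_def fun_eq_iff split: if_splits)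
  also have "\<dots> \<longleftrightarrow> (\<exists>b\<in>module_homs K L M. \<forall>x\<in>carrier L. \<forall>y\<in>carrier L.
       f (x, y) = (act x (b y) \<ominus>\<^bsub>M\<^esub> act y (b x) \<ominus>\<^bsub>M\<^esub> b (x \<otimes>\<^bsub>L\<^esub> y)) \<oplus>\<^bsub>M\<^esub> g (x, y))"
  proof (intro bex_cong ball_cong refl)
    fix b x y assume *: "b \<in> module_homs K L M" "x \<in> carrier L" "y \<in> carrier L"
    then have "act x (b y) \<ominus>\<^bsub>M\<^esub> act y (b x) \<ominus>\<^bsub>M\<^esub> b (x \<otimes>\<^bsub>L\<^esub> y) \<in> carrier M"
      by (simp add: module_homs_closed act_closed bracket_closed)
    then show "f (x, y) \<ominus>\<^bsub>M\<^esub> g (x, y) = act x (b y) \<ominus>\<^bsub>M\<^esub> act y (b x) \<ominus>\<^bsub>M\<^esub> b (x \<otimes>\<^bsub>L\<^esub> y) \<longleftrightarrow>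
      f (x, y) = act x (b y) \<ominus>\<^bsub>M\<^esub> act y (b x) \<ominus>\<^bsub>M\<^esub> b (x \<otimes>\<^bsub>L\<^esub> y) \<oplus>\<^bsub>M\<^esub> g (x, y)"
      using * cocyclesD(6)[OF assms(1)] cocyclesD(6)[OF assms(2)] by (metis M.M.eq_minus_iff)
  qed
  finally show ?thesis .
qed

end

section \<open>Extensions\<close>

locale lie_ext = lie_rep K L M act
  for K :: "('k, 'r) ring_scheme" (structure) and L :: "('k, 'a) module" (structure)
    and M :: "('k, 'm) module" (structure) and act :: "'a \<Rightarrow> 'm \<Rightarrow> 'm" +
  fixes E :: "('k, 'e) module" (structure) and i :: "'m \<Rightarrow> 'e" and p :: "'e \<Rightarrow> 'a"
  assumes ext: "lie_extension K L M act E i p"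

sublocale lie_ext \<subseteq> E: lie_alg K E
  using ext by (simp add: lie_extension_def lie_alg_def)

section \<open>Linear sections and the class of an extension\<close>

definition linear_sections ::
    "('k, 'r) ring_scheme \<Rightarrow> ('k, 'a) module \<Rightarrow> ('k, 'e) module \<Rightarrow> ('e \<Rightarrow> 'a) \<Rightarrow> ('a \<Rightarrow> 'e) set" where
  "linear_sections K L E p = {s \<in> module_homs K L E. \<forall>x\<in>carrier L. p (s x) = x}"

context lie_ext
begin

lemmas E_module = E.L_module

lemma i_hom: "i \<in> module_homs K M E"
  and i_inj: "inj_on i (carrier M)"
  and i_abelian: "\<lbrakk>m \<in> carrier M; n \<in> carrier M\<rbrakk> \<Longrightarrow> i m \<otimes>\<^bsub>E\<^esub> i n = \<zero>\<^bsub>E\<^esub>"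
  and p_hom: "p \<in> module_homs K E L"
  and p_bracket: "\<lbrakk>e \<in> carrier E; e' \<in> carrier E\<rbrakk> \<Longrightarrow> p (e \<otimes>\<^bsub>E\<^esub> e') = p e \<otimes>\<^bsub>L\<^esub> p e'"
  and p_surj: "p ` carrier E = carrier L"
  and kernel: "a_kernel E L p = i ` carrier M"
  and i_act: "\<lbrakk>e \<in> carrier E; n \<in> carrier M\<rbrakk> \<Longrightarrow> i (act (p e) n) = e \<otimes>\<^bsub>E\<^esub> i n"
  using ext by (auto simp: lie_extension_def lie_homs_def)

lemma p_i: "m \<in> carrier M \<Longrightarrow> p (i m) = \<zero>\<^bsub>L\<^esub>"
  using kernel by (auto simp: a_kernel_def')

lemma i_closed: "m \<in> carrier M \<Longrightarrow> i m \<in> carrier E"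
  by (rule module_homs_closed[OF i_hom])

lemma p_closed: "e \<in> carrier E \<Longrightarrow> p e \<in> carrier L"
  by (rule module_homs_closed[OF p_hom])

lemma i_inv:
  assumes "e \<in> carrier E" "p e = \<zero>\<^bsub>L\<^esub>"
  shows "inv_into (carrier M) i e \<in> carrier M" "i (inv_into (carrier M) i e) = e"
proof -
  have "e \<in> i ` carrier M" using kernel assms by (auto simp: a_kernel_def')
  then show "inv_into (carrier M) i e \<in> carrier M" "i (inv_into (carrier M) i e) = e"
    by (auto simp: inv_into_into f_inv_into_f)
qed

lemma inv_i: "m \<in> carrier M \<Longrightarrow> inv_into (carrier M) i (i m) = m"
  by (simp add: i_inj)

lemma i_eqD: "\<lbrakk>i m = i n; m \<in> carrier M; n \<in> carrier M\<rbrakk> \<Longrightarrow> m = n"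
  using i_inj by (simp add: inj_on_def)

lemma i_add: "\<lbrakk>m \<in> carrier M; n \<in> carrier M\<rbrakk> \<Longrightarrow> i (m \<oplus>\<^bsub>M\<^esub> n) = i m \<oplus>\<^bsub>E\<^esub> i n"
  by (rule module_homs_add[OF i_hom])

lemma i_minus: "\<lbrakk>m \<in> carrier M; n \<in> carrier M\<rbrakk> \<Longrightarrow> i (m \<ominus>\<^bsub>M\<^esub> n) = i m \<ominus>\<^bsub>E\<^esub> i n"
  by (rule module_homs_minus[OF i_hom M_module E_module])

text \<open>Injectivity of i reflects linearity. Maps into \<open>M\<close> that arise as preimages
  under i are linear for this reason.\<close>

lemma lift_through_i:
  assumes V: "module K V" and g: "(\<lambda>v. i (g v)) \<in> module_homs K V E" "\<And>v. v \<in> carrier V \<Longrightarrow>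
    g v \<in> carrier M"
  shows "g \<in> module_homs K V M"
proof -
  interpret V: linear_space K V unfolding linear_space_iff by fact
  show ?thesis
    by (rule module_homsI; (rule i_eqD)?)
      (auto simp: g(2) i_add module_homs_smult[OF i_hom] module_homs_add[OF g(1)]
        module_homs_smult[OF g(1)])
qed

lemma linear_section_exists: obtains s where "s \<in> linear_sections K L E p"
proof -
  obtain s where "s \<in> module_homs K L E" "\<And>x. x \<in> carrier L \<Longrightarrow> p (s x) = x"
    using module_homs_section[OF K.field_axioms E_module L_module p_hom p_surj] by blast
  then have "s \<in> linear_sections K L E p" by (simp add: linear_sections_def)
  then show ?thesis by (rule that)
qed

lemma linear_sectionsD:
  assumes "s \<in> linear_sections K L E p"
  shows "s \<in> module_homs K L E" "\<And>x. x \<in> carrier L \<Longrightarrow> p (s x) = x" "\<And>x. x \<in> carrier L \<Longrightarrow>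
    s x \<in> carrier E"
  using assms by (auto simp: linear_sections_def module_homs_closed)

text \<open>Since p respects brackets and s is a section, the defect [s x, s y] - s [x, y] lies in
  the kernel of p, which is the image of i; hence \<open>inv_into\<close> returns a true
  preimage.\<close>

lemma section_cocycle_apply:
  assumes s: "s \<in> linear_sections K L E p" and xy: "x \<in> carrier L" "y \<in> carrier L"
  shows "section_cocycle L M E i s (x, y) \<in> carrier M"
    "i (section_cocycle L M E i s (x, y)) = s x \<otimes>\<^bsub>E\<^esub> s y \<ominus>\<^bsub>E\<^esub> s (x \<otimes>\<^bsub>L\<^esub> y)"
proof -
  note S = linear_sectionsD[OF s]
  have c: "s x \<otimes>\<^bsub>E\<^esub> s y \<ominus>\<^bsub>E\<^esub> s (x \<otimes>\<^bsub>L\<^esub> y) \<in> carrier E"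
    using S xy by (simp add: bracket_closed E.bracket_closed)
  have "p (s x \<otimes>\<^bsub>E\<^esub> s y \<ominus>\<^bsub>E\<^esub> s (x \<otimes>\<^bsub>L\<^esub> y)) = \<zero>\<^bsub>L\<^esub>"
    using S xy by (simp add: module_homs_minus[OF p_hom E_module L_module] p_bracket bracket_closed
      E.bracket_closed L.M.minus_eq_zero_iff)
  then show "section_cocycle L M E i s (x, y) \<in> carrier M"
    "i (section_cocycle L M E i s (x, y)) = s x \<otimes>\<^bsub>E\<^esub> s y \<ominus>\<^bsub>E\<^esub> s (x \<otimes>\<^bsub>L\<^esub> y)"
    using i_inv[OF c] xy by (auto simp: section_cocycle_def)
qed

text \<open>All conditions are verified after applying the injective map i, where the action becomes
  the bracket with s x. Both sides of the cocycle identity then reduce to minus the cyclic sum of [s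
  x, s [y, z]]: on the left by Jacobi in \<open>E\<close>, on the right because s carries Jacobi in
  \<open>L\<close> to zero.\<close>

lemma section_cocycle_cocycle:
  assumes s: "s \<in> linear_sections K L E p"
  shows "section_cocycle L M E i s \<in> cocycles2 K L M act"
proof -
  note S = linear_sectionsD[OF s]
  let ?f = "section_cocycle L M E i s"
  note F = section_cocycle_apply[OF s]
  have "?f = restrict ?f (carrier L \<times> carrier L)" by (auto simp: section_cocycle_def)
  also have "\<dots> \<in> cocycles2 K L M act"
  proof (rule cocyclesI)
    fix x assume x: "x \<in> carrier L"
    have "(\<lambda>y. i (?f (x, y))) \<in> module_homs K L E"
      by (rule module_homs_cong[OF module_homs_diff[OF module_homs_comp[OF S(1) E.bracket_hom_r[OF
        S(3)[OF x]]]
        module_homs_comp[OF bracket_hom_r[OF x] S(1)] E_module] L_module]) (simp add: F x)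
    then show "(\<lambda>y. ?f (x, y)) \<in> module_homs K L M"
      by (rule lift_through_i[OF L_module]) (simp add: F x)
    have "(\<lambda>y. i (?f (y, x))) \<in> module_homs K L E"
      by (rule module_homs_cong[OF module_homs_diff[OF module_homs_comp[OF S(1) E.bracket_hom_l[OF
        S(3)[OF x]]]
        module_homs_comp[OF bracket_hom_l[OF x] S(1)] E_module] L_module]) (simp add: F x)
    then show "(\<lambda>y. ?f (y, x)) \<in> module_homs K L M"
      by (rule lift_through_i[OF L_module]) (simp add: F x)
    show "?f (x, x) = \<zero>\<^bsub>M\<^esub>"
      by (rule i_eqD) (use x S in \<open>simp_all add: F bracket_self E.bracket_self
        module_homs_zero[OF S(1) L_module E_module] module_homs_zero[OF i_hom M_module E_module]
          a_minus_def E.L.M.minus_zero_eq\<close>)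
    fix y z assume yz: "y \<in> carrier L" "z \<in> carrier L"
    note c = bracket_closed[OF x yz(1)] bracket_closed[OF yz] bracket_closed[OF yz(2) x]
    note c2 = bracket_closed[OF c(1) yz(2)] bracket_closed[OF c(2) x] bracket_closed[OF c(3) yz(1)]
    note sc = S(3)[OF x] S(3)[OF yz(1)] S(3)[OF yz(2)]
    note fc = F(1)[OF yz] F(1)[OF yz(2) x] F(1)[OF x yz(1)] F(1)[OF c(1) yz(2)] F(1)[OF c(2) x]
      F(1)[OF c(3) yz(1)]
    have i_act': "i (act u n) = s u \<otimes>\<^bsub>E\<^esub> i n" if "u \<in> carrier L" "n \<in> carrier M" for u n
      using i_act[of "s u" n] that S by simp
    have J: "s ((x \<otimes>\<^bsub>L\<^esub> y) \<otimes>\<^bsub>L\<^esub> z) \<oplus>\<^bsub>E\<^esub> s ((y \<otimes>\<^bsub>L\<^esub> z) \<otimes>\<^bsub>L\<^esub> x) \<oplus>\<^bsub>E\<^esub> s ((z \<otimes>\<^bsub>L\<^esub> x) \<otimes>\<^bsub>L\<^esub> y) = \<zero>\<^bsub>E\<^esub>"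
      using jacobi_left[OF x yz] c2
      by (simp add: module_homs_add[OF S(1), symmetric] module_homs_zero[OF S(1) L_module E_module])
    have JE: "s x \<otimes>\<^bsub>E\<^esub> (s y \<otimes>\<^bsub>E\<^esub> s z) \<oplus>\<^bsub>E\<^esub> s y \<otimes>\<^bsub>E\<^esub> (s z \<otimes>\<^bsub>E\<^esub> s x) \<oplus>\<^bsub>E\<^esub> s z \<otimes>\<^bsub>E\<^esub> (s x \<otimes>\<^bsub>E\<^esub> s y) = \<zero>\<^bsub>E\<^esub>"
      using sc by (rule E.jacobi)
    have 1: "i (act x (?f (y, z)) \<oplus>\<^bsub>M\<^esub> act y (?f (z, x)) \<oplus>\<^bsub>M\<^esub> act z (?f (x, y)))
      = s x \<otimes>\<^bsub>E\<^esub> (s y \<otimes>\<^bsub>E\<^esub> s z \<ominus>\<^bsub>E\<^esub> s (y \<otimes>\<^bsub>L\<^esub> z)) \<oplus>\<^bsub>E\<^esub> s y \<otimes>\<^bsub>E\<^esub> (s z \<otimes>\<^bsub>E\<^esub> s x \<ominus>\<^bsub>E\<^esub> s (z \<otimes>\<^bsub>L\<^esub> x))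
        \<oplus>\<^bsub>E\<^esub> s z \<otimes>\<^bsub>E\<^esub> (s x \<otimes>\<^bsub>E\<^esub> s y \<ominus>\<^bsub>E\<^esub> s (x \<otimes>\<^bsub>L\<^esub> y))"
      using x yz fc by (simp add: i_add i_act' act_closed F(2))
    also have "\<dots> = (s x \<otimes>\<^bsub>E\<^esub> (s y \<otimes>\<^bsub>E\<^esub> s z) \<oplus>\<^bsub>E\<^esub> s y \<otimes>\<^bsub>E\<^esub> (s z \<otimes>\<^bsub>E\<^esub> s x) \<oplus>\<^bsub>E\<^esub> s z \<otimes>\<^bsub>E\<^esub> (s x \<otimes>\<^bsub>E\<^esub> s y))
      \<ominus>\<^bsub>E\<^esub> s x \<otimes>\<^bsub>E\<^esub> s (y \<otimes>\<^bsub>L\<^esub> z) \<ominus>\<^bsub>E\<^esub> s y \<otimes>\<^bsub>E\<^esub> s (z \<otimes>\<^bsub>L\<^esub> x) \<ominus>\<^bsub>E\<^esub> s z \<otimes>\<^bsub>E\<^esub> s (x \<otimes>\<^bsub>L\<^esub> y)"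
      using sc S(3)[OF c(1)] S(3)[OF c(2)] S(3)[OF c(3)] by algebra
    also have "\<dots> = \<ominus>\<^bsub>E\<^esub> (s x \<otimes>\<^bsub>E\<^esub> s (y \<otimes>\<^bsub>L\<^esub> z)) \<ominus>\<^bsub>E\<^esub> s y \<otimes>\<^bsub>E\<^esub> s (z \<otimes>\<^bsub>L\<^esub> x) \<ominus>\<^bsub>E\<^esub> s z \<otimes>\<^bsub>E\<^esub> s (x \<otimes>\<^bsub>L\<^esub> y)"
      unfolding JE using sc S(3)[OF c(1)] S(3)[OF c(2)] S(3)[OF c(3)] by algebra
    finally have 1: "i (act x (?f (y, z)) \<oplus>\<^bsub>M\<^esub> act y (?f (z, x)) \<oplus>\<^bsub>M\<^esub> act z (?f (x, y))) = \<dots>" .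
    have "i (?f (x \<otimes>\<^bsub>L\<^esub> y, z) \<oplus>\<^bsub>M\<^esub> ?f (y \<otimes>\<^bsub>L\<^esub> z, x) \<oplus>\<^bsub>M\<^esub> ?f (z \<otimes>\<^bsub>L\<^esub> x, y))
      = (s (x \<otimes>\<^bsub>L\<^esub> y) \<otimes>\<^bsub>E\<^esub> s z \<ominus>\<^bsub>E\<^esub> s ((x \<otimes>\<^bsub>L\<^esub> y) \<otimes>\<^bsub>L\<^esub> z)) \<oplus>\<^bsub>E\<^esub> (s (y \<otimes>\<^bsub>L\<^esub> z) \<otimes>\<^bsub>E\<^esub> s x \<ominus>\<^bsub>E\<^esub> s ((y \<otimes>\<^bsub>L\<^esub> z) \<otimes>\<^bsub>L\<^esub> x))
        \<oplus>\<^bsub>E\<^esub> (s (z \<otimes>\<^bsub>L\<^esub> x) \<otimes>\<^bsub>E\<^esub> s y \<ominus>\<^bsub>E\<^esub> s ((z \<otimes>\<^bsub>L\<^esub> x) \<otimes>\<^bsub>L\<^esub> y))"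
      using x yz fc c by (simp add: i_add F(2))
    also have "\<dots> = s (x \<otimes>\<^bsub>L\<^esub> y) \<otimes>\<^bsub>E\<^esub> s z \<oplus>\<^bsub>E\<^esub> s (y \<otimes>\<^bsub>L\<^esub> z) \<otimes>\<^bsub>E\<^esub> s x \<oplus>\<^bsub>E\<^esub> s (z \<otimes>\<^bsub>L\<^esub> x) \<otimes>\<^bsub>E\<^esub> s y
        \<ominus>\<^bsub>E\<^esub> (s ((x \<otimes>\<^bsub>L\<^esub> y) \<otimes>\<^bsub>L\<^esub> z) \<oplus>\<^bsub>E\<^esub> s ((y \<otimes>\<^bsub>L\<^esub> z) \<otimes>\<^bsub>L\<^esub> x) \<oplus>\<^bsub>E\<^esub> s ((z \<otimes>\<^bsub>L\<^esub> x) \<otimes>\<^bsub>L\<^esub> y))"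
      using sc S(3)[OF c(1)] S(3)[OF c(2)] S(3)[OF c(3)] S(3)[OF c2(1)] S(3)[OF c2(2)] S(3)[OF
        c2(3)] by algebra
    also have "\<dots> = \<ominus>\<^bsub>E\<^esub> (s x \<otimes>\<^bsub>E\<^esub> s (y \<otimes>\<^bsub>L\<^esub> z)) \<ominus>\<^bsub>E\<^esub> s y \<otimes>\<^bsub>E\<^esub> s (z \<otimes>\<^bsub>L\<^esub> x) \<ominus>\<^bsub>E\<^esub> s z \<otimes>\<^bsub>E\<^esub> s (x \<otimes>\<^bsub>L\<^esub> y)"
      unfolding J E.bracket_antisym[OF sc(1) S(3)[OF c(2)]] E.bracket_antisym[OF sc(2) S(3)[OF
        c(3)]]
        E.bracket_antisym[OF sc(3) S(3)[OF c(1)]]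
      using sc S(3)[OF c(1)] S(3)[OF c(2)] S(3)[OF c(3)] by algebra
    finally show "act x (?f (y, z)) \<oplus>\<^bsub>M\<^esub> act y (?f (z, x)) \<oplus>\<^bsub>M\<^esub> act z (?f (x, y)) =
      ?f (x \<otimes>\<^bsub>L\<^esub> y, z) \<oplus>\<^bsub>M\<^esub> ?f (y \<otimes>\<^bsub>L\<^esub> z, x) \<oplus>\<^bsub>M\<^esub> ?f (z \<otimes>\<^bsub>L\<^esub> x, y)"
      unfolding 1[symmetric] by (intro i_eqD[of _ "?f (x \<otimes>\<^bsub>L\<^esub> y, z) \<oplus>\<^bsub>M\<^esub> ?f (y \<otimes>\<^bsub>L\<^esub> z, x) \<oplus>\<^bsub>M\<^esub> ?f (z \<otimes>\<^bsub>L\<^esub> x,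
        y)"])
        (use x yz fc in \<open>simp_all add: act_closed\<close>)
  qed
  finally show ?thesis .
qed

lemma linear_section_shift:
  assumes s: "s \<in> linear_sections K L E p" and b: "b \<in> module_homs K L M"
  shows "(\<lambda>x. s x \<oplus>\<^bsub>E\<^esub> i (b x)) \<in> linear_sections K L E p"
  using linear_sectionsD[OF s] module_homs_sum[OF _ module_homs_comp[OF b i_hom] E_module]
    module_homs_closed[OF b]
  by (auto simp: linear_sections_def module_homs_add[OF p_hom] p_i i_closed)

text \<open>In the expansion of [s x + i (b x), s y + i (b y)] the term [i (b x), i (b y)] vanishes
  because \<open>M\<close> is abelian inside \<open>E\<close>, and the two mixed terms are actions
  on values of b.\<close>

lemma section_cocycle_shift:
  assumes s: "s \<in> linear_sections K L E p" and b: "b \<in> module_homs K L M"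
    and s': "s' \<in> linear_sections K L E p" "\<And>x. x \<in> carrier L \<Longrightarrow> s' x = s x \<oplus>\<^bsub>E\<^esub> i (b x)"
    and xy: "x \<in> carrier L" "y \<in> carrier L"
  shows "section_cocycle L M E i s' (x, y) =
    (act x (b y) \<ominus>\<^bsub>M\<^esub> act y (b x) \<ominus>\<^bsub>M\<^esub> b (x \<otimes>\<^bsub>L\<^esub> y)) \<oplus>\<^bsub>M\<^esub> section_cocycle L M E i s (x, y)"
proof (rule i_eqD)
  note S = linear_sectionsD[OF s] and S' = linear_sectionsD[OF s'(1)] and B =
    module_homs_closed[OF b]
  note c = bracket_closed[OF xy]
  note cl = S(3)[OF xy(1)] S(3)[OF xy(2)] S(3)[OF c] i_closed[OF B[OF xy(1)]] i_closed[OF B[OF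
    xy(2)]] i_closed[OF B[OF c]]
  have i_act': "i (act u n) = s u \<otimes>\<^bsub>E\<^esub> i n" if "u \<in> carrier L" "n \<in> carrier M" for u n
    using i_act[of "s u" n] that S by simp
  have "i (section_cocycle L M E i s' (x, y)) =
     (s x \<oplus>\<^bsub>E\<^esub> i (b x)) \<otimes>\<^bsub>E\<^esub> (s y \<oplus>\<^bsub>E\<^esub> i (b y)) \<ominus>\<^bsub>E\<^esub> (s (x \<otimes>\<^bsub>L\<^esub> y) \<oplus>\<^bsub>E\<^esub> i (b (x \<otimes>\<^bsub>L\<^esub> y)))"
    using section_cocycle_apply(2)[OF s'(1) xy] xy c by (simp add: s'(2))
  also have "\<dots> = s x \<otimes>\<^bsub>E\<^esub> i (b y) \<oplus>\<^bsub>E\<^esub> i (b x) \<otimes>\<^bsub>E\<^esub> s y \<ominus>\<^bsub>E\<^esub> i (b (x \<otimes>\<^bsub>L\<^esub> y)) \<oplus>\<^bsub>E\<^esub> (s x \<otimes>\<^bsub>E\<^esub> s y \<ominus>\<^bsub>E\<^esub> s (x \<otimes>\<^bsub>L\<^esub> y))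
    \<oplus>\<^bsub>E\<^esub> i (b x) \<otimes>\<^bsub>E\<^esub> i (b y)"
    using cl by algebra
  also have "\<dots> = s x \<otimes>\<^bsub>E\<^esub> i (b y) \<ominus>\<^bsub>E\<^esub> s y \<otimes>\<^bsub>E\<^esub> i (b x) \<ominus>\<^bsub>E\<^esub> i (b (x \<otimes>\<^bsub>L\<^esub> y)) \<oplus>\<^bsub>E\<^esub> (s x \<otimes>\<^bsub>E\<^esub> s y \<ominus>\<^bsub>E\<^esub> s (x \<otimes>\<^bsub>L\<^esub> y))"
    unfolding i_abelian[OF B[OF xy(1)] B[OF xy(2)]] E.bracket_antisym[OF cl(2,4)] using cl
      by algebra
  also have "\<dots> = i ((act x (b y) \<ominus>\<^bsub>M\<^esub> act y (b x) \<ominus>\<^bsub>M\<^esub> b (x \<otimes>\<^bsub>L\<^esub> y)) \<oplus>\<^bsub>M\<^esub> section_cocycle L M E i s (x, y))"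
    using xy B c section_cocycle_apply[OF s xy] by (simp add: i_add i_minus i_act' act_closed)
  finally show "i (section_cocycle L M E i s' (x, y)) =
    i ((act x (b y) \<ominus>\<^bsub>M\<^esub> act y (b x) \<ominus>\<^bsub>M\<^esub> b (x \<otimes>\<^bsub>L\<^esub> y)) \<oplus>\<^bsub>M\<^esub> section_cocycle L M E i s (x, y))" .
qed (use xy in \<open>simp_all add: section_cocycle_apply[OF s] section_cocycle_apply[OF s'(1)]
  module_homs_closed[OF b]
   act_closed bracket_closed\<close>)

text \<open>The difference of two lifts of x lies in the kernel of p, and
  \<open>lift_through_i\<close> makes the resulting b linear.\<close>

lemma linear_sections_diff:
  assumes s: "s \<in> linear_sections K L E p" and s': "s' \<in> linear_sections K L E p"
  obtains b where "b \<in> module_homs K L M" "\<And>x. x \<in> carrier L \<Longrightarrow> s' x = s x \<oplus>\<^bsub>E\<^esub> i (b x)"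
proof -
  note S = linear_sectionsD[OF s] and S' = linear_sectionsD[OF s']
  define b where "b x = inv_into (carrier M) i (s' x \<ominus>\<^bsub>E\<^esub> s x)" for x
  have b: "b x \<in> carrier M" "i (b x) = s' x \<ominus>\<^bsub>E\<^esub> s x" if "x \<in> carrier L" for x
  proof -
    have c: "s' x \<ominus>\<^bsub>E\<^esub> s x \<in> carrier E" using S S' that by simp
    have "p (s' x \<ominus>\<^bsub>E\<^esub> s x) = \<zero>\<^bsub>L\<^esub>"
      using S S' that by (simp add: module_homs_minus[OF p_hom E_module L_module]
        L.M.minus_eq_zero_iff)
    then show "b x \<in> carrier M" "i (b x) = s' x \<ominus>\<^bsub>E\<^esub> s x"
      using i_inv[OF c] by (auto simp: b_def)
  qed
  have "(\<lambda>x. i (b x)) \<in> module_homs K L E"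
    by (rule module_homs_cong[OF module_homs_diff[OF S'(1) S(1) E_module] L_module]) (simp add: b)
  then have "b \<in> module_homs K L M"
    by (rule lift_through_i[OF L_module]) (rule b)
  moreover have "s' x = s x \<oplus>\<^bsub>E\<^esub> i (b x)" if "x \<in> carrier L" for x
    unfolding b(2)[OF that] using S(3)[OF that] S'(3)[OF that] by algebra
  ultimately show ?thesis using that by blast
qed

text \<open>Two linear sections differ by a linear map b into \<open>M\<close>, hence their cocycles
  by the coboundary of b. This justifies the definite description in
  \<open>ext_class\<close>.\<close>

lemma ext_class_eq:
  assumes s: "s \<in> linear_sections K L E p"
  shows "ext_class K L M act E i p = H2_class K L M act (section_cocycle L M E i s)"
  unfolding ext_class_def
proof (rule the_equality)
  show "\<exists>s'\<in>module_homs K L E. (\<forall>x\<in>carrier L. p (s' x) = x) \<and>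
      H2_class K L M act (section_cocycle L M E i s) =
        H2_class K L M act (section_cocycle L M E i s')"
    using s by (auto simp: linear_sections_def)
  fix c assume "\<exists>s'\<in>module_homs K L E. (\<forall>x\<in>carrier L. p (s' x) = x) \<and> c =
    H2_class K L M act (section_cocycle L M E i s')"
  then obtain s' where s': "s' \<in> linear_sections K L E p" "c =
    H2_class K L M act (section_cocycle L M E i s')"
    by (auto simp: linear_sections_def)
  obtain b where b: "b \<in> module_homs K L M" "\<And>x. x \<in> carrier L \<Longrightarrow> s' x = s x \<oplus>\<^bsub>E\<^esub> i (b x)"
    using linear_sections_diff[OF s s'(1)] by blast
  show "c = H2_class K L M act (section_cocycle L M E i s)"
    unfolding s'(2) H2_class_eq_iff[OF section_cocycle_cocycle[OF s'(1)] section_cocycle_cocycle[OF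
      s]]
    using section_cocycle_shift[OF s b(1) s'(1) b(2)] b(1) by blast
qed

end

text \<open>The standard extension with prescribed cocycle f. Its elements have the pair type over
  which the description in \<open>rho\<close> ranges.\<close>

definition twisted :: "('k, 'a) module \<Rightarrow> ('k, 'm) module \<Rightarrow> ('a \<Rightarrow> 'm \<Rightarrow> 'm) \<Rightarrow> ('a \<times> 'a \<Rightarrow> 'm) \<Rightarrow> ('k, 'm
  \<times> 'a) module" where
  "twisted L M act f = (semidirect L M act)
    \<lparr>mult := \<lambda>(m, x) (n, y). (act x n \<ominus>\<^bsub>M\<^esub> act y m \<oplus>\<^bsub>M\<^esub> f (x, y), x \<otimes>\<^bsub>L\<^esub> y)\<rparr>"

lemma semidirect_simps [simp]:
  "carrier (semidirect L M act) = carrier M \<times> carrier L"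
  "(m, x) \<otimes>\<^bsub>semidirect L M act\<^esub> (n, y) = (act x n \<ominus>\<^bsub>M\<^esub> act y m, x \<otimes>\<^bsub>L\<^esub> y)"
  "\<zero>\<^bsub>semidirect L M act\<^esub> = (\<zero>\<^bsub>M\<^esub>, \<zero>\<^bsub>L\<^esub>)"
  "(m, x) \<oplus>\<^bsub>semidirect L M act\<^esub> (n, y) = (m \<oplus>\<^bsub>M\<^esub> n, x \<oplus>\<^bsub>L\<^esub> y)"
  "a \<odot>\<^bsub>semidirect L M act\<^esub> (m, x) = (a \<odot>\<^bsub>M\<^esub> m, a \<odot>\<^bsub>L\<^esub> x)"
  by (simp_all add: semidirect_def)

lemma twisted_simps [simp]:
  "carrier (twisted L M act f) = carrier M \<times> carrier L"
  "(m, x) \<otimes>\<^bsub>twisted L M act f\<^esub> (n, y) = (act x n \<ominus>\<^bsub>M\<^esub> act y m \<oplus>\<^bsub>M\<^esub> f (x, y), x \<otimes>\<^bsub>L\<^esub> y)"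
  "\<zero>\<^bsub>twisted L M act f\<^esub> = (\<zero>\<^bsub>M\<^esub>, \<zero>\<^bsub>L\<^esub>)"
  "(m, x) \<oplus>\<^bsub>twisted L M act f\<^esub> (n, y) = (m \<oplus>\<^bsub>M\<^esub> n, x \<oplus>\<^bsub>L\<^esub> y)"
  "a \<odot>\<^bsub>twisted L M act f\<^esub> (m, x) = (a \<odot>\<^bsub>M\<^esub> m, a \<odot>\<^bsub>L\<^esub> x)"
  by (simp_all add: twisted_def)

text \<open>For the elements (l, x), (m, y), (n, z), \<open>xyn\<close> is x \<cdot> (y \<cdot> n),
  \<open>fx\<close> is x \<cdot> f(y, z), and \<open>g1\<close>, \<open>g2\<close>,
  \<open>g3\<close> are f([x, y], z), f([y, z], x), f([z, x], y). The action terms on l, m, n cancel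
  and leave the difference of the two sides of the cocycle identity.\<close>

lemma (in abelian_group) twisted_jacobi_sum:
  assumes "xyn \<in> carrier G" "xzm \<in> carrier G" "yzl \<in> carrier G" "yxn \<in> carrier G" "zxm \<in> carrier G"
    "zyl \<in> carrier G"
    "fx \<in> carrier G" "fy \<in> carrier G" "fz \<in> carrier G" "g1 \<in> carrier G" "g2 \<in> carrier G" "g3 \<in>
      carrier G"
  shows "((xyn \<ominus> xzm \<oplus> fx) \<ominus> (yzl \<ominus> zyl) \<oplus> \<ominus> g2) \<oplus> ((yzl \<ominus> yxn \<oplus> fy) \<ominus> (zxm \<ominus> xzm) \<oplus> \<ominus> g3) \<oplus>
    ((zxm \<ominus> zyl \<oplus> fz) \<ominus> (xyn \<ominus> yxn) \<oplus> \<ominus> g1) = (fx \<oplus> fy \<oplus> fz) \<ominus> (g1 \<oplus> g2 \<oplus> g3)"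
  using assms by algebra

context lie_rep
begin

text \<open>The linear structure ignores the product; leaving q free covers the semidirect product
  and all its twists at once.\<close>

lemma semidirect_mult_linear: "linear_space K ((semidirect L M act)\<lparr>mult := q\<rparr>)"
proof -
  let ?S = "(semidirect L M act)\<lparr>mult := q\<rparr>"
  have "abelian_group ?S"
  proof (rule abelian_groupI)
    fix e assume "e \<in> carrier (?S)"
    then obtain m x where "e = (m, x)" "m \<in> carrier M" "x \<in> carrier L" by auto
    then show "\<exists>e'\<in>carrier (?S). e' \<oplus>\<^bsub>?S\<^esub> e = \<zero>\<^bsub>?S\<^esub>"
      by (intro bexI[of _ "(\<ominus>\<^bsub>M\<^esub> m, \<ominus>\<^bsub>L\<^esub> x)"]) (auto simp: M.M.l_neg L.M.l_neg)
  qed (auto simp: M.M.a_ac L.M.a_ac)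
  then show ?thesis
    unfolding linear_space_iff
    by (intro moduleI) (auto simp: K.is_cring M.smult_l_distr M.smult_r_distr M.smult_assoc1
       L.smult_l_distr L.smult_r_distr L.smult_assoc1)
qed

text \<open>Bilinearity and alternation of the bracket come from those of f and of the action; the
  first component of the Jacobi sum is the defect of the cocycle identity.\<close>

lemma twisted_lie_alg:
  assumes f: "f \<in> cocycles2 K L M act"
  shows "lie_alg K (twisted L M act f)"
proof -
  interpret T: linear_space K "twisted L M act f" unfolding twisted_def
    by (rule semidirect_mult_linear)
  note F = cocyclesD[OF f]
  have Fs: "f (a \<odot>\<^bsub>L\<^esub> x, y) = a \<odot>\<^bsub>M\<^esub> f (x, y)" "f (x, a \<odot>\<^bsub>L\<^esub> y) = a \<odot>\<^bsub>M\<^esub> f (x, y)"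
    if "a \<in> carrier K" "x \<in> carrier L" "y \<in> carrier L" for a x y
    using module_homs_smult[OF F(3)] module_homs_smult[OF F(2)] that by auto
  show ?thesis
  proof (unfold_locales, goal_cases)
    case (1 u v) then show ?case by (auto simp: act_closed F(6) bracket_closed)
  next
    case (2 u v w)
    then obtain l x m y n z where uvw: "u = (l, x)" "v = (m, y)" "w = (n, z)"
      and c: "l \<in> carrier M" "m \<in> carrier M" "n \<in> carrier M" "x \<in> carrier L" "y \<in> carrier L" "z \<in>
        carrier L" by auto
    have "act (x \<oplus>\<^bsub>L\<^esub> y) n \<ominus>\<^bsub>M\<^esub> act z (l \<oplus>\<^bsub>M\<^esub> m) \<oplus>\<^bsub>M\<^esub> (f (x, z) \<oplus>\<^bsub>M\<^esub> f (y, z))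
      = act x n \<ominus>\<^bsub>M\<^esub> act z l \<oplus>\<^bsub>M\<^esub> f (x, z) \<oplus>\<^bsub>M\<^esub> (act y n \<ominus>\<^bsub>M\<^esub> act z m \<oplus>\<^bsub>M\<^esub> f (y, z))"
      using c F(6)[OF c(4,6)] F(6)[OF c(5,6)] by algebra
    then show ?case unfolding uvw using c by (simp add: F(8) bracket_l_distr)
  next
    case (3 u v w)
    then obtain l x m y n z where uvw: "u = (l, x)" "v = (m, y)" "w = (n, z)"
      and c: "l \<in> carrier M" "m \<in> carrier M" "n \<in> carrier M" "x \<in> carrier L" "y \<in> carrier L" "z \<in>
        carrier L" by auto
    have "act x (m \<oplus>\<^bsub>M\<^esub> n) \<ominus>\<^bsub>M\<^esub> act (y \<oplus>\<^bsub>L\<^esub> z) l \<oplus>\<^bsub>M\<^esub> (f (x, y) \<oplus>\<^bsub>M\<^esub> f (x, z))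
      = act x m \<ominus>\<^bsub>M\<^esub> act y l \<oplus>\<^bsub>M\<^esub> f (x, y) \<oplus>\<^bsub>M\<^esub> (act x n \<ominus>\<^bsub>M\<^esub> act z l \<oplus>\<^bsub>M\<^esub> f (x, z))"
      using c F(6)[OF c(4,6)] F(6)[OF c(4,5)] by algebra
    then show ?case unfolding uvw using c by (simp add: F(7) bracket_r_distr)
  next
    case (4 a u v)
    then show ?case
      by (auto simp: Fs act_smult_l act_smult_r bracket_smult_l a_minus_def M.smult_r_distr
        M.smult_r_minus act_closed F(6))
  next
    case (5 a u v)
    then show ?case
      by (auto simp: Fs act_smult_l act_smult_r bracket_smult_r a_minus_def M.smult_r_distr
        M.smult_r_minus act_closed F(6))
  next
    case (6 u)
    then show ?case by (auto simp: F(4) bracket_self act_closed a_minus_def M.M.r_neg)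
  next
    case (7 u v w)
    then obtain l x m y n z where uvw: "u = (l, x)" "v = (m, y)" "w = (n, z)"
      and c: "l \<in> carrier M" "m \<in> carrier M" "n \<in> carrier M" "x \<in> carrier L" "y \<in> carrier L" "z \<in>
        carrier L" by auto
    note b = bracket_closed[OF c(4,5)] bracket_closed[OF c(5,6)] bracket_closed[OF c(6,4)]
    note fc = F(6)[OF c(4,5)] F(6)[OF c(5,6)] F(6)[OF c(6,4)] F(6)[OF b(1) c(6)] F(6)[OF b(2) c(4)]
      F(6)[OF b(3) c(5)]
    have "act x (act y n \<ominus>\<^bsub>M\<^esub> act z m \<oplus>\<^bsub>M\<^esub> f (y, z)) \<ominus>\<^bsub>M\<^esub> act (y \<otimes>\<^bsub>L\<^esub> z) l \<oplus>\<^bsub>M\<^esub> f (x, y \<otimes>\<^bsub>L\<^esub> z) \<oplus>\<^bsub>M\<^esub>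
       (act y (act z l \<ominus>\<^bsub>M\<^esub> act x n \<oplus>\<^bsub>M\<^esub> f (z, x)) \<ominus>\<^bsub>M\<^esub> act (z \<otimes>\<^bsub>L\<^esub> x) m \<oplus>\<^bsub>M\<^esub> f (y, z \<otimes>\<^bsub>L\<^esub> x)) \<oplus>\<^bsub>M\<^esub>
       (act z (act x m \<ominus>\<^bsub>M\<^esub> act y l \<oplus>\<^bsub>M\<^esub> f (x, y)) \<ominus>\<^bsub>M\<^esub> act (x \<otimes>\<^bsub>L\<^esub> y) n \<oplus>\<^bsub>M\<^esub> f (z, x \<otimes>\<^bsub>L\<^esub> y))
      = (act x (f (y, z)) \<oplus>\<^bsub>M\<^esub> act y (f (z, x)) \<oplus>\<^bsub>M\<^esub> act z (f (x, y)))
       \<ominus>\<^bsub>M\<^esub> (f (x \<otimes>\<^bsub>L\<^esub> y, z) \<oplus>\<^bsub>M\<^esub> f (y \<otimes>\<^bsub>L\<^esub> z, x) \<oplus>\<^bsub>M\<^esub> f (z \<otimes>\<^bsub>L\<^esub> x, y))"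
      \<comment> \<open>The bracket produces f(x, [y, z]), whereas the cocycle identity speaks of
        f([y, z], x).\<close>
      unfolding cocycle_antisym[OF f b(1) c(6)] cocycle_antisym[OF f b(2) c(4)] cocycle_antisym[OF f
        b(3) c(5)]
      using c fc by (simp add: act_minus act_r_distr act_bracket act_closed M.M.twisted_jacobi_sum)
    also have "\<dots> = \<zero>\<^bsub>M\<^esub>"
      unfolding F(5)[OF c(4-6)] using fc by algebra
    finally show ?case unfolding uvw using c by (simp add: jacobi)
  qed
qed

text \<open>The semidirect product is the twist by the zero cocycle. The two products agree only on
  the carrier, since adding zero is neutral only there; the axioms are therefore transferred along
  \<open>eq\<close>.\<close>

lemma semidirect_lie_alg: "lie_alg K (semidirect L M act)"
proof -
  define z where "z = (\<lambda>u\<in>carrier L \<times> carrier L. \<zero>\<^bsub>M\<^esub>)"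
  have "z \<in> cocycles2 K L M act"
    unfolding z_def by (rule cocyclesI) (auto simp: module_homs_const_zero[OF M_module] act_zero)
  then interpret T: lie_alg K "twisted L M act z" by (rule twisted_lie_alg)
  interpret S: linear_space K "semidirect L M act"
    using semidirect_mult_linear[of "mult (semidirect L M act)"] by simp
  have eq: "u \<otimes>\<^bsub>semidirect L M act\<^esub> v = u \<otimes>\<^bsub>twisted L M act z\<^esub> v"
    if "u \<in> carrier M \<times> carrier L" "v \<in> carrier M \<times> carrier L" for u v
    using that by (auto simp: z_def act_closed)
  have ops: "add (semidirect L M act) = add (twisted L M act z)" "smult (semidirect L M act) =
    smult (twisted L M act z)"
    by (simp_all add: twisted_def)
  note [simp] = T.bracket_closed[simplified] T.L.M.a_closed[simplified] T.L.smult_closed[simplified]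
  show ?thesis
    by unfold_locales (simp_all add: eq ops T.bracket_l_distr T.bracket_r_distr T.bracket_smult_l
      T.bracket_smult_r T.bracket_self[simplified] T.jacobi[simplified])
qed

text \<open>The section x \<mapsto> (0, x) has cocycle f on the nose, not merely up to a coboundary.
  Hence every element of H^2 is the class of an extension on pairs.\<close>

lemma twisted_extension:
  assumes f: "f \<in> cocycles2 K L M act"
  shows "lie_ext K L M act (twisted L M act f) (\<lambda>m. (m, \<zero>\<^bsub>L\<^esub>)) snd"
    "(\<lambda>x. (\<zero>\<^bsub>M\<^esub>, x)) \<in> linear_sections K L (twisted L M act f) snd"
    "section_cocycle L M (twisted L M act f) (\<lambda>m. (m, \<zero>\<^bsub>L\<^esub>)) (\<lambda>x. (\<zero>\<^bsub>M\<^esub>, x)) = f"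
proof -
  interpret T: lie_alg K "twisted L M act f" by (rule twisted_lie_alg[OF f])
  note F = cocyclesD[OF f]
  have F0: "f (x, \<zero>\<^bsub>L\<^esub>) = \<zero>\<^bsub>M\<^esub>" "f (\<zero>\<^bsub>L\<^esub>, x) = \<zero>\<^bsub>M\<^esub>" if "x \<in> carrier L" for x
    using module_homs_zero[OF F(2) L_module M_module] module_homs_zero[OF F(3) L_module M_module]
      that by auto
  have "lie_extension K L M act (twisted L M act f) (\<lambda>m. (m, \<zero>\<^bsub>L\<^esub>)) snd"
    unfolding lie_extension_def
  proof (intro conjI)
    show "lie_algebra K (twisted L M act f)" using T.lie_alg_axioms by (simp add: lie_alg_def)
    show "(\<lambda>m. (m, \<zero>\<^bsub>L\<^esub>)) \<in> module_homs K M (twisted L M act f)" by (rule module_homsI) auto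
    show "snd \<in> lie_homs K (twisted L M act f) L" by (auto simp: lie_homs_def module_homs_def)
    show "snd ` carrier (twisted L M act f) = carrier L" using M.M.zero_closed
      by (auto simp: image_iff)
  qed (auto simp: inj_on_def a_kernel_def' bracket_self act_zero_l F0 a_minus_def M.M.minus_zero_eq
    act_closed
      bracket_zero_r)
  then show ext: "lie_ext K L M act (twisted L M act f) (\<lambda>m. (m, \<zero>\<^bsub>L\<^esub>)) snd"
    by (simp add: lie_ext_def lie_ext_axioms_def lie_rep_axioms)
  interpret X: lie_ext K L M act "twisted L M act f" "\<lambda>m. (m, \<zero>\<^bsub>L\<^esub>)" snd by (rule ext)
  show s: "(\<lambda>x. (\<zero>\<^bsub>M\<^esub>, x)) \<in> linear_sections K L (twisted L M act f) snd"
    by (auto simp: linear_sections_def intro!: module_homsI)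
  show "section_cocycle L M (twisted L M act f) (\<lambda>m. (m, \<zero>\<^bsub>L\<^esub>)) (\<lambda>x. (\<zero>\<^bsub>M\<^esub>, x)) = f"
  proof (rule PiE_ext[OF _ F(1)])
    show "section_cocycle L M (twisted L M act f) (\<lambda>m. (m, \<zero>\<^bsub>L\<^esub>)) (\<lambda>x. (\<zero>\<^bsub>M\<^esub>, x)) \<in> carrier L \<times> carrier
      L \<rightarrow>\<^sub>E carrier M"
      using cocyclesD(1)[OF X.section_cocycle_cocycle[OF s]] .
    fix u assume "u \<in> carrier L \<times> carrier L"
    then obtain x y where xy: "u = (x, y)" "x \<in> carrier L" "y \<in> carrier L" by auto
    have "(f (x, y), \<zero>\<^bsub>L\<^esub>) \<oplus>\<^bsub>twisted L M act f\<^esub> (\<zero>\<^bsub>M\<^esub>, x \<otimes>\<^bsub>L\<^esub> y) =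
       (\<zero>\<^bsub>M\<^esub>, x) \<otimes>\<^bsub>twisted L M act f\<^esub> (\<zero>\<^bsub>M\<^esub>, y)"
      using xy F(6) by (simp add: bracket_closed act_zero a_minus_def M.M.minus_zero_eq)
    then have "(f (x, y), \<zero>\<^bsub>L\<^esub>) = (\<zero>\<^bsub>M\<^esub>, x) \<otimes>\<^bsub>twisted L M act f\<^esub> (\<zero>\<^bsub>M\<^esub>, y) \<ominus>\<^bsub>twisted L M act f\<^esub> (\<zero>\<^bsub>M\<^esub>, x \<otimes>\<^bsub>L\<^esub> y)"
      by (subst T.L.M.eq_minus_iff) (use xy F(6) in \<open>auto simp: bracket_closed act_closed\<close>)
    then show "section_cocycle L M (twisted L M act f) (\<lambda>m. (m, \<zero>\<^bsub>L\<^esub>)) (\<lambda>x. (\<zero>\<^bsub>M\<^esub>, x)) u = f u"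
      using X.section_cocycle_apply(2)[OF s xy(2,3)] unfolding xy(1) by (metis prod.inject)
  qed
qed

end

section \<open>The modules attached to an ideal\<close>

text \<open>For a derivation d of the ideal, \<open>xudv\<close> is x \<cdot> (u \<cdot> d v) and
  \<open>vdxu\<close> is v \<cdot> d [x, u].\<close>

lemma (in abelian_group) der_act_ders_sum:
  assumes "xudv \<in> carrier G" "xvdu \<in> carrier G" "uxdv \<in> carrier G" "vxdu \<in> carrier G" "vdxu \<in>
    carrier G" "udxv \<in> carrier G"
  shows "(xudv \<ominus> xvdu) \<ominus> (((xudv \<ominus> uxdv) \<ominus> vdxu) \<oplus> (udxv \<ominus> (xvdu \<ominus> vxdu))) =
    (uxdv \<ominus> udxv) \<ominus> (vxdu \<ominus> vdxu)"
  using assms by algebra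

text \<open>Here \<open>xdyz\<close> is x \<cdot> d [y, z] and \<open>dxyz\<close> is d [x, [y, z]];
  the terms with a single action cancel.\<close>

lemma (in abelian_group) der_act_bracket_sum:
  assumes "xydz \<in> carrier G" "xdyz \<in> carrier G" "ydxz \<in> carrier G" "dyxz \<in> carrier G" "yxdz \<in>
    carrier G" "dxyz \<in> carrier G"
  shows "(xydz \<ominus> yxdz) \<ominus> (dxyz \<ominus> dyxz) =
    ((xydz \<ominus> xdyz) \<ominus> (ydxz \<ominus> dyxz)) \<ominus> ((yxdz \<ominus> ydxz) \<ominus> (xdyz \<ominus> dxyz))"
  using assms by algebra

locale ideal_rep = lie_rep K L M act
  for K :: "('k, 'r) ring_scheme" (structure) and L :: "('k, 'a) module" (structure)
    and M :: "('k, 'm) module" (structure) and act :: "'a \<Rightarrow> 'm \<Rightarrow> 'm" +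
  fixes H :: "'a set"
  assumes ideal: "lie_ideal K L H"
begin

abbreviation coset :: "'a \<Rightarrow> 'a set" ("\<pi>") where "\<pi> x \<equiv> H +>\<^bsub>L\<^esub> x"

lemma H_submodule: "submodule H K L" using ideal by (simp add: lie_ideal_def)

lemma H_ideal: "\<lbrakk>x \<in> carrier L; z \<in> H\<rbrakk> \<Longrightarrow> x \<otimes>\<^bsub>L\<^esub> z \<in> H"
  using ideal by (simp add: lie_ideal_def lie_ideal_axioms_def)

lemma H_ideal_r: "\<lbrakk>x \<in> carrier L; z \<in> H\<rbrakk> \<Longrightarrow> z \<otimes>\<^bsub>L\<^esub> x \<in> H"
  using ideal_closed_r[OF H_submodule H_ideal] .

lemma H_carrier: "z \<in> H \<Longrightarrow> z \<in> carrier L" by (rule L.submodule_carrier[OF H_submodule])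

lemma H_zero: "\<zero>\<^bsub>L\<^esub> \<in> H" by (rule L.submodule_zero[OF H_submodule])

lemma H_rep: "lie_rep K (subalg L H) M act"
proof -
  interpret H: lie_alg K "subalg L H"
    by (rule subalgebra[OF H_submodule]) (simp add: H_ideal H_carrier)
  show ?thesis
    by unfold_locales
      (simp_all add: H_carrier act_closed act_l_distr act_r_distr act_smult_l act_smult_r
        act_bracket)
qed

lemma Q_alg: "lie_alg K (quot_alg L H)"
  by (rule quot_lie_alg[OF H_submodule H_ideal])

lemma coset_eq_iff: "\<lbrakk>x \<in> carrier L; y \<in> carrier L\<rbrakk> \<Longrightarrow> \<pi> x = \<pi> y \<longleftrightarrow> x \<ominus>\<^bsub>L\<^esub> y \<in> H"
  by (rule L.rcos_eq_iff[OF H_submodule])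

lemma coset_H: "z \<in> H \<Longrightarrow> \<pi> z = H"
  by (rule L.rcos_absorb[OF H_submodule])

lemma coset_eq_self_iff: "x \<in> carrier L \<Longrightarrow> \<pi> x = H \<longleftrightarrow> x \<in> H"
  using coset_eq_iff[of x "\<zero>\<^bsub>L\<^esub>"] coset_H[OF H_zero] by (simp add: a_minus_def L.M.minus_zero_eq)

lemma coset_hom: "(\<lambda>x. \<pi> x) \<in> module_homs K L (quot_alg L H)"
  by (rule L.quot_proj_hom[OF H_submodule])

lemma coset_bracket: "\<lbrakk>x \<in> carrier L; y \<in> carrier L\<rbrakk> \<Longrightarrow> \<pi> x \<otimes>\<^bsub>quot_alg L H\<^esub> \<pi> y = \<pi> (x \<otimes>\<^bsub>L\<^esub> y)"
  by (rule quot_bracket[OF H_submodule H_ideal])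

lemmas coset_add = L.quot_add[OF H_submodule]
lemmas coset_smult = L.quot_smult[OF H_submodule]

lemma coset_decomp:
  assumes "x \<in> carrier L" "y \<in> carrier L" "\<pi> x = \<pi> y"
  obtains z where "z \<in> H" "x = z \<oplus>\<^bsub>L\<^esub> y"
proof (rule that)
  show "x \<ominus>\<^bsub>L\<^esub> y \<in> H" using assms by (simp add: coset_eq_iff)
  show "x = x \<ominus>\<^bsub>L\<^esub> y \<oplus>\<^bsub>L\<^esub> y" using assms(1,2) by algebra
qed

lemma hom_coset_const:
  assumes g: "g \<in> module_homs K L N" and N: "module K N" and 0: "\<And>z. z \<in> H \<Longrightarrow> g z = \<zero>\<^bsub>N\<^esub>"
    and x: "x \<in> carrier L" "y \<in> carrier L" "\<pi> x = \<pi> y"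
  shows "g x = g y"
proof -
  interpret N: linear_space K N unfolding linear_space_iff by fact
  obtain z where z: "z \<in> H" "x = z \<oplus>\<^bsub>L\<^esub> y" using coset_decomp[OF x] .
  show ?thesis
    using z x(2) 0 module_homs_closed[OF g x(2)] by (simp add: module_homs_add[OF g] H_carrier)
qed

subsection \<open>Invariants\<close>

abbreviation MH :: "'m set" where "MH \<equiv> invariants (subalg L H) M act"

lemma MH_iff: "m \<in> MH \<longleftrightarrow> m \<in> carrier M \<and> (\<forall>z\<in>H. act z m = \<zero>\<^bsub>M\<^esub>)"
  by (simp add: invariants_def)

lemma MH_submodule: "submodule MH K M"
  by (rule M.submoduleI)
    (auto simp: MH_iff act_zero act_neg act_r_distr act_smult_r H_carrier M.M.minus_zero_eq)

lemma inv_module_simps [simp]: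
  "carrier (inv_module L H M act) = MH"
  "\<zero>\<^bsub>inv_module L H M act\<^esub> = \<zero>\<^bsub>M\<^esub>"
  "add (inv_module L H M act) = add M"
  "smult (inv_module L H M act) = smult M"
  by (simp_all add: inv_module_def)

lemma inv_module_minus: "n \<in> MH \<Longrightarrow> m \<ominus>\<^bsub>inv_module L H M act\<^esub> n = m \<ominus>\<^bsub>M\<^esub> n"
  unfolding inv_module_def by (rule a_minus_subalg[OF MH_submodule M_module])

text \<open>Elements of \<open>H\<close> annihilate m, so x \<mapsto> x \<cdot> m is constant on the
  coset and \<open>the_elem\<close> is applied to a singleton.\<close>

lemma inv_act_coset:
  assumes x: "x \<in> carrier L" and m: "m \<in> MH"
  shows "inv_act act (\<pi> x) m = act x m"
proof -
  have m': "m \<in> carrier M" "\<And>z. z \<in> H \<Longrightarrow> act z m = \<zero>\<^bsub>M\<^esub>" using m by (auto simp: MH_iff)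
  have "act w m = act x m" if "w \<in> \<pi> x" for w
    using L.rcos_mem[OF H_submodule x that] x m'
    by (intro hom_coset_const[OF act_hom_l[OF m'(1)] M_module]) auto
  then have "(\<lambda>x. act x m) ` \<pi> x = (\<lambda>_. act x m) ` \<pi> x" by (intro image_cong refl)
  also have "\<dots> = {act x m}" by (rule image_constant[OF L.rcos_self[OF H_submodule x]])
  finally have "(\<lambda>x. act x m) ` \<pi> x = {act x m}" .
  then show ?thesis by (simp add: inv_act_def)
qed

text \<open>For z in \<open>H\<close>, z \<cdot> (x \<cdot> m) = x \<cdot> (z \<cdot> m) - [x, z]
  \<cdot> m, and [x, z] lies in the ideal.\<close>

lemma act_MH:
  assumes x: "x \<in> carrier L" and m: "m \<in> MH"
  shows "act x m \<in> MH"
proof -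
  have m': "m \<in> carrier M" "\<And>z. z \<in> H \<Longrightarrow> act z m = \<zero>\<^bsub>M\<^esub>" using m by (auto simp: MH_iff)
  have "act z (act x m) = \<zero>\<^bsub>M\<^esub>" if z: "z \<in> H" for z
  proof -
    have "act (x \<otimes>\<^bsub>L\<^esub> z) m = act x (act z m) \<ominus>\<^bsub>M\<^esub> act z (act x m)"
      using x z m' by (simp add: act_bracket H_carrier)
    then have "act x (act z m) \<ominus>\<^bsub>M\<^esub> act z (act x m) = \<zero>\<^bsub>M\<^esub>"
      using m'(2)[OF H_ideal[OF x z]] by simp
    then show ?thesis
      using x z m' by (simp add: M.M.minus_eq_zero_iff act_closed H_carrier act_zero)
  qed
  then show ?thesis using x m' by (simp add: MH_iff act_closed)
qed

lemma Q_rep: "lie_rep K (quot_alg L H) (inv_module L H M act) (inv_act act)"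
proof -
  interpret Q: lie_alg K "quot_alg L H" by (rule Q_alg)
  interpret I: linear_space K "inv_module L H M act"
    unfolding linear_space_iff inv_module_def by (rule module_subalg[OF MH_submodule M_module])
  note [simp] = inv_act_coset act_MH coset_add coset_smult coset_bracket M.submodule_carrier[OF
    MH_submodule]
    bracket_closed I.M.a_closed[simplified] I.smult_closed[simplified] inv_module_minus
  note [simp del] = quot_alg_simps(2-5)
  show ?thesis
    by unfold_locales (auto simp: act_l_distr act_r_distr act_smult_l act_smult_r act_bracket)
qed

end

sublocale ideal_rep \<subseteq> H: lie_rep K "subalg L H" M act by (rule H_rep)
sublocale ideal_rep \<subseteq> Q: lie_rep K "quot_alg L H" "inv_module L H M act" "inv_act act"
  by (rule Q_rep)

context ideal_rep
begin

subsection \<open>The action on the first cohomology of the ideal\<close>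

abbreviation ders_H where "ders_H \<equiv> ders K (subalg L H) M act"
abbreviation class_H where "class_H \<equiv> H1_class K (subalg L H) M act"
abbreviation H1_H where "H1_H \<equiv> H1 K (subalg L H) M act"

lemma ders_HD:
  assumes "d \<in> ders_H"
  shows "d \<in> module_homs K (subalg L H) M" "d \<in> extensional H"
    "\<And>z. z \<in> H \<Longrightarrow> d z \<in> carrier M"
    "\<And>z w. \<lbrakk>z \<in> H; w \<in> H\<rbrakk> \<Longrightarrow> d (z \<otimes>\<^bsub>L\<^esub> w) = act z (d w) \<ominus>\<^bsub>M\<^esub> act w (d z)"
    "\<And>z w. \<lbrakk>z \<in> H; w \<in> H\<rbrakk> \<Longrightarrow> d (z \<oplus>\<^bsub>L\<^esub> w) = d z \<oplus>\<^bsub>M\<^esub> d w"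
    "\<And>z w. \<lbrakk>z \<in> H; w \<in> H\<rbrakk> \<Longrightarrow> d (z \<ominus>\<^bsub>L\<^esub> w) = d z \<ominus>\<^bsub>M\<^esub> d w"
    "\<And>a w. \<lbrakk>a \<in> carrier K; w \<in> H\<rbrakk> \<Longrightarrow> d (a \<odot>\<^bsub>L\<^esub> w) = a \<odot>\<^bsub>M\<^esub> d w"
  using H.dersD[OF assms] module_homs_add[of d K "subalg L H" M] module_homs_smult[of d K "subalg L
    H" M]
    module_homs_minus[of d K "subalg L H" M, OF _ H.L_module M_module]
  by (auto simp: a_minus_subalg[OF H_submodule L_module])

lemma der_act_apply: "z \<in> H \<Longrightarrow> der_act L H M act x d z = act x (d z) \<ominus>\<^bsub>M\<^esub> d (x \<otimes>\<^bsub>L\<^esub> z)"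
  by (simp add: der_act_def)

text \<open>Combines the product rule of ad x on [u, v] with \<open>act_bracket\<close>, which moves
  x past u and v.\<close>

lemma der_act_ders:
  assumes x: "x \<in> carrier L" and d: "d \<in> ders_H"
  shows "der_act L H M act x d \<in> ders_H"
proof -
  note D = ders_HD[OF d]
  have "(\<lambda>z. act x (d z) \<ominus>\<^bsub>M\<^esub> d (x \<otimes>\<^bsub>L\<^esub> z)) \<in> module_homs K (subalg L H) M"
  proof (rule module_homs_diff[OF module_homs_comp[OF D(1) act_hom[OF x]] module_homs_comp[OF _
    D(1)] M_module])
    show "(\<lambda>z. x \<otimes>\<^bsub>L\<^esub> z) \<in> module_homs K (subalg L H) (subalg L H)"
      using x by (intro module_homsI) (auto simp: H_ideal H_carrier bracket_r_distr bracket_smult_r)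
  qed
  then have "(\<lambda>z\<in>carrier (subalg L H). act x (d z) \<ominus>\<^bsub>M\<^esub> d (x \<otimes>\<^bsub>L\<^esub> z)) \<in> ders_H"
  proof (rule H.restrict_dersI)
    fix u v assume "u \<in> carrier (subalg L H)" "v \<in> carrier (subalg L H)"
    then have uv: "u \<in> H" "v \<in> H" by simp_all
    note c = uv[THEN H_carrier] H_ideal[OF x uv(1)] H_ideal[OF x uv(2)]
    have l: "x \<otimes>\<^bsub>L\<^esub> (u \<otimes>\<^bsub>L\<^esub> v) = (x \<otimes>\<^bsub>L\<^esub> u) \<otimes>\<^bsub>L\<^esub> v \<oplus>\<^bsub>L\<^esub> u \<otimes>\<^bsub>L\<^esub> (x \<otimes>\<^bsub>L\<^esub> v)"
      unfolding leibniz[OF x c(1,2)] using bracket_closed[OF x bracket_closed[OF c(1,2)]]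
        bracket_closed[OF c(1) bracket_closed[OF x c(2)]] by algebra
    show "act x (d (u \<otimes>\<^bsub>subalg L H\<^esub> v)) \<ominus>\<^bsub>M\<^esub> d (x \<otimes>\<^bsub>L\<^esub> (u \<otimes>\<^bsub>subalg L H\<^esub> v)) =
       act u (act x (d v) \<ominus>\<^bsub>M\<^esub> d (x \<otimes>\<^bsub>L\<^esub> v)) \<ominus>\<^bsub>M\<^esub> act v (act x (d u) \<ominus>\<^bsub>M\<^esub> d (x \<otimes>\<^bsub>L\<^esub> u))"
      using x uv c by (simp add: l D act_minus act_bracket act_closed H_ideal bracket_closed
        M.M.der_act_ders_sum)
  qed
  then show ?thesis by (simp add: der_act_def)
qed

text \<open>The derivation law gives d [z, w] = z \<cdot> d w - w \<cdot> d z, so z \<cdot> d is the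
  inner derivation of d z. Thus \<open>H\<close> acts trivially on its own first cohomology, which
  is what lets the action of \<open>L\<close> descend to the quotient.\<close>

lemma der_act_inner:
  assumes d: "d \<in> ders_H" and z: "z \<in> H" "w \<in> H"
  shows "der_act L H M act z d w = act w (d z)"
proof -
  note D = ders_HD[OF d]
  have "act z (d w) \<ominus>\<^bsub>M\<^esub> (act z (d w) \<ominus>\<^bsub>M\<^esub> act w (d z)) = act w (d z)"
    using act_closed[OF H_carrier[OF z(1)] D(3)[OF z(2)]] act_closed[OF H_carrier[OF z(2)] D(3)[OF
      z(1)]]
    by algebra
  then show ?thesis using z by (simp add: der_act_apply D)
qed

lemma der_act_hom:
  "x \<in> carrier L \<Longrightarrow> der_act L H M act x \<in> module_homs K (der_space K (subalg L H) M act) (der_space K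
    (subalg L H) M act)"
proof (rule module_homsI)
  assume x: "x \<in> carrier L"
  fix d assume "d \<in> carrier (der_space K (subalg L H) M act)"
  then have d: "d \<in> ders_H" by simp
  show "der_act L H M act x d \<in> carrier (der_space K (subalg L H) M act)"
    using der_act_ders[OF x d] by simp
  show "der_act L H M act x (a \<odot>\<^bsub>der_space K (subalg L H) M act\<^esub> d) =
    a \<odot>\<^bsub>der_space K (subalg L H) M act\<^esub> der_act L H M act x d"
    if "a \<in> carrier K" for a
    using that x ders_HD[OF d] by (auto simp: der_act_def H_ideal act_smult_r act_closed a_minus_def
      M.smult_r_distr M.smult_r_minus intro!: restrict_ext)
  fix e assume "e \<in> carrier (der_space K (subalg L H) M act)"
  then have e: "e \<in> ders_H" by simp
  have "act x (d z \<oplus>\<^bsub>M\<^esub> e z) \<ominus>\<^bsub>M\<^esub> (d (x \<otimes>\<^bsub>L\<^esub> z) \<oplus>\<^bsub>M\<^esub> e (x \<otimes>\<^bsub>L\<^esub> z)) =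
     act x (d z) \<ominus>\<^bsub>M\<^esub> d (x \<otimes>\<^bsub>L\<^esub> z) \<oplus>\<^bsub>M\<^esub> (act x (e z) \<ominus>\<^bsub>M\<^esub> e (x \<otimes>\<^bsub>L\<^esub> z))" if z: "z \<in> H" for z
    using x ders_HD(3)[OF d z] ders_HD(3)[OF e z] ders_HD(3)[OF d H_ideal[OF x z]] ders_HD(3)[OF e
      H_ideal[OF x z]]
    by algebra
  then show "der_act L H M act x (d \<oplus>\<^bsub>der_space K (subalg L H) M act\<^esub> e) =
    der_act L H M act x d \<oplus>\<^bsub>der_space K (subalg L H) M act\<^esub> der_act L H M act x e"
    using x by (auto simp: der_act_def H_ideal intro!: restrict_ext)
qed

lemma der_act_hom_l:
  assumes d: "d \<in> ders_H"
  shows "(\<lambda>x. der_act L H M act x d) \<in> module_homs K L (der_space K (subalg L H) M act)"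
proof (rule module_homsI)
  note D = ders_HD[OF d]
  fix x assume x: "x \<in> carrier L"
  show "der_act L H M act x d \<in> carrier (der_space K (subalg L H) M act)"
    using der_act_ders[OF x d] by simp
  show "der_act L H M act (a \<odot>\<^bsub>L\<^esub> x) d = a \<odot>\<^bsub>der_space K (subalg L H) M act\<^esub> der_act L H M act x d"
    if "a \<in> carrier K" for a
    using that x by (auto simp: der_act_def H_ideal act_smult_l act_closed a_minus_def H_carrier
      bracket_smult_l D
      M.smult_r_distr M.smult_r_minus intro!: restrict_ext)
  fix y assume y: "y \<in> carrier L"
  have "act (x \<oplus>\<^bsub>L\<^esub> y) (d z) \<ominus>\<^bsub>M\<^esub> (d (x \<otimes>\<^bsub>L\<^esub> z) \<oplus>\<^bsub>M\<^esub> d (y \<otimes>\<^bsub>L\<^esub> z)) =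
     act x (d z) \<ominus>\<^bsub>M\<^esub> d (x \<otimes>\<^bsub>L\<^esub> z) \<oplus>\<^bsub>M\<^esub> (act y (d z) \<ominus>\<^bsub>M\<^esub> d (y \<otimes>\<^bsub>L\<^esub> z))" if z: "z \<in> H" for z
    using x y D(3)[OF z] D(3)[OF H_ideal[OF x z]] D(3)[OF H_ideal[OF y z]] by algebra
  then show "der_act L H M act (x \<oplus>\<^bsub>L\<^esub> y) d =
    der_act L H M act x d \<oplus>\<^bsub>der_space K (subalg L H) M act\<^esub> der_act L H M act y d"
    using x y by (auto simp: der_act_def H_ideal H_carrier bracket_l_distr D intro!: restrict_ext)
qed

lemma der_act_bracket:
  assumes x: "x \<in> carrier L" and y: "y \<in> carrier L" and d: "d \<in> ders_H"
  shows "der_act L H M act (x \<otimes>\<^bsub>L\<^esub> y) d = der_act L H M act x (der_act L H M act y d)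
    \<ominus>\<^bsub>der_space K (subalg L H) M act\<^esub> der_act L H M act y (der_act L H M act x d)"
proof -
  note D = ders_HD[OF d]
  show ?thesis
    unfolding H.der_space_minus[OF der_act_ders[OF x der_act_ders[OF y d]] der_act_ders[OF y
      der_act_ders[OF x d]]]
  proof (rule extensionalityI)
    fix z assume z: "z \<in> H"
    note h = H_ideal[OF x z] H_ideal[OF y z] H_ideal[OF x H_ideal[OF y z]] H_ideal[OF y H_ideal[OF x
      z]]
    show "der_act L H M act (x \<otimes>\<^bsub>L\<^esub> y) d z = (\<lambda>z\<in>carrier (subalg L H).
       der_act L H M act x (der_act L H M act y d) z \<ominus>\<^bsub>M\<^esub> der_act L H M act y (der_act L H M act x d)
         z) z"
      using x y z h D(3)[OF z] D(3)[OF h(1)] D(3)[OF h(2)] D(3)[OF h(3)] D(3)[OF h(4)]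
      by (simp add: der_act_apply leibniz H_carrier D act_bracket act_minus act_closed
        M.M.der_act_bracket_sum)
  qed (auto simp: der_act_def)
qed

text \<open>Both representatives may change. Writing w = h + x and e = d + \<delta>(m) gives w
  \<cdot> e = \<delta>(e h) + \<delta>(x \<cdot> m) + x \<cdot> d, with \<open>der_act_inner\<close>
  applied to h.\<close>

lemma H1_act_class:
  assumes x: "x \<in> carrier L" and d: "d \<in> ders_H"
  shows "H1_act K L H M act (\<pi> x) (class_H d) = class_H (der_act L H M act x d)"
  unfolding H1_act_def
proof (rule L.Union_rcos_const[OF H_submodule x], rule linear_space.Union_rcos_const[OF
  H.der_space_linear H.inner_ders_submodule])
  show "d \<in> carrier (der_space K (subalg L H) M act)" using d by simp
  fix w e assume w: "w \<in> carrier L" "\<pi> w = \<pi> x" and "e \<in> carrier (der_space K (subalg L H) M act)"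
    and ed: "class_H e = class_H d"
  then have e: "e \<in> ders_H" by simp
  obtain h where h: "h \<in> H" "w = h \<oplus>\<^bsub>L\<^esub> x" using coset_decomp[OF w(1) x w(2)] .
  obtain m where m: "m \<in> carrier M" "\<And>z. z \<in> H \<Longrightarrow> e z = act z m \<oplus>\<^bsub>M\<^esub> d z"
    using ed H.H1_class_eq_iff[OF e d] by auto
  note D = ders_HD[OF d] and E = ders_HD[OF e]
  show "class_H (der_act L H M act w e) = class_H (der_act L H M act x d)"
    unfolding H.H1_class_eq_iff[OF der_act_ders[OF w(1) e] der_act_ders[OF x d]]
  proof (intro bexI ballI)
    show "act x m \<oplus>\<^bsub>M\<^esub> e h \<in> carrier M" using x m(1) E(3)[OF h(1)] by (simp add: act_closed)
    fix z assume "z \<in> carrier (subalg L H)"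
    then have z: "z \<in> H" by simp
    note hc = H_carrier[OF h(1)] H_carrier[OF z] H_ideal[OF x z]
    have "der_act L H M act w e z = der_act L H M act h e z \<oplus>\<^bsub>M\<^esub> der_act L H M act x e z"
      unfolding h(2) using module_homs_add[OF der_act_hom_l[OF e] hc(1) x] z by simp
    also have "\<dots> = act z (e h) \<oplus>\<^bsub>M\<^esub> (act x (e z) \<ominus>\<^bsub>M\<^esub> e (x \<otimes>\<^bsub>L\<^esub> z))"
      using z by (simp add: der_act_inner[OF e h(1) z]) (simp add: der_act_apply)
    also have "\<dots> = act z (e h) \<oplus>\<^bsub>M\<^esub> (act x (act z m \<oplus>\<^bsub>M\<^esub> d z) \<ominus>\<^bsub>M\<^esub> (act (x \<otimes>\<^bsub>L\<^esub> z) m \<oplus>\<^bsub>M\<^esub> d (x \<otimes>\<^bsub>L\<^esub> z)))"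
      by (simp add: m(2) z hc)
    also have "\<dots> = act z (act x m \<oplus>\<^bsub>M\<^esub> e h) \<oplus>\<^bsub>M\<^esub> (act x (d z) \<ominus>\<^bsub>M\<^esub> d (x \<otimes>\<^bsub>L\<^esub> z))"
      using x hc m(1) E(3)[OF h(1)] D(3)[OF z] D(3)[OF hc(3)] by algebra
    finally show "der_act L H M act w e z = act z (act x m \<oplus>\<^bsub>M\<^esub> e h) \<oplus>\<^bsub>M\<^esub> der_act L H M act x d z"
      using z by (simp add: der_act_apply)
  qed
qed

text \<open>The laws already hold for \<open>der_act\<close> on derivations, where it is linear in
  both slots and respects brackets; only the passage to classes remains. The operations of
  \<open>der_space\<close> are kept folded for this.\<close>

lemma C_rep: "lie_rep K (quot_alg L H) H1_H (H1_act K L H M act)"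
proof -
  interpret C: linear_space K H1_H by (rule H.H1_module)
  note Dlin = H.der_space_linear[unfolded linear_space_iff]
  have class_add: "class_H d \<oplus>\<^bsub>H1_H\<^esub> class_H e = class_H (d \<oplus>\<^bsub>der_space K (subalg L H) M act\<^esub> e)"
    and class_minus: "class_H d \<ominus>\<^bsub>H1_H\<^esub> class_H e = class_H (d \<ominus>\<^bsub>der_space K (subalg L H) M act\<^esub> e)"
    if "d \<in> ders_H" "e \<in> ders_H" for d e
    using module_homs_add[OF H.H1_class_hom] module_homs_minus[OF H.H1_class_hom Dlin
      C.module_axioms] that
    by (simp_all del: H.der_space_simps(2-4))
  have class_smult: "a \<odot>\<^bsub>H1_H\<^esub> class_H d = class_H (a \<odot>\<^bsub>der_space K (subalg L H) M act\<^esub> d)"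
    if "a \<in> carrier K" "d \<in> ders_H" for d a
    using module_homs_smult[OF H.H1_class_hom] that by (simp del: H.der_space_simps(2-4))
  have cl: "d \<oplus>\<^bsub>der_space K (subalg L H) M act\<^esub> e \<in> ders_H" if "d \<in> ders_H" "e \<in> ders_H" for d e
    using abelian_groupE(1)[OF module.axioms(2)[OF Dlin]] that by (simp del: H.der_space_simps(2-4))
  have cl2: "a \<odot>\<^bsub>der_space K (subalg L H) M act\<^esub> d \<in> ders_H" if "a \<in> carrier K" "d \<in> ders_H" for d a
    using module.smult_closed[OF Dlin] that by (simp del: H.der_space_simps(2-4))
  have da: "der_act L H M act (x \<oplus>\<^bsub>L\<^esub> y) d = der_act L H M act x d \<oplus>\<^bsub>der_space K (subalg L H) M act\<^esub>
    der_act L H M act y d"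
    if "x \<in> carrier L" "y \<in> carrier L" "d \<in> ders_H" for x y d
    using that module_homs_add[OF der_act_hom_l] by (auto simp del: H.der_space_simps(2-4))
  have da3: "der_act L H M act (a \<odot>\<^bsub>L\<^esub> x) d = a \<odot>\<^bsub>der_space K (subalg L H) M act\<^esub> der_act L H M act x d"
     "der_act L H M act x (a \<odot>\<^bsub>der_space K (subalg L H) M act\<^esub> d) =
       a \<odot>\<^bsub>der_space K (subalg L H) M act\<^esub> der_act L H M act x d"
    if "x \<in> carrier L" "d \<in> ders_H" "a \<in> carrier K" for x d a
    using that module_homs_smult[OF der_act_hom_l]
      module_homs_smult[OF der_act_hom] by (auto simp del: H.der_space_simps(2-4))
  have da2: "der_act L H M act x (d \<oplus>\<^bsub>der_space K (subalg L H) M act\<^esub> e) =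
    der_act L H M act x d \<oplus>\<^bsub>der_space K (subalg L H) M act\<^esub> der_act L H M act x e"
    if "x \<in> carrier L" "d \<in> ders_H" "e \<in> ders_H" for x d e
    using that module_homs_add[OF der_act_hom] by (auto simp del: H.der_space_simps(2-4))
  note [simp] = H1_act_class coset_add coset_smult coset_bracket class_add class_minus class_smult
    cl cl2 da da2 da3
    der_act_bracket der_act_ders bracket_closed H.H1_carrier
  note [simp del] = quot_alg_simps(2-5) H.der_space_simps(2-4)
  show ?thesis
    by unfold_locales (unfold quot_alg_simps(1) H.H1_carrier, (elim imageE; simp)+)
qed

end

sublocale ideal_rep \<subseteq> C: lie_rep K "quot_alg L H" H1_H "H1_act K L H M act" by (rule C_rep)

section \<open>Inflation and restriction in degree one\<close>

context lie_rep
begin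

lemma zero_ders: "(\<lambda>x\<in>carrier L. \<zero>\<^bsub>M\<^esub>) \<in> ders K L M act"
  by (rule restrict_dersI[OF module_homs_const_zero[OF M_module]])
    (simp add: act_zero a_minus_def M.M.minus_zero_eq)

lemma zero_cocycle: "(\<lambda>x\<in>carrier L \<times> carrier L. \<zero>\<^bsub>M\<^esub>) \<in> cocycles2 K L M act"
  by (rule cocyclesI) (auto simp: module_homs_const_zero[OF M_module] act_zero)

lemma H1_class_zero_iff:
  assumes "d \<in> ders K L M act"
  shows "H1_class K L M act d = \<zero>\<^bsub>H1 K L M act\<^esub> \<longleftrightarrow> (\<exists>m\<in>carrier M. \<forall>x\<in>carrier L. d x = act x m)"
  unfolding H1_zero H1_class_eq_iff[OF assms zero_ders] by (simp add: act_closed cong: bex_cong)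

end

context ideal_rep
begin

abbreviation ders_Q where "ders_Q \<equiv> ders K (quot_alg L H) (inv_module L H M act) (inv_act act)"
abbreviation class_Q where "class_Q \<equiv> H1_class K (quot_alg L H) (inv_module L H M act) (inv_act
  act)"
abbreviation H1_Q where "H1_Q \<equiv> H1 K (quot_alg L H) (inv_module L H M act) (inv_act act)"
abbreviation class2_Q where "class2_Q \<equiv> H2_class K (quot_alg L H) (inv_module L H M act) (inv_act
  act)"
abbreviation cocycles_Q where "cocycles_Q \<equiv> cocycles2 K (quot_alg L H) (inv_module L H M act)
  (inv_act act)"
abbreviation H2_Q where "H2_Q \<equiv> H2 K (quot_alg L H) (inv_module L H M act) (inv_act act)"
abbreviation ders_L where "ders_L \<equiv> ders K L M act"
abbreviation class_L where "class_L \<equiv> H1_class K L M act"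
abbreviation cocycles_L where "cocycles_L \<equiv> cocycles2 K L M act"
abbreviation class2_L where "class2_L \<equiv> H2_class K L M act"

section \<open>Descending maps along the projection to the quotient\<close>

lemma coset_closed: "x \<in> carrier L \<Longrightarrow> \<pi> x \<in> carrier (quot_alg L H)"
  by simp

lemma cosetE:
  assumes "X \<in> carrier (quot_alg L H)" obtains x where "x \<in> carrier L" "X = \<pi> x"
  using assms by auto

lemma descend_fun:
  assumes "\<And>x y. \<lbrakk>x \<in> carrier L; y \<in> carrier L; \<pi> x = \<pi> y\<rbrakk> \<Longrightarrow> g x = g y"
  obtains h where "h \<in> extensional (carrier (quot_alg L H))" "\<And>x. x \<in> carrier L \<Longrightarrow> h (\<pi> x) = g x"
proof (rule that)
  let ?h = "\<lambda>X\<in>carrier (quot_alg L H). g (SOME x. x \<in> carrier L \<and> \<pi> x = X)"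
  show "?h \<in> extensional (carrier (quot_alg L H))" by simp
  fix x assume x: "x \<in> carrier L"
  then have c: "(SOME y. y \<in> carrier L \<and> \<pi> y = \<pi> x) \<in> carrier L \<and> \<pi> (SOME y. y \<in> carrier L \<and> \<pi> y =
    \<pi> x) = \<pi> x"
    by (intro someI[of "\<lambda>y. y \<in> carrier L \<and> \<pi> y = \<pi> x"]) simp
  have "g (SOME y. y \<in> carrier L \<and> \<pi> y = \<pi> x) = g x"
    by (rule assms) (use c x in blast)+
  then show "?h (\<pi> x) = g x" using coset_closed[OF x] by (simp del: quot_alg_simps)
qed

text \<open>The universal property of the quotient, with an extensional factor because derivations
  on the quotient have to be extensional.\<close>

lemma descend_hom:
  assumes g: "g \<in> module_homs K L N" and N: "module K N" and 0: "\<And>z. z \<in> H \<Longrightarrow> g z = \<zero>\<^bsub>N\<^esub>"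
  obtains h where "h \<in> module_homs K (quot_alg L H) N" "h \<in> extensional (carrier (quot_alg L H))"
    "\<And>x. x \<in> carrier L \<Longrightarrow> h (\<pi> x) = g x"
proof -
  obtain h where h: "h \<in> extensional (carrier (quot_alg L H))" "\<And>x. x \<in> carrier L \<Longrightarrow> h (\<pi> x) = g x"
    using descend_fun[of g] hom_coset_const[OF g N 0] by metis
  then show ?thesis using that L.quot_homI[OF H_submodule g] by blast
qed

lemma ders_QD:
  assumes "d \<in> ders_Q" "x \<in> carrier L"
  shows "d (\<pi> x) \<in> MH" "d (\<pi> x) \<in> carrier M" "\<And>z. z \<in> H \<Longrightarrow> act z (d (\<pi> x)) = \<zero>\<^bsub>M\<^esub>"
    "y \<in> carrier L \<Longrightarrow> d (\<pi> (x \<otimes>\<^bsub>L\<^esub> y)) = act x (d (\<pi> y)) \<ominus>\<^bsub>M\<^esub> act y (d (\<pi> x))"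
proof -
  have c: "d (\<pi> v) \<in> MH" if "v \<in> carrier L" for v
    using Q.dersD(4)[OF assms(1), of "\<pi> v"] that by simp
  show "d (\<pi> x) \<in> MH" "d (\<pi> x) \<in> carrier M" "\<And>z. z \<in> H \<Longrightarrow> act z (d (\<pi> x)) = \<zero>\<^bsub>M\<^esub>"
    using c[OF assms(2)] by (auto simp: MH_iff)
  show "d (\<pi> (x \<otimes>\<^bsub>L\<^esub> y)) = act x (d (\<pi> y)) \<ominus>\<^bsub>M\<^esub> act y (d (\<pi> x))" if y: "y \<in> carrier L"
    using Q.dersD(5)[OF assms(1) coset_closed[OF assms(2)] coset_closed[OF y]] assms(2) y c
    by (simp add: coset_bracket inv_act_coset inv_module_minus act_MH del: quot_alg_simps)
qed

text \<open>For z in \<open>H\<close>, 0 = D [z, x] = z \<cdot> D x - x \<cdot> D z = z \<cdot> D x: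
  a derivation that kills the ideal takes invariant values by itself.\<close>

lemma descend_der:
  assumes D: "D \<in> ders_L" and 0: "\<And>z. z \<in> H \<Longrightarrow> D z = \<zero>\<^bsub>M\<^esub>"
  obtains d where "d \<in> ders_Q" "\<And>x. x \<in> carrier L \<Longrightarrow> d (\<pi> x) = D x"
proof -
  note D' = dersD[OF D]
  have MH: "D x \<in> MH" if x: "x \<in> carrier L" for x
  proof -
    have "act z (D x) = \<zero>\<^bsub>M\<^esub>" if z: "z \<in> H" for z
      using D'(5)[OF H_carrier[OF z] x] 0[OF z] 0[OF H_ideal_r[OF x z]] x D'(4)[OF x] act_closed[OF
        H_carrier[OF z] D'(4)[OF x]]
      by (simp add: act_zero a_minus_def M.M.minus_zero_eq)
    then show ?thesis using D'(4)[OF x] by (simp add: MH_iff)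
  qed
  have "D \<in> module_homs K L (inv_module L H M act)"
    using D'(1) MH by (auto simp: inv_module_def module_homs_into_subalg M.submodule_carrier[OF
      MH_submodule] subset_eq)
  then obtain d where d: "d \<in> module_homs K (quot_alg L H) (inv_module L H M act)"
      "d \<in> extensional (carrier (quot_alg L H))" "\<And>x. x \<in> carrier L \<Longrightarrow> d (\<pi> x) = D x"
    using descend_hom[OF _ Q.M_module, of D] 0 by auto
  have "d \<in> ders_Q"
  proof (rule Q.dersI[OF d(1,2)])
    fix X Y assume "X \<in> carrier (quot_alg L H)" "Y \<in> carrier (quot_alg L H)"
    then obtain x y where xy: "x \<in> carrier L" "X = \<pi> x" "y \<in> carrier L" "Y = \<pi> y"
      by (auto elim!: cosetE)
    show "d (X \<otimes>\<^bsub>quot_alg L H\<^esub> Y) = inv_act act X (d Y) \<ominus>\<^bsub>inv_module L H M act\<^esub> inv_act act Y (d X)"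
      unfolding xy(2,4) coset_bracket[OF xy(1,3)] d(3)[OF xy(1)] d(3)[OF xy(3)] d(3)[OF
        bracket_closed[OF xy(1,3)]]
      using xy by (simp add: inv_act_coset MH inv_module_minus act_MH D'(5))
  qed
  then show ?thesis using that d(3) by blast
qed

section \<open>Inflation of derivations and its kernel\<close>

definition infl1 :: "('a set \<Rightarrow> 'm) \<Rightarrow> 'a \<Rightarrow> 'm" where
  "infl1 d = (\<lambda>x\<in>carrier L. d (\<pi> x))"

lemma infl1_hom: "infl1 \<in> module_homs K
   (der_space K (quot_alg L H) (inv_module L H M act) (inv_act act)) (der_space K L M act)"
proof (rule module_homsI)
  fix d assume "d \<in> carrier (der_space K (quot_alg L H) (inv_module L H M act) (inv_act act))"
  then have d: "d \<in> ders_Q" by simp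
  have "d \<in> module_homs K (quot_alg L H) M"
    using Q.dersD(1)[OF d] unfolding inv_module_def
    by (simp add: module_homs_into_subalg M.submoduleE(1)[OF MH_submodule])
  from module_homs_comp[OF coset_hom this] show "infl1 d \<in> carrier (der_space K L M act)"
    unfolding infl1_def der_space_simps(1) by (rule restrict_dersI) (rule ders_QD(4)[OF d])
qed (auto simp: infl1_def intro!: restrict_ext)

lemma infl1_ders: "d \<in> ders_Q \<Longrightarrow> infl1 d \<in> ders_L"
  using module_homs_closed[OF infl1_hom] by simp

lemma infl1_inner: "infl1 ` inner_ders (quot_alg L H) (inv_module L H M act) (inv_act act) \<subseteq>
  inner_ders L M act"
proof
  fix D assume "D \<in> infl1 ` inner_ders (quot_alg L H) (inv_module L H M act) (inv_act act)"
  then obtain m where m: "m \<in> MH" "D = infl1 (\<lambda>X\<in>carrier (quot_alg L H). inv_act act X m)"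
    unfolding Q.inner_ders_eq by auto
  have "D = (\<lambda>x\<in>carrier L. act x m)"
    unfolding m(2) infl1_def by (rule restrict_ext) (simp add: inv_act_coset m(1))
  then show "D \<in> inner_ders L M act" using m(1) unfolding inner_ders_eq MH_iff by blast
qed

lemma inf1_class: "d \<in> ders_Q \<Longrightarrow> inf1 K L H M act (class_Q d) = class_L (infl1 d)"
  unfolding inf1_def infl1_def[symmetric, abs_def]
  using linear_space.induced_rcos[OF Q.der_space_linear Q.inner_ders_submodule infl1_hom
     der_space_linear[unfolded linear_space_iff] inner_ders_submodule infl1_inner] by simp

lemma inf1_hom: "inf1 K L H M act \<in> module_homs K H1_Q (H1 K L M act)"
  unfolding inf1_def infl1_def[symmetric, abs_def] H1_def
  by (rule linear_space.induced_hom[OF Q.der_space_linear Q.inner_ders_submodule infl1_hom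
     der_space_linear[unfolded linear_space_iff] inner_ders_submodule infl1_inner])

text \<open>If the inflation of d is the inner derivation of m, then z \<cdot> m = d(H) = 0 for z in
  \<open>H\<close>; thus m is invariant and d is already inner over the quotient.\<close>

lemma inf1_kernel: "a_kernel H1_Q (H1 K L M act) (inf1 K L H M act) = {\<zero>\<^bsub>H1_Q\<^esub>}"
proof (intro equalityI subsetI)
  fix C assume "C \<in> a_kernel H1_Q (H1 K L M act) (inf1 K L H M act)"
  then obtain d where d: "d \<in> ders_Q" "C = class_Q d" "class_L (infl1 d) = \<zero>\<^bsub>H1 K L M act\<^esub>"
    by (auto simp: a_kernel_def' Q.H1_carrier inf1_class)
  then obtain m where m: "m \<in> carrier M" "\<And>x. x \<in> carrier L \<Longrightarrow> d (\<pi> x) = act x m"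
    by (auto simp: H1_class_zero_iff infl1_ders) (auto simp: infl1_def)
  have "act z m = \<zero>\<^bsub>M\<^esub>" if z: "z \<in> H" for z
    using module_homs_zero[OF Q.dersD(1)[OF d(1)] Q.L_module Q.M_module] m(2)[OF H_carrier[OF z]]
      coset_H[OF z] by simp
  then have "m \<in> MH" using m(1) by (simp add: MH_iff)
  then have "\<exists>n\<in>carrier (inv_module L H M act). \<forall>X\<in>carrier (quot_alg L H). d X = inv_act act X n"
    by (auto intro!: bexI[of _ m] simp: m(2) inv_act_coset)
  then have "d \<in> inner_ders (quot_alg L H) (inv_module L H M act) (inv_act act)"
    using Q.dersD(2)[OF d(1)] unfolding Q.inner_ders_eq
    by (auto simp del: quot_alg_simps inv_module_simps intro!: extensionalityI[of d])
  then show "C \<in> {\<zero>\<^bsub>H1_Q\<^esub>}"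
    using linear_space.rcos_absorb[OF Q.der_space_linear Q.inner_ders_submodule]
      by (simp add: d(2) H1_def)
next
  interpret H1Q: linear_space K H1_Q by (rule Q.H1_module)
  fix C assume "C \<in> {\<zero>\<^bsub>H1_Q\<^esub>}"
  then show "C \<in> a_kernel H1_Q (H1 K L M act) (inf1 K L H M act)"
    using module_homs_zero[OF inf1_hom H1Q.module_axioms H1_module[unfolded linear_space_iff]]
    by (auto simp: a_kernel_def')
qed

text \<open>The preimage of the invariant classes in the derivations of \<open>H\<close>, spelled
  out without cohomology; the element m may depend on x in any way.\<close>

definition inv_ders :: "('a \<Rightarrow> 'm) set" where
  "inv_ders = {d \<in> ders_H. \<forall>x\<in>carrier L. \<exists>m\<in>carrier M. \<forall>z\<in>H. der_act L H M act x d z = act z m}"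

end

section \<open>Restriction of derivations and exactness at H^1(L, M)\<close>

context lie_rep
begin

text \<open>The correction by a coboundary in degree one. It leaves the class alone, and a suitable
  m makes the derivation vanish on \<open>H\<close>.\<close>

lemma shift_inner_ders:
  assumes "d \<in> ders K L M act" "m \<in> carrier M"
  shows "(\<lambda>x\<in>carrier L. d x \<ominus>\<^bsub>M\<^esub> act x m) \<in> ders K L M act"
    "H1_class K L M act (\<lambda>x\<in>carrier L. d x \<ominus>\<^bsub>M\<^esub> act x m) = H1_class K L M act d"
proof -
  have "(\<lambda>x\<in>carrier L. d x \<ominus>\<^bsub>M\<^esub> act x m) = d \<ominus>\<^bsub>der_space K L M act\<^esub> inner_der L act m"
    unfolding der_space_minus[OF assms(1) inner_der_ders[OF assms(2)]]
    by (rule restrict_ext) (simp add: inner_der_def)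
  also have "\<dots> \<in> ders K L M act"
    using abelian_group.minus_closed[OF module.axioms(2)[OF der_space_linear[unfolded
      linear_space_iff]]]
      assms(1) inner_der_ders[OF assms(2)] by simp
  finally show *: "(\<lambda>x\<in>carrier L. d x \<ominus>\<^bsub>M\<^esub> act x m) \<in> ders K L M act" .
  have "d x \<ominus>\<^bsub>M\<^esub> act x m = act x (\<ominus>\<^bsub>M\<^esub> m) \<oplus>\<^bsub>M\<^esub> d x" if "x \<in> carrier L" for x
    using that assms(2) dersD(4)[OF assms(1) that] by algebra
  then show "H1_class K L M act (\<lambda>x\<in>carrier L. d x \<ominus>\<^bsub>M\<^esub> act x m) = H1_class K L M act d"
    unfolding H1_class_eq_iff[OF * assms(1)] using assms(2) by auto
qed

end

context ideal_rep
begin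

lemma inv_dersD:
  assumes "d \<in> inv_ders"
  shows "d \<in> ders_H" "x \<in> carrier L \<Longrightarrow> \<exists>m\<in>carrier M. \<forall>z\<in>H. der_act L H M act x d z = act z m"
  using assms by (auto simp: inv_ders_def)

lemma H1_inv_carrier: "carrier (H1_inv K L H M act) = class_H ` inv_ders"
proof -
  have "class_H d \<in> invariants (quot_alg L H) H1_H (H1_act K L H M act) \<longleftrightarrow> d \<in> inv_ders"
    if d: "d \<in> ders_H" for d
    using d by (simp add: invariants_def H.H1_carrier H1_act_class H.H1_class_zero_iff der_act_ders
      inv_ders_def)
  then show ?thesis
    by (auto simp: H1_inv_def) (auto simp: invariants_def H.H1_carrier inv_ders_def)
qed

lemma H1_inv_simps [simp]:
  "\<zero>\<^bsub>H1_inv K L H M act\<^esub> = \<zero>\<^bsub>H1_H\<^esub>"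
  "add (H1_inv K L H M act) = add H1_H"
  "smult (H1_inv K L H M act) = smult H1_H"
  by (simp_all add: H1_inv_def)

text \<open>The witness is \<open>D\<close> itself: by the derivation law for [x, z], x acts on the
  restriction of \<open>D\<close> as the inner derivation of D x.\<close>

lemma res_ders:
  assumes D: "D \<in> ders_L"
  shows "restrict D H \<in> inv_ders"
proof -
  note D' = dersD[OF D]
  have "(\<lambda>x\<in>carrier (subalg L H). D x) \<in> ders_H"
    by (rule H.restrict_dersI[OF module_homs_subalg[OF D'(1)]]) (auto simp: H_carrier D'(5))
  then have r: "restrict D H \<in> ders_H" by simp
  have "der_act L H M act x (restrict D H) z = act z (D x)" if x: "x \<in> carrier L" and z: "z \<in> H"
    for x z
  proof -
    have "act x (D z) \<ominus>\<^bsub>M\<^esub> (act x (D z) \<ominus>\<^bsub>M\<^esub> act z (D x)) = act z (D x)"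
      using act_closed[OF x D'(4)[OF H_carrier[OF z]]] act_closed[OF H_carrier[OF z] D'(4)[OF x]]
        by algebra
    then show ?thesis using x z by (simp add: der_act_apply H_ideal D'(5) H_carrier)
  qed
  then show ?thesis using r D'(4) by (auto simp: inv_ders_def)
qed

lemma restrict_hom: "(\<lambda>d. restrict d H) \<in> module_homs K (der_space K L M act) (der_space K (subalg L
  H) M act)"
  by (rule module_homsI)
    (use res_ders in \<open>auto simp: H_carrier inv_ders_def intro!: restrict_ext\<close>)

lemma restrict_inner: "(\<lambda>d. restrict d H) ` inner_ders L M act \<subseteq> inner_ders (subalg L H) M act"
proof
  fix D assume "D \<in> (\<lambda>d. restrict d H) ` inner_ders L M act"
  then obtain m where m: "m \<in> carrier M" "D = restrict (\<lambda>x\<in>carrier L. act x m) H"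
    unfolding inner_ders_eq by auto
  have "D = (\<lambda>x\<in>carrier (subalg L H). act x m)"
    unfolding m(2) by (auto simp: restrict_def H_carrier)
  then show "D \<in> inner_ders (subalg L H) M act" using m(1) unfolding H.inner_ders_eq by blast
qed

lemma res1_class: "D \<in> ders_L \<Longrightarrow> res1 K L H M act (class_L D) = class_H (restrict D H)"
  unfolding res1_def
  using linear_space.induced_rcos[OF der_space_linear inner_ders_submodule restrict_hom
     H.der_space_linear[unfolded linear_space_iff] H.inner_ders_submodule restrict_inner] by simp

lemma res1_hom: "res1 K L H M act \<in> module_homs K (H1 K L M act) (H1_inv K L H M act)"
proof -
  have "res1 K L H M act \<in> module_homs K (H1 K L M act) H1_H"
    unfolding res1_def H1_def
    by (rule linear_space.induced_hom[OF der_space_linear inner_ders_submodule restrict_hom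
     H.der_space_linear[unfolded linear_space_iff] H.inner_ders_submodule restrict_inner])
  then show ?thesis
    by (auto simp: module_homs_def H1_inv_carrier H1_carrier res1_class res_ders Pi_def)
qed

text \<open>If \<open>D\<close> restricts on \<open>H\<close> to the inner derivation of m, then D -
  \<delta>(m), with \<delta>(m) taken on all of \<open>L\<close>, is cohomologous to
  \<open>D\<close> and vanishes on \<open>H\<close>, so it descends. Conversely, an inflated
  derivation takes the value d(H) = 0 on \<open>H\<close>.\<close>

lemma exact_H1: "exact_at K H1_Q (inf1 K L H M act) (H1 K L M act) (res1 K L H M act) (H1_inv K L H
  M act)"
  unfolding exact_at_def
proof (intro conjI inf1_hom res1_hom equalityI subsetI)
  fix C assume "C \<in> inf1 K L H M act ` carrier H1_Q"
  then obtain d where d: "d \<in> ders_Q" "C = class_L (infl1 d)"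
    by (auto simp: Q.H1_carrier inf1_class)
  have "restrict (infl1 d) H = (\<lambda>x\<in>carrier (subalg L H). \<zero>\<^bsub>M\<^esub>)"
    using module_homs_zero[OF Q.dersD(1)[OF d(1)] Q.L_module Q.M_module]
    by (simp, intro restrict_ext) (simp add: infl1_def H_carrier coset_H)
  then show "C \<in> a_kernel (H1 K L M act) (H1_inv K L H M act) (res1 K L H M act)"
    using d infl1_ders[OF d(1)] by (auto simp: a_kernel_def' H1_carrier res1_class H.H1_zero)
next
  fix C assume "C \<in> a_kernel (H1 K L M act) (H1_inv K L H M act) (res1 K L H M act)"
  then obtain D where D: "D \<in> ders_L" "C = class_L D" "class_H (restrict D H) = \<zero>\<^bsub>H1_H\<^esub>"
    by (auto simp: a_kernel_def' H1_carrier res1_class)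
  then obtain m where m: "m \<in> carrier M" "\<And>z. z \<in> H \<Longrightarrow> D z = act z m"
    using H.H1_class_zero_iff[OF inv_dersD(1)[OF res_ders[OF D(1)]]] by auto
  note S = shift_inner_ders[OF D(1) m(1)]
  have "D z \<ominus>\<^bsub>M\<^esub> act z m = \<zero>\<^bsub>M\<^esub>" if "z \<in> H" for z
    using that m by (simp add: M.M.minus_eq_zero_iff act_closed H_carrier)
  then obtain d where d: "d \<in> ders_Q" "\<And>x. x \<in> carrier L \<Longrightarrow> d (\<pi> x) = D x \<ominus>\<^bsub>M\<^esub> act x m"
    using descend_der[OF S(1)] by (auto simp: H_carrier)
  have "infl1 d = (\<lambda>x\<in>carrier L. D x \<ominus>\<^bsub>M\<^esub> act x m)"
    unfolding infl1_def by (rule restrict_ext) (rule d(2))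
  then have "C = inf1 K L H M act (class_Q d)"
    using S(2) by (simp add: inf1_class d(1) D(2))
  then show "C \<in> inf1 K L H M act ` carrier H1_Q" using d(1) by (auto simp: Q.H1_carrier)
qed

section \<open>Transgression\<close>

text \<open>In the cocycle identity for x, y and z in \<open>H\<close>, every term but z \<cdot>
  f(x, y) has an argument in \<open>H\<close> and vanishes; so the values are invariant. By
  linearity f is constant on cosets in each argument.\<close>

lemma descend_cocycle:
  assumes f: "f \<in> cocycles_L" and 0: "\<And>x z. \<lbrakk>x \<in> carrier L; z \<in> H\<rbrakk> \<Longrightarrow> f (x, z) = \<zero>\<^bsub>M\<^esub>"
  obtains g where "g \<in> cocycles_Q" "\<And>x y. \<lbrakk>x \<in> carrier L; y \<in> carrier L\<rbrakk> \<Longrightarrow> g (\<pi> x, \<pi> y) = f (x, y)"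
proof -
  note F = cocyclesD[OF f]
  have left0: "f (z, x) = \<zero>\<^bsub>M\<^esub>" if "x \<in> carrier L" "z \<in> H" for x z
    using cocycle_antisym[OF f that(1) H_carrier[OF that(2)]] 0[OF that]
      by (simp add: M.M.minus_zero_eq)
  have MH: "f (x, y) \<in> MH" if x: "x \<in> carrier L" and y: "y \<in> carrier L" for x y
  proof -
    have "act z (f (x, y)) = \<zero>\<^bsub>M\<^esub>" if z: "z \<in> H" for z
      using F(5)[OF x y H_carrier[OF z]] x y z F(6)[OF x y]
      by (simp add: 0 left0 act_zero H_ideal H_ideal_r bracket_closed H_carrier act_closed)
    then show ?thesis using F(6)[OF x y] by (simp add: MH_iff)
  qed
  have c1: "f (x, y) = f (x', y)" if "x \<in> carrier L" "x' \<in> carrier L" "y \<in> carrier L" "\<pi> x =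
    \<pi> x'" for x x' y
    by (rule hom_coset_const[OF F(3)[OF that(3)] M_module _ that(1,2,4)]) (rule left0[OF that(3)])
  have c2: "f (x, y) = f (x, y')" if "x \<in> carrier L" "y \<in> carrier L" "y' \<in> carrier L" "\<pi> y =
    \<pi> y'" for x y y'
    by (rule hom_coset_const[OF F(2)[OF that(1)] M_module _ that(2,3,4)]) (rule 0[OF that(1)])
  \<comment> \<open>A choice of representatives, made invisible by \<open>c1\<close> and
    \<open>c2\<close>.\<close>
  define r where "r X = (SOME x. x \<in> carrier L \<and> \<pi> x = X)" for X
  have r: "r (\<pi> x) \<in> carrier L" "\<pi> (r (\<pi> x)) = \<pi> x" if "x \<in> carrier L" for x
    using someI[of "\<lambda>y. y \<in> carrier L \<and> \<pi> y = \<pi> x" x] that by (auto simp: r_def)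
  define g0 where "g0 = (\<lambda>(X, Y). f (r X, r Y))"
  have g0: "g0 (\<pi> x, \<pi> y) = f (x, y)" if "x \<in> carrier L" "y \<in> carrier L" for x y
    using c1[of "r (\<pi> x)" x "r (\<pi> y)"] c2[of x "r (\<pi> y)" y] r that by (simp add: g0_def)
  have hom: "f' \<in> module_homs K L (inv_module L H M act)"
    if "f' \<in> module_homs K L M" "\<And>x. x \<in> carrier L \<Longrightarrow> f' x \<in> MH" for f'
    using that by (auto simp: inv_module_def module_homs_into_subalg M.submodule_carrier[OF
      MH_submodule] subset_eq)
  have "restrict g0 (carrier (quot_alg L H) \<times> carrier (quot_alg L H)) \<in> cocycles_Q"
  proof (rule Q.cocyclesI)
    fix X assume "X \<in> carrier (quot_alg L H)"
    then obtain x where x: "x \<in> carrier L" "X = \<pi> x" by (rule cosetE)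
    show "(\<lambda>Y. g0 (Y, X)) \<in> module_homs K (quot_alg L H) (inv_module L H M act)"
      by (rule L.quot_homI[OF H_submodule hom[OF F(3)[OF x(1)]]]) (use x g0 MH in auto)
    show "(\<lambda>Y. g0 (X, Y)) \<in> module_homs K (quot_alg L H) (inv_module L H M act)"
      by (rule L.quot_homI[OF H_submodule hom[OF F(2)[OF x(1)]]]) (use x g0 MH in auto)
    show "g0 (X, X) = \<zero>\<^bsub>inv_module L H M act\<^esub>" using x by (simp add: g0 F(4))
    fix Y Z assume "Y \<in> carrier (quot_alg L H)" "Z \<in> carrier (quot_alg L H)"
    then obtain y z where yz: "y \<in> carrier L" "Y = \<pi> y" "z \<in> carrier L" "Z = \<pi> z"
      by (auto elim!: cosetE)
    show "inv_act act X (g0 (Y, Z)) \<oplus>\<^bsub>inv_module L H M act\<^esub> inv_act act Y (g0 (Z, X)) \<oplus>\<^bsub>inv_module L H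
      M act\<^esub> inv_act act Z (g0 (X, Y)) =
       g0 (X \<otimes>\<^bsub>quot_alg L H\<^esub> Y, Z) \<oplus>\<^bsub>inv_module L H M act\<^esub> g0 (Y \<otimes>\<^bsub>quot_alg L H\<^esub> Z, X) \<oplus>\<^bsub>inv_module L H M
         act\<^esub>
       g0 (Z \<otimes>\<^bsub>quot_alg L H\<^esub> X, Y)"
      unfolding x(2) yz(2,4) using F(5)[OF x(1) yz(1,3)] x(1) yz(1,3)
      by (simp add: coset_bracket g0 inv_act_coset MH bracket_closed del: quot_alg_simps)
  qed
  then show ?thesis using that g0 by (auto simp del: quot_alg_simps simp: coset_closed)
qed

text \<open>A relation and not a function: t can be altered by any linear map into \<open>MH\<close>
  that vanishes on \<open>H\<close>, which changes f by a coboundary.\<close>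

definition tr_datum :: "('a \<Rightarrow> 'm) \<Rightarrow> ('a \<Rightarrow> 'm) \<Rightarrow> ('a set \<times> 'a set \<Rightarrow> 'm) \<Rightarrow> bool" where
  "tr_datum d t f \<longleftrightarrow> t \<in> module_homs K L M \<and> (\<forall>z\<in>H. t z = d z) \<and>
     (\<forall>x\<in>carrier L. \<forall>z\<in>H. der_act L H M act x d z = act z (t x)) \<and> f \<in> cocycles_Q \<and>
     (\<forall>x\<in>carrier L. \<forall>y\<in>carrier L. f (\<pi> x, \<pi> y) = act x (t y) \<ominus>\<^bsub>M\<^esub> act y (t x) \<ominus>\<^bsub>M\<^esub> t (x \<otimes>\<^bsub>L\<^esub> y))"

text \<open>The map \<delta> : M \<rightarrow> Inn(H, M) is linear and onto, hence has a linear
  section, and t is this section after \<phi>. A separate choice of m for each x would not be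
  linear; linearity also yields t = 0 wherever \<phi> = 0.\<close>

lemma linear_choice:
  assumes \<phi>: "\<phi> \<in> module_homs K L (fun_space H M)"
    and inner: "\<And>x. x \<in> carrier L \<Longrightarrow> \<exists>m\<in>carrier M. \<forall>z\<in>H. \<phi> x z = act z m"
    and 0: "\<And>z. z \<in> H \<Longrightarrow> \<phi> z = (\<lambda>z\<in>H. \<zero>\<^bsub>M\<^esub>)"
  obtains t where "t \<in> module_homs K L M" "\<And>z. z \<in> H \<Longrightarrow> t z = \<zero>\<^bsub>M\<^esub>"
    "\<And>x z. \<lbrakk>x \<in> carrier L; z \<in> H\<rbrakk> \<Longrightarrow> \<phi> x z = act z (t x)"
proof -
  let ?I = "inner_ders (subalg L H) M act"
  have I: "submodule ?I K (fun_space H M)" using H.inner_ders_submodule_fun by simp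
  have modI: "module K (subalg (fun_space H M) ?I)" by (rule module_subalg[OF I fun_space_module])
  have Isub: "?I \<subseteq> carrier (fun_space H M)" by (rule module.submoduleE(1)[OF fun_space_module I])
  have hom: "inner_der (subalg L H) act \<in> module_homs K M (subalg (fun_space H M) ?I)"
    unfolding module_homs_into_subalg[OF Isub] using H.inner_der_hom by (simp add: inner_ders_def)
  obtain s where s: "s \<in> module_homs K (subalg (fun_space H M) ?I) M"
    "\<And>d. d \<in> ?I \<Longrightarrow> inner_der (subalg L H) act (s d) = d"
    using module_homs_section[OF K.field_axioms M_module modI hom] by (auto simp: inner_ders_def)
  have \<phi>I: "\<phi> x \<in> ?I" if x: "x \<in> carrier L" for x
  proof -
    obtain m where m: "m \<in> carrier M" "\<And>z. z \<in> H \<Longrightarrow> \<phi> x z = act z m" using inner[OF x] by blast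
    have "\<phi> x = (\<lambda>z\<in>carrier (subalg L H). act z m)"
      using module_homs_closed[OF \<phi> x] m(2) by (auto simp: fun_eq_iff PiE_iff extensional_def)
    then show ?thesis using m(1) unfolding H.inner_ders_eq by blast
  qed
  have \<phi>': "\<phi> \<in> module_homs K L (subalg (fun_space H M) ?I)"
    using \<phi> \<phi>I by (auto simp: module_homs_into_subalg[OF Isub])
  show ?thesis
  proof (rule that[OF module_homs_comp[OF \<phi>' s(1)]])
    show "s (\<phi> z) = \<zero>\<^bsub>M\<^esub>" if "z \<in> H" for z
      using module_homs_zero[OF s(1) modI M_module] by (simp add: 0[OF that])
    show "\<phi> x z = act z (s (\<phi> x))" if x: "x \<in> carrier L" and z: "z \<in> H" for x z
    proof -
      have "\<phi> x z = inner_der (subalg L H) act (s (\<phi> x)) z" using s(2)[OF \<phi>I[OF x]] by simp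
      then show ?thesis using z by (simp add: inner_der_def)
    qed
  qed
qed

lemma extend_from_H:
  assumes "d \<in> module_homs K (subalg L H) M"
  obtains b where "b \<in> module_homs K L M" "\<And>z. z \<in> H \<Longrightarrow> b z = d z"
  using module_homs_extend[OF K.field_axioms L_module M_module H_submodule assms] by blast

lemma tr_datum_exists:
  assumes d: "d \<in> inv_ders"
  obtains t f where "tr_datum d t f"
proof -
  note dH = inv_dersD(1)[OF d]
  note D = ders_HD[OF dH]
  obtain b where b: "b \<in> module_homs K L M" "\<And>z. z \<in> H \<Longrightarrow> b z = d z"
    using extend_from_H[OF D(1)] by blast
  note B = module_homs_closed[OF b(1)]
  \<comment> \<open>The part of x \<cdot> d not yet accounted for by the extension b. It is inner
    because x \<cdot> d and \<delta>(b x) are, and zero for x in \<open>H\<close> since b agrees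
    with d there.\<close>
  define \<phi> where "\<phi> x = (\<lambda>z\<in>H. der_act L H M act x d z \<ominus>\<^bsub>M\<^esub> act z (b x))" for x
  have dc: "der_act L H M act x d z \<in> carrier M" if "x \<in> carrier L" "z \<in> H" for x z
    using ders_HD(3)[OF der_act_ders[OF that(1) dH] that(2)] .
  have \<phi>: "\<phi> \<in> module_homs K L (fun_space H M)"
  proof (rule module_homsI)
    fix x assume x: "x \<in> carrier L"
    show "\<phi> x \<in> carrier (fun_space H M)" using x dc B by (auto simp: \<phi>_def act_closed H_carrier)
    show "\<phi> (a \<odot>\<^bsub>L\<^esub> x) = a \<odot>\<^bsub>fun_space H M\<^esub> \<phi> x" if a: "a \<in> carrier K" for a
      using module_homs_smult[OF der_act_hom_l[OF dH] a x] a x dc B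
      by (auto simp: \<phi>_def module_homs_smult[OF b(1)] act_smult_r act_closed H_carrier
        M.smult_r_distr M.smult_r_minus a_minus_def
        intro!: restrict_ext)
    fix y assume y: "y \<in> carrier L"
    show "\<phi> (x \<oplus>\<^bsub>L\<^esub> y) = \<phi> x \<oplus>\<^bsub>fun_space H M\<^esub> \<phi> y"
      unfolding \<phi>_def fun_space_simps
    proof (rule restrict_ext)
      fix z assume z: "z \<in> H"
      have "der_act L H M act x d z \<oplus>\<^bsub>M\<^esub> der_act L H M act y d z \<ominus>\<^bsub>M\<^esub> act z (b x \<oplus>\<^bsub>M\<^esub> b y) =
        der_act L H M act x d z \<ominus>\<^bsub>M\<^esub> act z (b x) \<oplus>\<^bsub>M\<^esub> (der_act L H M act y d z \<ominus>\<^bsub>M\<^esub> act z (b y))"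
        using dc[OF x z] dc[OF y z] H_carrier[OF z] B[OF x] B[OF y] by algebra
      then show "der_act L H M act (x \<oplus>\<^bsub>L\<^esub> y) d z \<ominus>\<^bsub>M\<^esub> act z (b (x \<oplus>\<^bsub>L\<^esub> y)) =
        (\<lambda>z\<in>H. der_act L H M act x d z \<ominus>\<^bsub>M\<^esub> act z (b x)) z \<oplus>\<^bsub>M\<^esub> (\<lambda>z\<in>H. der_act L H M act y d z \<ominus>\<^bsub>M\<^esub> act z
          (b y)) z"
        using module_homs_add[OF der_act_hom_l[OF dH] x y] x y z
          by (simp add: module_homs_add[OF b(1)])
    qed
  qed
  have inner: "\<exists>m\<in>carrier M. \<forall>z\<in>H. \<phi> x z = act z m" if x: "x \<in> carrier L" for x
  proof -
    obtain m where m: "m \<in> carrier M" "\<And>z. z \<in> H \<Longrightarrow> der_act L H M act x d z = act z m"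
      using inv_dersD(2)[OF d x] by blast
    show ?thesis using m B[OF x] by (intro bexI[of _ "m \<ominus>\<^bsub>M\<^esub> b x"]) (auto simp: \<phi>_def act_minus
      H_carrier)
  qed
  have 0: "\<phi> z = (\<lambda>z\<in>H. \<zero>\<^bsub>M\<^esub>)" if z: "z \<in> H" for z
    unfolding \<phi>_def
    by (rule restrict_ext) (use z D in \<open>simp add: der_act_inner[OF dH] b(2) M.M.minus_eq_zero_iff
      act_closed H_carrier\<close>)
  obtain t0 where t0: "t0 \<in> module_homs K L M" "\<And>z. z \<in> H \<Longrightarrow> t0 z = \<zero>\<^bsub>M\<^esub>"
    "\<And>x z. \<lbrakk>x \<in> carrier L; z \<in> H\<rbrakk> \<Longrightarrow> \<phi> x z = act z (t0 x)"
    using linear_choice[OF \<phi> inner 0] by blast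
  note T0 = module_homs_closed[OF t0(1)]
  define t where "t x = b x \<oplus>\<^bsub>M\<^esub> t0 x" for x
  have t: "t \<in> module_homs K L M" unfolding t_def by (rule module_homs_sum[OF b(1) t0(1) M_module])
  note T = module_homs_closed[OF t]
  have tH: "t z = d z" if "z \<in> H" for z using that D(3) by (simp add: t_def b(2) t0(2))
  have td: "der_act L H M act x d z = act z (t x)" if x: "x \<in> carrier L" and z: "z \<in> H" for x z
  proof -
    have "der_act L H M act x d z \<ominus>\<^bsub>M\<^esub> act z (b x) = act z (t0 x)" using t0(3)[OF x z] z
      by (simp add: \<phi>_def)
    then have "act z (t x) = act z (b x) \<oplus>\<^bsub>M\<^esub> (der_act L H M act x d z \<ominus>\<^bsub>M\<^esub> act z (b x))"
      using x z B T0 by (simp add: t_def act_r_distr H_carrier)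
    also have "\<dots> = der_act L H M act x d z" using dc[OF x z] act_closed[OF H_carrier[OF z] B[OF x]]
      by algebra
    finally show ?thesis by simp
  qed
  \<comment> \<open>Regrouped, the coboundary at (x, z) is (x \<cdot> d)(z) - z \<cdot> t x, since t
    z and t [x, z] are values of d.\<close>
  have van: "coboundary2 L M act t (x, z) = \<zero>\<^bsub>M\<^esub>" if x: "x \<in> carrier L" and z: "z \<in> H" for x z
  proof -
    have "act x (d z) \<ominus>\<^bsub>M\<^esub> d (x \<otimes>\<^bsub>L\<^esub> z) = act z (t x)" using td[OF x z] z by (simp add: der_act_apply)
    moreover have "act x (d z) \<ominus>\<^bsub>M\<^esub> act z (t x) \<ominus>\<^bsub>M\<^esub> d (x \<otimes>\<^bsub>L\<^esub> z) =
      (act x (d z) \<ominus>\<^bsub>M\<^esub> d (x \<otimes>\<^bsub>L\<^esub> z)) \<ominus>\<^bsub>M\<^esub> act z (t x)"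
      using act_closed[OF x D(3)[OF z]] act_closed[OF H_carrier[OF z] T[OF x]] D(3)[OF H_ideal[OF x
        z]] by algebra
    ultimately show ?thesis
      using x z T by (simp add: coboundary2_apply H_carrier tH H_ideal M.M.minus_eq_zero_iff
        act_closed)
  qed
  obtain f where f: "f \<in> cocycles_Q" "\<And>x y. \<lbrakk>x \<in> carrier L; y \<in> carrier L\<rbrakk> \<Longrightarrow> f (\<pi> x, \<pi> y) =
    coboundary2 L M act t (x, y)"
    using descend_cocycle[OF coboundary2_cocycle[OF t] van] by blast
  show ?thesis
    by (rule that[of t f]) (use t tH td f in \<open>simp add: tr_datum_def coboundary2_apply\<close>)
qed

end

section \<open>The extension formed from the idealizer and its class\<close>

lemma (in abelian_group) idealizer_sum:
  assumes "xn \<in> carrier G" "ym \<in> carrier G" "txy \<in> carrier G" "xty \<in> carrier G" "ytx \<in> carrier G"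
  shows "(xn \<ominus> xty) \<ominus> (ym \<ominus> ytx) \<oplus> (xty \<ominus> ytx \<ominus> txy) = xn \<ominus> ym \<ominus> txy"
  using assms by algebra

lemma (in abelian_group) diff_add_cancel: "\<lbrakk>x \<in> carrier G; y \<in> carrier G\<rbrakk> \<Longrightarrow> x \<ominus> y \<oplus> y = x"
  by algebra

lemma (in abelian_group) diff_diff_cancel: "\<lbrakk>x \<in> carrier G; y \<in> carrier G\<rbrakk> \<Longrightarrow> x \<ominus> (x \<ominus> y) = y"
  by algebra

text \<open>Moving s [x, y] to the other side and f under i gives an equation free of inverses,
  which can be checked on cosets in a quotient.\<close>

lemma (in lie_ext) section_cocycle_eqI:
  assumes s: "s \<in> linear_sections K L E p" and f: "f \<in> carrier L \<times> carrier L \<rightarrow>\<^sub>E carrier M"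
    and eq: "\<And>x y. \<lbrakk>x \<in> carrier L; y \<in> carrier L\<rbrakk> \<Longrightarrow> s x \<otimes>\<^bsub>E\<^esub> s y = i (f (x, y)) \<oplus>\<^bsub>E\<^esub> s (x \<otimes>\<^bsub>L\<^esub> y)"
  shows "section_cocycle L M E i s = f"
proof (rule PiE_ext[OF cocyclesD(1)[OF section_cocycle_cocycle[OF s]] f])
  fix u assume "u \<in> carrier L \<times> carrier L"
  then obtain x y where u: "u = (x, y)" and xy: "x \<in> carrier L" "y \<in> carrier L" by auto
  note S = linear_sectionsD(3)[OF s]
  have fM: "f (x, y) \<in> carrier M" using f xy by auto
  have "s x \<otimes>\<^bsub>E\<^esub> s y \<ominus>\<^bsub>E\<^esub> s (x \<otimes>\<^bsub>L\<^esub> y) = i (f (x, y))"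
    using eq[OF xy] i_closed[OF fM] S xy by (metis E.L.M.eq_minus_iff bracket_closed
      E.bracket_closed)
  then show "section_cocycle L M E i s u = f u"
    unfolding u using section_cocycle_apply[OF s xy] fM by (intro i_eqD) simp_all
qed

context lie_rep
begin

lemma semidirect_minus:
  assumes "m \<in> carrier M" "n \<in> carrier M" "x \<in> carrier L" "y \<in> carrier L"
  shows "(m, x) \<ominus>\<^bsub>semidirect L M act\<^esub> (n, y) = (m \<ominus>\<^bsub>M\<^esub> n, x \<ominus>\<^bsub>L\<^esub> y)"
proof -
  interpret S: lie_alg K "semidirect L M act" by (rule semidirect_lie_alg)
  have "m \<ominus>\<^bsub>M\<^esub> n \<oplus>\<^bsub>M\<^esub> n = m" using assms(1,2) by algebra
  moreover have "x \<ominus>\<^bsub>L\<^esub> y \<oplus>\<^bsub>L\<^esub> y = x" using assms(3,4) by algebra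
  ultimately have "(m \<ominus>\<^bsub>M\<^esub> n, x \<ominus>\<^bsub>L\<^esub> y) = (m, x) \<ominus>\<^bsub>semidirect L M act\<^esub> (n, y)"
    using assms by (subst S.L.M.eq_minus_iff) auto
  then show ?thesis by simp
qed

end

context ideal_rep
begin

lemma tr_datumD:
  assumes "tr_datum d t f"
  shows "t \<in> module_homs K L M" "\<And>z. z \<in> H \<Longrightarrow> t z = d z"
    "\<And>x z. \<lbrakk>x \<in> carrier L; z \<in> H\<rbrakk> \<Longrightarrow> der_act L H M act x d z = act z (t x)" "f \<in> cocycles_Q"
    "\<And>x y. \<lbrakk>x \<in> carrier L; y \<in> carrier L\<rbrakk> \<Longrightarrow> f (\<pi> x, \<pi> y) = act x (t y) \<ominus>\<^bsub>M\<^esub> act y (t x) \<ominus>\<^bsub>M\<^esub> t (x \<otimes>\<^bsub>L\<^esub> y)"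
    "\<And>x. x \<in> carrier L \<Longrightarrow> t x \<in> carrier M"
    "\<And>x y. \<lbrakk>x \<in> carrier L; y \<in> carrier L\<rbrakk> \<Longrightarrow> f (\<pi> x, \<pi> y) \<in> MH"
proof -
  show "f (\<pi> x, \<pi> y) \<in> MH" if "x \<in> carrier L" "y \<in> carrier L" for x y
    using assms Q.cocyclesD(6)[of f "\<pi> x" "\<pi> y"] that by (simp add: tr_datum_def)
qed (use assms in \<open>auto simp: tr_datum_def module_homs_closed\<close>)

text \<open>The second component [x, z] already lies in \<open>H\<close>, so membership in the graph
  is the single equation x \<cdot> d z - z \<cdot> m = d [x, z].\<close>

lemma graph_bracket_iff:
  assumes d: "d \<in> ders_H" and m: "m \<in> carrier M" and x: "x \<in> carrier L" and z: "z \<in> H"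
  shows "(m, x) \<otimes>\<^bsub>semidirect L M act\<^esub> graph_map d z \<in> graph_map d ` H \<longleftrightarrow> der_act L H M act x d z =
    act z m"
proof -
  note D = ders_HD[OF d] and h = H_ideal[OF x z]
  have c: "act x (d z) \<in> carrier M" "act z m \<in> carrier M" "d (x \<otimes>\<^bsub>L\<^esub> z) \<in> carrier M"
    using x z m D(3) h by (auto simp: act_closed H_carrier)
  have "(m, x) \<otimes>\<^bsub>semidirect L M act\<^esub> graph_map d z \<in> graph_map d ` H \<longleftrightarrow>
      act x (d z) \<ominus>\<^bsub>M\<^esub> act z m = d (x \<otimes>\<^bsub>L\<^esub> z)"
    using h by (auto simp: graph_map_def image_iff)
  also have "\<dots> \<longleftrightarrow> act x (d z) \<ominus>\<^bsub>M\<^esub> d (x \<otimes>\<^bsub>L\<^esub> z) = act z m"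
    using c M.M.eq_minus_iff[of "d (x \<otimes>\<^bsub>L\<^esub> z)" "act x (d z)" "act z m"]
      M.M.eq_minus_iff[of "act z m" "act x (d z)" "d (x \<otimes>\<^bsub>L\<^esub> z)"] M.M.a_comm by metis
  finally show ?thesis using z by (simp add: der_act_apply)
qed

text \<open>Membership means \<delta>(m) = x \<cdot> d = \<delta>(t x) on \<open>H\<close>, that is,
  m - t x is invariant. The idealizer thus is the preimage of \<open>MH\<close> under the linear map
  (m, x) \<mapsto> m - t x.\<close>

lemma tr_idealizer_iff:
  assumes d: "d \<in> ders_H" and datum: "tr_datum d t f"
  shows "(m, x) \<in> tr_idealizer L H M act d \<longleftrightarrow> m \<in> carrier M \<and> x \<in> carrier L \<and> m \<ominus>\<^bsub>M\<^esub> t x \<in> MH"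
proof (cases "m \<in> carrier M \<and> x \<in> carrier L")
  case True
  then have m: "m \<in> carrier M" and x: "x \<in> carrier L" by auto
  note T = tr_datumD[OF datum]
  have "act z (t x) = act z m \<longleftrightarrow> act z (m \<ominus>\<^bsub>M\<^esub> t x) = \<zero>\<^bsub>M\<^esub>" if z: "z \<in> H" for z
    using T(6)[OF x] z m by (auto simp: act_minus H_carrier M.M.minus_eq_zero_iff act_closed)
  then have "(\<forall>z\<in>H. act z (t x) = act z m) \<longleftrightarrow> m \<ominus>\<^bsub>M\<^esub> t x \<in> MH"
    using m T(6)[OF x] by (simp add: MH_iff)
  then show ?thesis
    using m x by (simp add: tr_idealizer_def graph_bracket_iff[OF d] T(3))
qed (auto simp: tr_idealizer_def)

text \<open>Most of the proof checks that the idealizer modulo the graph is an extension of the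
  quotient by \<open>MH\<close> with the right action. The map x \<mapsto> (t x, x) then descends
  because it sends \<open>H\<close> into the graph, and the defect of its bracket at x, y is
  (f(\<pi> x, \<pi> y), 0).\<close>

lemma tr_der_eq:
  assumes d: "d \<in> ders_H" and datum: "tr_datum d t f"
  shows "tr_der K L H M act d = class2_Q f"
proof -
  note D = ders_HD[OF d] and T = tr_datumD[OF datum]
  define S where "S = semidirect L M act"
  define G where "G = graph_map d ` H"
  define I where "I = tr_idealizer L H M act d"
  interpret S: lie_alg K S unfolding S_def by (rule semidirect_lie_alg)
  have [simp]: "carrier S = carrier M \<times> carrier L"
    "\<zero>\<^bsub>S\<^esub> = (\<zero>\<^bsub>M\<^esub>, \<zero>\<^bsub>L\<^esub>)" by (simp_all add: S_def)
  have ops [simp]: "(m, x) \<otimes>\<^bsub>S\<^esub> (n, y) = (act x n \<ominus>\<^bsub>M\<^esub> act y m, x \<otimes>\<^bsub>L\<^esub> y)"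
    "(m, x) \<oplus>\<^bsub>S\<^esub> (n, y) = (m \<oplus>\<^bsub>M\<^esub> n, x \<oplus>\<^bsub>L\<^esub> y)" "a \<odot>\<^bsub>S\<^esub> (m, x) = (a \<odot>\<^bsub>M\<^esub> m, a \<odot>\<^bsub>L\<^esub> x)" for m x n y a
    by (simp_all add: S_def)
  have Sminus: "(m, x) \<ominus>\<^bsub>S\<^esub> (n, y) = (m \<ominus>\<^bsub>M\<^esub> n, x \<ominus>\<^bsub>L\<^esub> y)"
    if "m \<in> carrier M" "n \<in> carrier M" "x \<in> carrier L" "y \<in> carrier L" for m x n y
    unfolding S_def using that by (rule semidirect_minus)
  have I_iff: "(m, x) \<in> I \<longleftrightarrow> m \<in> carrier M \<and> x \<in> carrier L \<and> m \<ominus>\<^bsub>M\<^esub> t x \<in> MH" for m x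
    unfolding I_def by (rule tr_idealizer_iff[OF d datum])
  have G_iff: "(m, x) \<in> G \<longleftrightarrow> x \<in> H \<and> m = d x" for m x
    by (auto simp: G_def graph_map_def)
  have dT: "d z = t z" if "z \<in> H" for z using T(2)[OF that] by simp
  note MHs = M.submodule_carrier[OF MH_submodule] M.submoduleE(3-5)[OF MH_submodule]
    M.submodule_minus_closed[OF MH_submodule] M.submodule_zero[OF MH_submodule]
  have T0: "t \<zero>\<^bsub>L\<^esub> = \<zero>\<^bsub>M\<^esub>" by (rule module_homs_zero[OF T(1) L_module M_module])
  have Gsub: "submodule G K S"
  proof -
    have "graph_map d \<in> module_homs K (subalg L H) S"
      using D by (auto simp: graph_map_def H_carrier intro!: module_homsI)
    from submodule_image[OF this H.L_module S.L_module H.L.carrier_is_submodule]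
    show ?thesis by (simp add: G_def)
  qed
  have GI: "G \<subseteq> I"
    by (auto simp: I_iff G_iff dT T(6) H_carrier MHs(6) M.M.r_neg a_minus_def)
  have Isub: "submodule I K S"
  proof -
    \<comment> \<open>The preimage of \<open>MH\<close> under this map is \<open>I\<close>, which is
      therefore a subspace.\<close>
    have h: "(\<lambda>u. fst u \<ominus>\<^bsub>M\<^esub> t (snd u)) \<in> module_homs K S M"
    proof (rule module_homs_diff[OF _ module_homs_comp[OF _ T(1)] M_module])
      show "fst \<in> module_homs K S M" by (rule module_homsI) auto
      show "snd \<in> module_homs K S L" by (rule module_homsI) auto
    qed
    show ?thesis
    proof (rule S.L.submoduleI)
      show "I \<subseteq> carrier S" by (auto simp: I_iff)
      show "\<zero>\<^bsub>S\<^esub> \<in> I" by (simp add: I_iff T0 MHs a_minus_def M.M.minus_zero_eq)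
      have I_iff': "u \<in> I \<longleftrightarrow> u \<in> carrier S \<and> fst u \<ominus>\<^bsub>M\<^esub> t (snd u) \<in> MH" for u
        by (cases u) (simp add: I_iff)
      show "\<ominus>\<^bsub>S\<^esub> u \<in> I" if "u \<in> I" for u
        using that module_homs_neg[OF h S.L_module M_module] MHs(2) S.L.M.a_inv_closed
        unfolding I_iff' by metis
      show "u \<oplus>\<^bsub>S\<^esub> v \<in> I" if "u \<in> I" "v \<in> I" for u v
        using that module_homs_add[OF h] MHs(4) S.L.M.a_closed unfolding I_iff' by metis
      show "a \<odot>\<^bsub>S\<^esub> u \<in> I" if "a \<in> carrier K" "u \<in> I" for a u
        using that module_homs_smult[OF h] MHs(3) S.L.smult_closed unfolding I_iff' by metis
    qed
  qed
  have Ibr: "u \<otimes>\<^bsub>S\<^esub> v \<in> I" if uv: "u \<in> I" "v \<in> I" for u v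
  proof -
    obtain m x n y where uv': "u = (m, x)" "v = (n, y)" by (cases u, cases v)
    have c: "m \<in> carrier M" "x \<in> carrier L" "m \<ominus>\<^bsub>M\<^esub> t x \<in> MH" "n \<in> carrier M" "y \<in> carrier L" "n \<ominus>\<^bsub>M\<^esub> t
      y \<in> MH"
      using uv unfolding uv' I_iff by auto
    \<comment> \<open>Write m and n as t x and t y plus invariant parts: the invariant parts
      contribute invariants by \<open>act_MH\<close>, and the others the coboundary of t, which is a
      value of f.\<close>
    have "act x n \<ominus>\<^bsub>M\<^esub> act y m \<ominus>\<^bsub>M\<^esub> t (x \<otimes>\<^bsub>L\<^esub> y)
      = act x (n \<ominus>\<^bsub>M\<^esub> t y) \<ominus>\<^bsub>M\<^esub> act y (m \<ominus>\<^bsub>M\<^esub> t x) \<oplus>\<^bsub>M\<^esub> (act x (t y) \<ominus>\<^bsub>M\<^esub> act y (t x) \<ominus>\<^bsub>M\<^esub> t (x \<otimes>\<^bsub>L\<^esub> y))"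
      using c T(6)[OF c(2)] T(6)[OF c(5)] T(6)[OF bracket_closed[OF c(2,5)]]
      by (simp add: act_minus act_closed M.M.idealizer_sum)
    also have "\<dots> \<in> MH"
      unfolding T(5)[OF c(2,5), symmetric]
      by (rule MHs(4)[OF MHs(5)[OF act_MH[OF c(2,6)] act_MH[OF c(5,3)]] T(7)[OF c(2,5)]])
    finally show ?thesis
      unfolding uv' using c by (simp add: I_iff act_closed bracket_closed)
  qed
  interpret SI: lie_alg K "subalg S I" by (rule S.subalgebra[OF Isub Ibr])
  have GSI: "submodule G K (subalg S I)" by (rule submodule_subalg[OF Gsub Isub GI S.L_module])
  have Gid: "u \<otimes>\<^bsub>subalg S I\<^esub> v \<in> G" if uv: "u \<in> carrier (subalg S I)" "v \<in> G" for u v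
  proof -
    obtain z where z: "z \<in> H" "v = graph_map d z" using uv(2) by (auto simp: G_def)
    then show ?thesis using uv(1) by (auto simp: I_def tr_idealizer_def S_def G_def)
  qed
  define E where "E = quot_alg (subalg S I) G"
  interpret E: lie_alg K E unfolding E_def by (rule SI.quot_lie_alg[OF GSI Gid])
  define i where "i = (\<lambda>m. G +>\<^bsub>S\<^esub> (m, \<zero>\<^bsub>L\<^esub>))"
  define p where "p = induced L H (snd :: 'm \<times> 'a \<Rightarrow> 'a)"
  have Ecar: "carrier E = (\<lambda>u. G +>\<^bsub>S\<^esub> u) ` I" by (simp add: E_def)
  have Ezero: "\<zero>\<^bsub>E\<^esub> = G" by (simp add: E_def)
  have Eadd: "(G +>\<^bsub>S\<^esub> u) \<oplus>\<^bsub>E\<^esub> (G +>\<^bsub>S\<^esub> v) = G +>\<^bsub>S\<^esub> (u \<oplus>\<^bsub>S\<^esub> v)" if "u \<in> I" "v \<in> I" for u v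
    using SI.L.quot_add[OF GSI] that by (simp add: E_def del: quot_alg_simps)
  have Emult: "(G +>\<^bsub>S\<^esub> u) \<otimes>\<^bsub>E\<^esub> (G +>\<^bsub>S\<^esub> v) = G +>\<^bsub>S\<^esub> (u \<otimes>\<^bsub>S\<^esub> v)" if "u \<in> I" "v \<in> I" for u v
    using SI.quot_bracket[OF GSI Gid] that by (simp add: E_def del: quot_alg_simps)
  have Eeq: "G +>\<^bsub>S\<^esub> u = G +>\<^bsub>S\<^esub> v \<longleftrightarrow> u \<ominus>\<^bsub>S\<^esub> v \<in> G" if "u \<in> I" "v \<in> I" for u v
    using S.L.rcos_eq_iff[OF Gsub] that S.L.submodule_carrier[OF Isub] by blast
  have proj: "(\<lambda>u. G +>\<^bsub>S\<^esub> u) \<in> module_homs K (subalg S I) E"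
    using SI.L.quot_proj_hom[OF GSI] by (simp add: E_def)
  have mI: "(m, \<zero>\<^bsub>L\<^esub>) \<in> I" if "m \<in> MH" for m
    using that by (simp add: I_iff T0 MHs(1) a_minus_def M.M.minus_zero_eq)
  have tI: "(t x, x) \<in> I" if "x \<in> carrier L" for x
    using that by (simp add: I_iff T(6) MHs(6) a_minus_def M.M.r_neg)
  have snd_hom: "snd \<in> module_homs K (subalg S I) L"
    by (rule module_homsI) (auto simp: I_iff)
  have sndG: "snd ` G \<subseteq> H" by (auto simp: G_iff)
  have p_coset: "p (G +>\<^bsub>S\<^esub> (m, x)) = \<pi> x" if "(m, x) \<in> I" for m x
    using SI.L.induced_rcos[OF GSI snd_hom L_module H_submodule sndG, of "(m, x)"] that
      by (simp add: p_def)
  have ext: "lie_extension K (quot_alg L H) (inv_module L H M act) (inv_act act) E i p"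
    unfolding lie_extension_def
  proof (intro conjI ballI)
    show "lie_algebra K E" using E.lie_alg_axioms by (simp add: lie_alg_def)
    have "(\<lambda>m. (m, \<zero>\<^bsub>L\<^esub>)) \<in> module_homs K (inv_module L H M act) (subalg S I)"
      by (rule module_homsI) (auto simp: mI)
    from module_homs_comp[OF this proj] show "i \<in> module_homs K (inv_module L H M act) E"
      by (simp add: i_def)
    show "inj_on i (carrier (inv_module L H M act))"
    proof (rule inj_onI)
      fix m n assume mn: "m \<in> carrier (inv_module L H M act)" "n \<in> carrier (inv_module L H M act)"
        "i m = i n"
      then have "(m \<ominus>\<^bsub>M\<^esub> n, \<zero>\<^bsub>L\<^esub>) \<in> G"
        by (simp add: i_def Eeq mI Sminus MHs(1)) (simp add: a_minus_def L.M.minus_zero_eq)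
      then show "m = n" using mn(1,2) by (simp add: G_iff H_zero dT[OF H_zero] T0
        M.M.minus_eq_zero_iff MHs(1))
    qed
    show "i m \<otimes>\<^bsub>E\<^esub> i n = \<zero>\<^bsub>E\<^esub>" if "m \<in> carrier (inv_module L H M act)" "n \<in> carrier (inv_module L H M
      act)" for m n
      using that S.L.rcos_zero[OF Gsub]
      by (simp add: i_def Emult mI act_zero_l MHs(1) bracket_zero_l Ezero a_minus_def
        M.M.minus_zero_eq)
    show "p \<in> lie_homs K E (quot_alg L H)"
      unfolding lie_homs_def
    proof (intro CollectI conjI ballI)
      from SI.L.induced_hom[OF GSI snd_hom L_module H_submodule sndG]
      show "p \<in> module_homs K E (quot_alg L H)" by (simp add: p_def E_def)
      fix X Y assume "X \<in> carrier E" "Y \<in> carrier E"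
      then obtain m x n y where u: "(m, x) \<in> I" "X = G +>\<^bsub>S\<^esub> (m, x)" "(n, y) \<in> I" "Y = G +>\<^bsub>S\<^esub> (n, y)"
        unfolding Ecar by auto
      then show "p (X \<otimes>\<^bsub>E\<^esub> Y) = p X \<otimes>\<^bsub>quot_alg L H\<^esub> p Y"
        using Ibr[OF u(1,3)] by (simp add: Emult p_coset del: quot_alg_simps) (simp add:
          coset_bracket I_iff del: quot_alg_simps)
    qed
    show "p ` carrier E = carrier (quot_alg L H)"
    proof (intro equalityI subsetI)
      fix X assume "X \<in> p ` carrier E"
      then show "X \<in> carrier (quot_alg L H)" unfolding Ecar by (auto simp: p_coset I_iff)
    next
      fix X assume "X \<in> carrier (quot_alg L H)"
      then obtain x where x: "x \<in> carrier L" "X = \<pi> x" by (rule cosetE)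
      then have "X = p (G +>\<^bsub>S\<^esub> (t x, x))" by (simp add: p_coset tI)
      then show "X \<in> p ` carrier E" unfolding Ecar using tI[OF x(1)] by blast
    qed
    show "a_kernel E (quot_alg L H) p = i ` carrier (inv_module L H M act)"
    proof (intro equalityI subsetI)
      fix X assume "X \<in> a_kernel E (quot_alg L H) p"
      then obtain m x where u: "(m, x) \<in> I" "X = G +>\<^bsub>S\<^esub> (m, x)" "p X = H"
        unfolding a_kernel_def' Ecar by auto
      then have x: "x \<in> H" "m \<in> carrier M" "m \<ominus>\<^bsub>M\<^esub> d x \<in> MH"
        using p_coset[OF u(1)] coset_eq_self_iff[of x] by (auto simp: I_iff dT)
      \<comment> \<open>For x in \<open>H\<close>, (m, x) = (m - d x, 0) + (d x, x), and the last
        summand lies in the graph; so m - d x is the preimage under i.\<close>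
      have "m \<ominus>\<^bsub>M\<^esub> (m \<ominus>\<^bsub>M\<^esub> d x) = d x" using x(2) D(3)[OF x(1)] by (rule M.M.diff_diff_cancel)
      then have "(m, x) \<ominus>\<^bsub>S\<^esub> (m \<ominus>\<^bsub>M\<^esub> d x, \<zero>\<^bsub>L\<^esub>) \<in> G"
        using x D(3)[OF x(1)] H_carrier[OF x(1)]
          by (simp add: Sminus G_iff) (simp add: a_minus_def L.M.minus_zero_eq)
      then have "X = i (m \<ominus>\<^bsub>M\<^esub> d x)" using u(1,2) mI[OF x(3)] by (simp add: i_def Eeq)
      then show "X \<in> i ` carrier (inv_module L H M act)" using x(3) by simp
    next
      fix X assume "X \<in> i ` carrier (inv_module L H M act)"
      then obtain m where m: "m \<in> MH" "X = i m" by auto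
      then show "X \<in> a_kernel E (quot_alg L H) p"
        using mI[OF m(1)] by (auto simp: a_kernel_def' Ecar i_def p_coset coset_H[OF H_zero])
    qed
    fix e n assume "e \<in> carrier E" "n \<in> carrier (inv_module L H M act)"
    then obtain m x where u: "(m, x) \<in> I" "e = G +>\<^bsub>S\<^esub> (m, x)" and n: "n \<in> MH" unfolding Ecar by auto
    show "i (inv_act act (p e) n) = e \<otimes>\<^bsub>E\<^esub> i n"
      using u n mI[OF n] by (simp add: p_coset I_iff inv_act_coset i_def Emult)
        (simp add: I_iff act_zero_l bracket_zero_r a_minus_def M.M.minus_zero_eq act_closed MHs(1))
  qed
  interpret X: lie_ext K "quot_alg L H" "inv_module L H M act" "inv_act act" E i p
    using ext by (simp add: lie_ext_def lie_ext_axioms_def Q.lie_rep_axioms)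
  have thom: "(\<lambda>x. G +>\<^bsub>S\<^esub> (t x, x)) \<in> module_homs K L E"
  proof (rule module_homs_comp[OF _ proj])
    show "(\<lambda>x. (t x, x)) \<in> module_homs K L (subalg S I)"
      by (rule module_homsI) (auto simp: tI module_homs_add[OF T(1)] module_homs_smult[OF T(1)])
  qed
  \<comment> \<open>On \<open>H\<close> the map t is d, so (t z, z) is a point of the graph.\<close>
  have tz: "G +>\<^bsub>S\<^esub> (t z, z) = \<zero>\<^bsub>E\<^esub>" if "z \<in> H" for z
    using S.L.rcos_absorb[OF Gsub, of "(t z, z)"] that by (simp add: Ezero G_iff dT)
  obtain \<sigma> where \<sigma>_ext: "\<sigma> \<in> module_homs K (quot_alg L H) E" "\<sigma> \<in> extensional (carrier (quot_alg L
    H))"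
      "\<And>x. x \<in> carrier L \<Longrightarrow> \<sigma> (\<pi> x) = G +>\<^bsub>S\<^esub> (t x, x)"
    by (rule descend_hom[OF thom E.L_module tz], assumption, rule that)
  note \<sigma> = \<sigma>_ext(1,3)
  have \<sigma>s: "\<sigma> \<in> linear_sections K (quot_alg L H) E p"
    using \<sigma> by (auto simp: linear_sections_def p_coset tI)
  have "section_cocycle (quot_alg L H) (inv_module L H M act) E i \<sigma> = f"
  proof (rule X.section_cocycle_eqI[OF \<sigma>s Q.cocyclesD(1)[OF T(4)]])
    fix X Y assume "X \<in> carrier (quot_alg L H)" "Y \<in> carrier (quot_alg L H)"
    then obtain x y where xy: "x \<in> carrier L" "X = \<pi> x" "y \<in> carrier L" "Y = \<pi> y"
      by (auto elim!: cosetE)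
    note b = bracket_closed[OF xy(1,3)]
    have "act x (t y) \<ominus>\<^bsub>M\<^esub> act y (t x) = f (\<pi> x, \<pi> y) \<oplus>\<^bsub>M\<^esub> t (x \<otimes>\<^bsub>L\<^esub> y)"
      unfolding T(5)[OF xy(1,3)] using xy(1,3) b T(6) by (simp add: M.M.diff_add_cancel act_closed)
    then have "(t x, x) \<otimes>\<^bsub>S\<^esub> (t y, y) = (f (\<pi> x, \<pi> y), \<zero>\<^bsub>L\<^esub>) \<oplus>\<^bsub>S\<^esub> (t (x \<otimes>\<^bsub>L\<^esub> y), x \<otimes>\<^bsub>L\<^esub> y)"
      using b by simp
    then show "\<sigma> X \<otimes>\<^bsub>E\<^esub> \<sigma> Y = i (f (X, Y)) \<oplus>\<^bsub>E\<^esub> \<sigma> (X \<otimes>\<^bsub>quot_alg L H\<^esub> Y)"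
      unfolding xy(2,4) using xy(1,3) b
      by (simp add: coset_bracket \<sigma>(2) Emult tI i_def Eadd mI T(7) del: quot_alg_simps ops)
  qed
  then show ?thesis
    using X.ext_class_eq[OF \<sigma>s] unfolding tr_der_def E_def i_def p_def S_def G_def I_def by simp
qed

end

section \<open>Linearity of transgression and exactness at the invariant classes\<close>

context lie_rep
begin

lemma H2_class_zero_iff:
  assumes "f \<in> cocycles2 K L M act"
  shows "H2_class K L M act f = \<zero>\<^bsub>H2 K L M act\<^esub> \<longleftrightarrow> (\<exists>b\<in>module_homs K L M.
    \<forall>x\<in>carrier L. \<forall>y\<in>carrier L. f (x, y) = act x (b y) \<ominus>\<^bsub>M\<^esub> act y (b x) \<ominus>\<^bsub>M\<^esub> b (x \<otimes>\<^bsub>L\<^esub> y))"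
  unfolding H2_zero H2_class_eq_iff[OF assms zero_cocycle]
  by (simp add: act_closed bracket_closed module_homs_closed cong: bex_cong)

end

text \<open>Replacing t by t + \<delta>(m) does not change its coboundary: \<open>xym\<close> is x
  \<cdot> (y \<cdot> m), and \<open>xym \<ominus> yxm\<close> is the action of [x, y] on m.\<close>

lemma (in abelian_group) coboundary_shift_sum:
  assumes "xty \<in> carrier G" "ytx \<in> carrier G" "txy \<in> carrier G" "xym \<in> carrier G" "yxm \<in> carrier G"
  shows "(xty \<oplus> xym) \<ominus> (ytx \<oplus> yxm) \<ominus> (txy \<oplus> (xym \<ominus> yxm)) = xty \<ominus> ytx \<ominus> txy"
  using assms by algebra

lemma (in abelian_group) coboundary_add:
  assumes "a \<in> carrier G" "b \<in> carrier G" "c \<in> carrier G" "a' \<in> carrier G" "b' \<in> carrier G" "c' \<in>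
    carrier G"
  shows "(a \<oplus> a') \<ominus> (b \<oplus> b') \<ominus> (c \<oplus> c') = (a \<ominus> b \<ominus> c) \<oplus> (a' \<ominus> b' \<ominus> c')"
  using assms by algebra

lemma (in abelian_group) diff_add_swap:
  assumes "a \<in> carrier G" "b \<in> carrier G" "a' \<in> carrier G" "b' \<in> carrier G"
  shows "(a \<oplus> a') \<ominus> (b \<oplus> b') = (a \<ominus> b) \<oplus> (a' \<ominus> b')"
  using assms by algebra

lemma (in abelian_group) diff_diff_swap:
  assumes "a \<in> carrier G" "b \<in> carrier G" "a' \<in> carrier G" "b' \<in> carrier G"
  shows "(a \<ominus> a') \<ominus> (b \<ominus> b') = (a \<ominus> b) \<ominus> (a' \<ominus> b')"
  using assms by algebra

context ideal_rep
begin

text \<open>Another representative is e = d + \<delta>(m); then t + \<delta>(m) is a datum for e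
  with the same f, since an inner derivation has zero coboundary. Thus \<open>tr_der\<close> is
  constant on the class, and the description in \<open>tr\<close> resolves.\<close>

lemma tr_class:
  assumes d: "d \<in> inv_ders" and datum: "tr_datum d t f"
  shows "tr K L H M act (class_H d) = class2_Q f"
proof -
  note dH = inv_dersD(1)[OF d] and T = tr_datumD[OF datum]
  have eq: "tr_der K L H M act e = class2_Q f" if e: "e \<in> class_H d" for e
  proof -
    have eH: "e \<in> ders_H" "class_H e = class_H d" using H.H1_class_rep[OF dH e] .
    then obtain m where m: "m \<in> carrier M" "\<And>z. z \<in> H \<Longrightarrow> e z = act z m \<oplus>\<^bsub>M\<^esub> d z"
      using H.H1_class_eq_iff[OF eH(1) dH] by auto
    define t' where "t' x = t x \<oplus>\<^bsub>M\<^esub> act x m" for x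
    have t': "t' \<in> module_homs K L M"
      unfolding t'_def by (rule module_homs_sum[OF T(1) act_hom_l[OF m(1)] M_module])
    have "tr_datum e t' f"
      unfolding tr_datum_def
    proof (intro conjI ballI t' T(4))
      show "t' z = e z" if "z \<in> H" for z
        using that m T(6) by (simp add: t'_def m(2) T(2)[symmetric] M.M.a_comm act_closed H_carrier)
      show "der_act L H M act x e z = act z (t' x)" if x: "x \<in> carrier L" and z: "z \<in> H" for x z
      proof -
        note c = ders_HD(3)[OF dH z] ders_HD(3)[OF dH H_ideal[OF x z]] H_carrier[OF z]
        have "der_act L H M act x e z = act x (act z m \<oplus>\<^bsub>M\<^esub> d z) \<ominus>\<^bsub>M\<^esub> (act (x \<otimes>\<^bsub>L\<^esub> z) m \<oplus>\<^bsub>M\<^esub> d (x \<otimes>\<^bsub>L\<^esub> z))"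
          using x z by (simp add: der_act_apply m(2) H_ideal)
        also have "\<dots> = act x (act z m) \<ominus>\<^bsub>M\<^esub> (act x (act z m) \<ominus>\<^bsub>M\<^esub> act z (act x m)) \<oplus>\<^bsub>M\<^esub> der_act L H M act
          x d z"
          using x z m(1) c by (simp add: der_act_apply act_r_distr act_bracket act_closed
            M.M.diff_add_swap)
        also have "\<dots> = act z (t' x)"
          using x z m(1) c T(6)[OF x]
          by (simp add: T(3) t'_def act_r_distr act_closed M.M.diff_diff_cancel M.M.a_comm)
        finally show ?thesis .
      qed
      show "f (\<pi> x, \<pi> y) = act x (t' y) \<ominus>\<^bsub>M\<^esub> act y (t' x) \<ominus>\<^bsub>M\<^esub> t' (x \<otimes>\<^bsub>L\<^esub> y)"
        if "x \<in> carrier L" "y \<in> carrier L" for x y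
        using that m(1) T(6)
        by (simp add: T(5) t'_def act_r_distr act_bracket act_closed bracket_closed
          M.M.coboundary_shift_sum)
    qed
    then show ?thesis by (rule tr_der_eq[OF eH(1)])
  qed
  show ?thesis
    unfolding tr_def by (rule the_equality) (use eq H.H1_class_self[OF dH] in blast)+
qed

text \<open>The conditions on a datum are linear, so data can be added; through
  \<open>tr_class\<close> this becomes additivity of \<open>tr\<close>.\<close>

lemma tr_datum_add:
  assumes d: "d \<in> inv_ders" "d' \<in> inv_ders" and datum: "tr_datum d t f" "tr_datum d' t' f'"
  shows "tr_datum (\<lambda>z\<in>H. d z \<oplus>\<^bsub>M\<^esub> d' z) (\<lambda>x. t x \<oplus>\<^bsub>M\<^esub> t' x)
    (\<lambda>u\<in>carrier (quot_alg L H) \<times> carrier (quot_alg L H). f u \<oplus>\<^bsub>M\<^esub> f' u)"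
proof -
  note T = tr_datumD[OF datum(1)] and T' = tr_datumD[OF datum(2)]
  note D = ders_HD[OF inv_dersD(1)[OF d(1)]] and D' = ders_HD[OF inv_dersD(1)[OF d(2)]]
  have "f \<oplus>\<^bsub>cocycle_space K (quot_alg L H) (inv_module L H M act) (inv_act act)\<^esub> f' \<in> cocycles_Q"
    using abelian_groupE(1)[OF module.axioms(2)[OF Q.cocycle_space_linear[unfolded
      linear_space_iff]]] T(4) T'(4)
    by (simp only: Q.cocycle_space_simps(1))
  then have f: "(\<lambda>u\<in>carrier (quot_alg L H) \<times> carrier (quot_alg L H). f u \<oplus>\<^bsub>M\<^esub> f' u) \<in> cocycles_Q"
    by (simp only: Q.cocycle_space_simps inv_module_simps)
  show ?thesis
    unfolding tr_datum_def
  proof (intro conjI ballI f module_homs_sum[OF T(1) T'(1) M_module])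
    show "t z \<oplus>\<^bsub>M\<^esub> t' z = (\<lambda>z\<in>H. d z \<oplus>\<^bsub>M\<^esub> d' z) z" if "z \<in> H" for z using that T(2) T'(2) by simp
    show "der_act L H M act x (\<lambda>z\<in>H. d z \<oplus>\<^bsub>M\<^esub> d' z) z = act z (t x \<oplus>\<^bsub>M\<^esub> t' x)"
      if "x \<in> carrier L" "z \<in> H" for x z
      using that T(3)[OF that] T'(3)[OF that] T(6) T'(6) D(3) D'(3)
      by (simp add: der_act_apply H_ideal act_r_distr act_closed H_carrier M.M.diff_add_swap)
    show "(\<lambda>u\<in>carrier (quot_alg L H) \<times> carrier (quot_alg L H). f u \<oplus>\<^bsub>M\<^esub> f' u) (\<pi> x, \<pi> y) =
      act x (t y \<oplus>\<^bsub>M\<^esub> t' y) \<ominus>\<^bsub>M\<^esub> act y (t x \<oplus>\<^bsub>M\<^esub> t' x) \<ominus>\<^bsub>M\<^esub> (t (x \<otimes>\<^bsub>L\<^esub> y) \<oplus>\<^bsub>M\<^esub> t' (x \<otimes>\<^bsub>L\<^esub> y))"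
      if "x \<in> carrier L" "y \<in> carrier L" for x y
      using that T(6) T'(6) by (simp add: T(5) T'(5) act_r_distr act_closed bracket_closed
        M.M.coboundary_add)
  qed
qed

lemma tr_datum_smult:
  assumes d: "d \<in> inv_ders" and a: "a \<in> carrier K" and datum: "tr_datum d t f"
  shows "tr_datum (\<lambda>z\<in>H. a \<odot>\<^bsub>M\<^esub> d z) (\<lambda>x. a \<odot>\<^bsub>M\<^esub> t x)
    (\<lambda>u\<in>carrier (quot_alg L H) \<times> carrier (quot_alg L H). a \<odot>\<^bsub>M\<^esub> f u)"
proof -
  note T = tr_datumD[OF datum]
  note D = ders_HD[OF inv_dersD(1)[OF d]]
  have "a \<odot>\<^bsub>cocycle_space K (quot_alg L H) (inv_module L H M act) (inv_act act)\<^esub> f \<in> cocycles_Q"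
    using module.smult_closed[OF Q.cocycle_space_linear[unfolded linear_space_iff] a] T(4)
    by (simp only: Q.cocycle_space_simps(1))
  then have f: "(\<lambda>u\<in>carrier (quot_alg L H) \<times> carrier (quot_alg L H). a \<odot>\<^bsub>M\<^esub> f u) \<in> cocycles_Q"
    by (simp only: Q.cocycle_space_simps inv_module_simps)
  show ?thesis
    unfolding tr_datum_def
  proof (intro conjI ballI f module_homs_scale[OF T(1) a M_module])
    show "a \<odot>\<^bsub>M\<^esub> t z = (\<lambda>z\<in>H. a \<odot>\<^bsub>M\<^esub> d z) z" if "z \<in> H" for z using that T(2) by simp
    have dist: "a \<odot>\<^bsub>M\<^esub> (m \<ominus>\<^bsub>M\<^esub> n) = a \<odot>\<^bsub>M\<^esub> m \<ominus>\<^bsub>M\<^esub> a \<odot>\<^bsub>M\<^esub> n" if "m \<in> carrier M" "n \<in> carrier M" for m n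
      using that a by (simp add: a_minus_def M.smult_r_distr M.smult_r_minus)
    show "der_act L H M act x (\<lambda>z\<in>H. a \<odot>\<^bsub>M\<^esub> d z) z = act z (a \<odot>\<^bsub>M\<^esub> t x)" if "x \<in> carrier L" "z \<in> H"
      for x z
      using that T(3)[OF that, symmetric] T(6) D(3) a
      by (simp add: der_act_apply H_ideal act_smult_r act_closed H_carrier dist)
    show "(\<lambda>u\<in>carrier (quot_alg L H) \<times> carrier (quot_alg L H). a \<odot>\<^bsub>M\<^esub> f u) (\<pi> x, \<pi> y) =
      act x (a \<odot>\<^bsub>M\<^esub> t y) \<ominus>\<^bsub>M\<^esub> act y (a \<odot>\<^bsub>M\<^esub> t x) \<ominus>\<^bsub>M\<^esub> a \<odot>\<^bsub>M\<^esub> t (x \<otimes>\<^bsub>L\<^esub> y)"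
      if "x \<in> carrier L" "y \<in> carrier L" for x y
      using that T(6) a by (simp add: T(5) act_smult_r act_closed bracket_closed dist)
  qed
qed

lemma tr_datum_inv:
  assumes "d \<in> ders_H" "tr_datum d t f"
  shows "d \<in> inv_ders"
  using assms(1) tr_datumD(3,6)[OF assms(2)] by (auto simp: inv_ders_def)

lemma tr_hom: "tr K L H M act \<in> module_homs K (H1_inv K L H M act) H2_Q"
proof (rule module_homsI)
  fix C assume "C \<in> carrier (H1_inv K L H M act)"
  then obtain d where d: "d \<in> inv_ders" "C = class_H d" by (auto simp: H1_inv_carrier)
  obtain t f where tf: "tr_datum d t f" using tr_datum_exists[OF d(1)] .
  note T = tr_datumD[OF tf] and dH = inv_dersD(1)[OF d(1)]
  show "tr K L H M act C \<in> carrier H2_Q" using T(4)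
    by (simp add: d(2) tr_class[OF d(1) tf] Q.H2_carrier)
  show "tr K L H M act (a \<odot>\<^bsub>H1_inv K L H M act\<^esub> C) = a \<odot>\<^bsub>H2_Q\<^esub> tr K L H M act C"
    if a: "a \<in> carrier K" for a
  proof -
    note s = tr_datum_smult[OF d(1) a tf]
    have "a \<odot>\<^bsub>der_space K (subalg L H) M act\<^esub> d \<in> ders_H"
      using module.smult_closed[OF H.der_space_linear[unfolded linear_space_iff] a] dH
        by (simp only: H.der_space_simps(1))
    then have e: "(\<lambda>z\<in>H. a \<odot>\<^bsub>M\<^esub> d z) \<in> inv_ders" using tr_datum_inv[OF _ s] by simp
    show ?thesis
      using H.H1_smult[OF dH a] Q.H2_smult[OF T(4) a] tr_class[OF e s]
      by (simp add: d(2) tr_class[OF d(1) tf] del: quot_alg_simps)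
  qed
  fix C' assume "C' \<in> carrier (H1_inv K L H M act)"
  then obtain d' where d': "d' \<in> inv_ders" "C' = class_H d'" by (auto simp: H1_inv_carrier)
  obtain t' f' where tf': "tr_datum d' t' f'" using tr_datum_exists[OF d'(1)] .
  note T' = tr_datumD[OF tf'] and dH' = inv_dersD(1)[OF d'(1)]
  note s = tr_datum_add[OF d(1) d'(1) tf tf']
  have "d \<oplus>\<^bsub>der_space K (subalg L H) M act\<^esub> d' \<in> ders_H"
    using abelian_groupE(1)[OF module.axioms(2)[OF H.der_space_linear[unfolded linear_space_iff]]]
      dH dH'
    by (simp only: H.der_space_simps(1))
  then have e: "(\<lambda>z\<in>H. d z \<oplus>\<^bsub>M\<^esub> d' z) \<in> inv_ders" using tr_datum_inv[OF _ s] by simp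
  show "tr K L H M act (C \<oplus>\<^bsub>H1_inv K L H M act\<^esub> C') = tr K L H M act C \<oplus>\<^bsub>H2_Q\<^esub> tr K L H M act C'"
    using H.H1_add[OF dH dH'] Q.H2_add[OF T(4) T'(4)] tr_class[OF e s]
    by (simp add: d(2) d'(2) tr_class[OF d(1) tf] tr_class[OF d'(1) tf'] del: quot_alg_simps)
qed

text \<open>A derivation \<open>D\<close> of \<open>L\<close> serves as its own t, with zero
  coboundary, so its restriction transgresses to zero. Conversely, if f is the coboundary of b over
  the quotient, then t - b \<circ> \<pi> has zero coboundary, hence is a derivation, and it still
  extends d because b \<circ> \<pi> vanishes on \<open>H\<close>.\<close>

lemma exact_H1_inv:
  "exact_at K (H1 K L M act) (res1 K L H M act) (H1_inv K L H M act) (tr K L H M act) H2_Q"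
  unfolding exact_at_def
proof (intro conjI res1_hom tr_hom equalityI subsetI)
  fix C assume "C \<in> res1 K L H M act ` carrier (H1 K L M act)"
  then obtain D where D: "D \<in> ders_L" "C = class_H (restrict D H)"
    by (auto simp: H1_carrier res1_class)
  note D' = dersD[OF D(1)] and R = res_ders[OF D(1)]
  have "tr_datum (restrict D H) D (\<lambda>u\<in>carrier (quot_alg L H) \<times> carrier (quot_alg L H). \<zero>\<^bsub>M\<^esub>)"
    unfolding tr_datum_def
  proof (intro conjI ballI D'(1))
    show "(\<lambda>u\<in>carrier (quot_alg L H) \<times> carrier (quot_alg L H). \<zero>\<^bsub>M\<^esub>) \<in> cocycles_Q"
      using Q.zero_cocycle by (simp only: inv_module_simps)
    show "der_act L H M act x (restrict D H) z = act z (D x)"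
      if x: "x \<in> carrier L" and z: "z \<in> H" for x z
      using x z M.M.diff_diff_cancel[of "act x (D z)" "act z (D x)"]
      by (simp add: der_act_apply H_ideal D'(4,5) H_carrier act_closed)
    show "(\<lambda>u\<in>carrier (quot_alg L H) \<times> carrier (quot_alg L H). \<zero>\<^bsub>M\<^esub>) (\<pi> x, \<pi> y) =
      act x (D y) \<ominus>\<^bsub>M\<^esub> act y (D x) \<ominus>\<^bsub>M\<^esub> D (x \<otimes>\<^bsub>L\<^esub> y)" if "x \<in> carrier L" "y \<in> carrier L" for x y
      using that by (simp add: D'(4,5) act_closed a_minus_def M.M.r_neg)
  qed simp
  then have "tr K L H M act C = \<zero>\<^bsub>H2_Q\<^esub>"
    using tr_class[OF R] by (simp add: D(2) Q.H2_zero del: quot_alg_simps)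
  then show "C \<in> a_kernel (H1_inv K L H M act) H2_Q (tr K L H M act)"
    using R by (auto simp: a_kernel_def' H1_inv_carrier D(2))
next
  fix C assume "C \<in> a_kernel (H1_inv K L H M act) H2_Q (tr K L H M act)"
  then obtain d where d: "d \<in> inv_ders" "C = class_H d" "tr K L H M act (class_H d) = \<zero>\<^bsub>H2_Q\<^esub>"
    by (auto simp: a_kernel_def' H1_inv_carrier)
  obtain t f where tf: "tr_datum d t f" using tr_datum_exists[OF d(1)] .
  note T = tr_datumD[OF tf] and dH = inv_dersD(1)[OF d(1)]
  have "class2_Q f = \<zero>\<^bsub>H2_Q\<^esub>" using d(3) tr_class[OF d(1) tf] by simp
  then obtain b where b: "b \<in> module_homs K (quot_alg L H) (inv_module L H M act)" and
    fb: "\<forall>X\<in>carrier (quot_alg L H). \<forall>Y\<in>carrier (quot_alg L H).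
      f (X, Y) = inv_act act X (b Y) \<ominus>\<^bsub>inv_module L H M act\<^esub> inv_act act Y (b X) \<ominus>\<^bsub>inv_module L H M act\<^esub>
        b (X \<otimes>\<^bsub>quot_alg L H\<^esub> Y)"
    unfolding Q.H2_class_zero_iff[OF T(4)] by blast
  have bMH: "b (\<pi> x) \<in> MH" if "x \<in> carrier L" for x
    using module_homs_closed[OF b coset_closed[OF that]] by simp
  have bM: "b (\<pi> x) \<in> carrier M" if "x \<in> carrier L" for x
    using bMH[OF that] by (simp add: MH_iff)
  have fb': "act x (t y) \<ominus>\<^bsub>M\<^esub> act y (t x) \<ominus>\<^bsub>M\<^esub> t (x \<otimes>\<^bsub>L\<^esub> y) =
    act x (b (\<pi> y)) \<ominus>\<^bsub>M\<^esub> act y (b (\<pi> x)) \<ominus>\<^bsub>M\<^esub> b (\<pi> (x \<otimes>\<^bsub>L\<^esub> y))"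
    if "x \<in> carrier L" "y \<in> carrier L" for x y
    using fb[rule_format, OF coset_closed[OF that(1)] coset_closed[OF that(2)]] that
    by (simp add: T(5) coset_bracket inv_act_coset bMH inv_module_minus act_MH bracket_closed del:
      quot_alg_simps)
  have b': "b \<in> module_homs K (quot_alg L H) M"
    using b unfolding inv_module_def by (simp add: module_homs_into_subalg M.submoduleE(1)[OF
      MH_submodule])
  define D where "D x = t x \<ominus>\<^bsub>M\<^esub> b (\<pi> x)" for x
  have Dh: "D \<in> module_homs K L M"
    unfolding D_def by (rule module_homs_diff[OF T(1) module_homs_comp[OF coset_hom b'] M_module])
  have DL: "(\<lambda>x\<in>carrier L. D x) \<in> ders_L"
  proof (rule restrict_dersI[OF Dh])
    fix x y assume xy: "x \<in> carrier L" "y \<in> carrier L"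
    note br = bracket_closed[OF xy]
    have "D (x \<otimes>\<^bsub>L\<^esub> y) = (act x (t y) \<ominus>\<^bsub>M\<^esub> act y (t x)) \<ominus>\<^bsub>M\<^esub> (act x (t y) \<ominus>\<^bsub>M\<^esub> act y (t x) \<ominus>\<^bsub>M\<^esub> t (x \<otimes>\<^bsub>L\<^esub> y)) \<ominus>\<^bsub>M\<^esub>
      b (\<pi> (x \<otimes>\<^bsub>L\<^esub> y))"
      using xy T(6) br by (simp add: D_def M.M.diff_diff_cancel act_closed)
    also have "\<dots> = (act x (t y) \<ominus>\<^bsub>M\<^esub> act y (t x)) \<ominus>\<^bsub>M\<^esub> (act x (b (\<pi> y)) \<ominus>\<^bsub>M\<^esub> act y (b (\<pi> x)))"
      unfolding fb'[OF xy]
      using act_closed[OF xy(1) T(6)[OF xy(2)]] act_closed[OF xy(2) T(6)[OF xy(1)]] bM[OF br]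
        act_closed[OF xy(1) bM[OF xy(2)]] act_closed[OF xy(2) bM[OF xy(1)]] by algebra
    also have "\<dots> = act x (D y) \<ominus>\<^bsub>M\<^esub> act y (D x)"
      using xy T(6) bM by (simp add: D_def act_minus act_closed M.M.diff_diff_swap)
    finally show "D (x \<otimes>\<^bsub>L\<^esub> y) = act x (D y) \<ominus>\<^bsub>M\<^esub> act y (D x)" .
  qed
  have "restrict (\<lambda>x\<in>carrier L. D x) H = d"
  proof (rule extensionalityI)
    fix z assume z: "z \<in> H"
    have "b (\<pi> z) = \<zero>\<^bsub>M\<^esub>" using module_homs_zero[OF b' Q.L_module M_module] z by (simp add: coset_H)
    then show "restrict (\<lambda>x\<in>carrier L. D x) H z = d z"
      using z ders_HD(3)[OF dH z] by (simp add: D_def T(2) H_carrier a_minus_def M.M.minus_zero_eq)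
  qed (use ders_HD(2)[OF dH] in auto)
  then have "C = res1 K L H M act (class_L (\<lambda>x\<in>carrier L. D x))"
    by (simp add: res1_class[OF DL] d(2))
  then show "C \<in> res1 K L H M act ` carrier (H1 K L M act)" using DL by (auto simp: H1_carrier)
qed

section \<open>Inflation in degree two\<close>

definition infl2 :: "('a set \<times> 'a set \<Rightarrow> 'm) \<Rightarrow> 'a \<times> 'a \<Rightarrow> 'm" where
  "infl2 f = (\<lambda>(x, y)\<in>carrier L \<times> carrier L. f (\<pi> x, \<pi> y))"

lemma infl2_apply: "\<lbrakk>x \<in> carrier L; y \<in> carrier L\<rbrakk> \<Longrightarrow> infl2 f (x, y) = f (\<pi> x, \<pi> y)"
  by (simp add: infl2_def)

lemma cocycles_Q_MH: "\<lbrakk>f \<in> cocycles_Q; x \<in> carrier L; y \<in> carrier L\<rbrakk> \<Longrightarrow> f (\<pi> x, \<pi> y) \<in> MH"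
  using Q.cocyclesD(6)[of f "\<pi> x" "\<pi> y"] by simp

lemma infl2_cocycle:
  assumes f: "f \<in> cocycles_Q"
  shows "infl2 f \<in> cocycles_L"
proof -
  note F = Q.cocyclesD[OF f] and fMH = cocycles_Q_MH[OF f]
  have hom: "g \<in> module_homs K (quot_alg L H) M"
    if "g \<in> module_homs K (quot_alg L H) (inv_module L H M act)" for g
    using that unfolding inv_module_def by (simp add: module_homs_into_subalg M.submoduleE(1)[OF
      MH_submodule])
  show ?thesis
    unfolding infl2_def
  proof (rule cocyclesI; unfold prod.case)
    fix x assume x: "x \<in> carrier L"
    show "(\<lambda>y. f (\<pi> y, \<pi> x)) \<in> module_homs K L M"
      by (rule module_homs_comp[OF coset_hom hom[OF F(3)[OF coset_closed[OF x]]]])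
    show "(\<lambda>y. f (\<pi> x, \<pi> y)) \<in> module_homs K L M"
      by (rule module_homs_comp[OF coset_hom hom[OF F(2)[OF coset_closed[OF x]]]])
    show "f (\<pi> x, \<pi> x) = \<zero>\<^bsub>M\<^esub>" using F(4)[OF coset_closed[OF x]] by simp
    fix y z assume yz: "y \<in> carrier L" "z \<in> carrier L"
    show "act x (f (\<pi> y, \<pi> z)) \<oplus>\<^bsub>M\<^esub> act y (f (\<pi> z, \<pi> x)) \<oplus>\<^bsub>M\<^esub> act z (f (\<pi> x, \<pi> y)) =
      f (\<pi> (x \<otimes>\<^bsub>L\<^esub> y), \<pi> z) \<oplus>\<^bsub>M\<^esub> f (\<pi> (y \<otimes>\<^bsub>L\<^esub> z), \<pi> x) \<oplus>\<^bsub>M\<^esub> f (\<pi> (z \<otimes>\<^bsub>L\<^esub> x), \<pi> y)"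
      using F(5)[OF coset_closed[OF x] coset_closed[OF yz(1)] coset_closed[OF yz(2)]] x yz
      by (simp add: coset_bracket inv_act_coset fMH del: quot_alg_simps)
  qed
qed

lemma infl2_hom: "infl2 \<in> module_homs K
  (cocycle_space K (quot_alg L H) (inv_module L H M act) (inv_act act)) (cocycle_space K L M act)"
proof (rule module_homsI)
  fix f assume "f \<in> carrier (cocycle_space K (quot_alg L H) (inv_module L H M act) (inv_act act))"
  then show "infl2 f \<in> carrier (cocycle_space K L M act)" by (simp add: infl2_cocycle)
qed (auto simp: infl2_def coset_closed intro!: restrict_ext)

text \<open>Inflation commutes with coboundaries: the coboundary of b inflates to that of b \<circ>
  \<pi>.\<close>

lemma infl2_coboundaries:
  "infl2 ` coboundaries2 K (quot_alg L H) (inv_module L H M act) (inv_act act) \<subseteq> coboundaries2 K L M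
    act"
proof
  fix g assume "g \<in> infl2 ` coboundaries2 K (quot_alg L H) (inv_module L H M act) (inv_act act)"
  then obtain b where b: "b \<in> module_homs K (quot_alg L H) (inv_module L H M act)"
    and g: "g = infl2 (coboundary2 (quot_alg L H) (inv_module L H M act) (inv_act act) b)"
    by (auto simp: coboundaries2_def)
  have bMH: "b (\<pi> x) \<in> MH" if "x \<in> carrier L" for x
    using module_homs_closed[OF b coset_closed[OF that]] by simp
  have b': "b \<in> module_homs K (quot_alg L H) M"
    using b unfolding inv_module_def by (simp add: module_homs_into_subalg M.submoduleE(1)[OF
      MH_submodule])
  have "g = coboundary2 L M act (\<lambda>x. b (\<pi> x))"
    unfolding g infl2_def coboundary2_def[of L]
  proof (rule restrict_ext; clarify)
    fix x y assume xy: "x \<in> carrier L" "y \<in> carrier L"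
    show "coboundary2 (quot_alg L H) (inv_module L H M act) (inv_act act) b (\<pi> x, \<pi> y) =
       act x (b (\<pi> y)) \<ominus>\<^bsub>M\<^esub> act y (b (\<pi> x)) \<ominus>\<^bsub>M\<^esub> b (\<pi> (x \<otimes>\<^bsub>L\<^esub> y))"
      unfolding Q.coboundary2_apply[OF coset_closed[OF xy(1)] coset_closed[OF xy(2)]] using xy
      by (simp add: coset_bracket inv_act_coset bMH inv_module_minus act_MH bracket_closed del:
        quot_alg_simps)
  qed
  then show "g \<in> coboundaries2 K L M act"
    using module_homs_comp[OF coset_hom b'] by (auto simp: coboundaries2_def)
qed

lemma inf2_class: "f \<in> cocycles_Q \<Longrightarrow> inf2 K L H M act (class2_Q f) = class2_L (infl2 f)"
  unfolding inf2_def infl2_def[symmetric, abs_def]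
  using linear_space.induced_rcos[OF Q.cocycle_space_linear Q.coboundaries2_submodule infl2_hom
     cocycle_space_linear[unfolded linear_space_iff] coboundaries2_submodule infl2_coboundaries]
       by simp

section \<open>Restriction in degree two and normalized cocycles\<close>

lemma restrict2_cocycle:
  assumes f: "f \<in> cocycles_L"
  shows "restrict f (H \<times> H) \<in> cocycles2 K (subalg L H) M act"
proof -
  note F = cocyclesD[OF f]
  have "restrict f (carrier (subalg L H) \<times> carrier (subalg L H)) \<in> cocycles2 K (subalg L H) M act"
    by (rule H.cocyclesI)
      (auto simp: H_carrier F(4,5) intro: module_homs_subalg[OF F(2)] module_homs_subalg[OF F(3)])
  then show ?thesis by simp
qed

lemma res2_class: "f \<in> cocycles_L \<Longrightarrow> res2 K L H M act (class2_L f) =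
  H2_class K (subalg L H) M act (restrict f (H \<times> H))"
proof -
  assume f: "f \<in> cocycles_L"
  have hom: "(\<lambda>f. restrict f (H \<times> H)) \<in> module_homs K (cocycle_space K L M act) (cocycle_space K
    (subalg L H) M act)"
    by (rule module_homsI) (auto simp: restrict2_cocycle H_carrier intro!: restrict_ext)
  have "(\<lambda>f. restrict f (H \<times> H)) ` coboundaries2 K L M act \<subseteq> coboundaries2 K (subalg L H) M act"
  proof
    fix g assume "g \<in> (\<lambda>f. restrict f (H \<times> H)) ` coboundaries2 K L M act"
    then obtain b where b: "b \<in> module_homs K L M" "g = restrict (coboundary2 L M act b) (H \<times> H)"
      by (auto simp: coboundaries2_def)
    have "g = coboundary2 (subalg L H) M act b"
      unfolding b(2) by (auto simp: coboundary2_def H_carrier intro!: restrict_ext)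
    then show "g \<in> coboundaries2 K (subalg L H) M act"
      using module_homs_subalg[OF b(1)] H_carrier by (auto simp: coboundaries2_def)
  qed
  from linear_space.induced_rcos[OF cocycle_space_linear coboundaries2_submodule hom
     H.cocycle_space_linear[unfolded linear_space_iff] H.coboundaries2_submodule this] f
  show ?thesis by (simp add: res2_def)
qed

text \<open>These are the cocycles of linear sections that extend a partial splitting: vanishing on
  H \<times> H says that the section is a homomorphism on \<open>H\<close>.\<close>

definition normalized :: "('a \<times> 'a \<Rightarrow> 'm) set" where
  "normalized = {f \<in> cocycles_L. \<forall>z\<in>H. \<forall>w\<in>H. f (z, w) = \<zero>\<^bsub>M\<^esub>}"

lemma shift_coboundary:
  assumes f: "f \<in> cocycles_L" and b: "b \<in> module_homs K L M"
  obtains g where "g \<in> cocycles_L" "class2_L g = class2_L f"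
    "\<And>x y. \<lbrakk>x \<in> carrier L; y \<in> carrier L\<rbrakk> \<Longrightarrow>
      f (x, y) = (act x (b y) \<ominus>\<^bsub>M\<^esub> act y (b x) \<ominus>\<^bsub>M\<^esub> b (x \<otimes>\<^bsub>L\<^esub> y)) \<oplus>\<^bsub>M\<^esub> g (x, y)"
    "\<And>x y. \<lbrakk>x \<in> carrier L; y \<in> carrier L\<rbrakk> \<Longrightarrow>
      g (x, y) = f (x, y) \<ominus>\<^bsub>M\<^esub> (act x (b y) \<ominus>\<^bsub>M\<^esub> act y (b x) \<ominus>\<^bsub>M\<^esub> b (x \<otimes>\<^bsub>L\<^esub> y))"
proof -
  define g where "g = f \<ominus>\<^bsub>cocycle_space K L M act\<^esub> coboundary2 L M act b"
  note cb = coboundary2_cocycle[OF b]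
  have g: "g \<in> cocycles_L"
    using abelian_group.minus_closed[OF module.axioms(2)[OF cocycle_space_linear[unfolded
      linear_space_iff]]] f cb
    by (simp add: g_def del: cocycle_space_simps(2-4))
  have ga: "g (x, y) = f (x, y) \<ominus>\<^bsub>M\<^esub> (act x (b y) \<ominus>\<^bsub>M\<^esub> act y (b x) \<ominus>\<^bsub>M\<^esub> b (x \<otimes>\<^bsub>L\<^esub> y))"
    if "x \<in> carrier L" "y \<in> carrier L" for x y
    using that by (simp add: g_def cocycle_space_minus[OF f cb] coboundary2_apply)
  have fa: "f (x, y) = (act x (b y) \<ominus>\<^bsub>M\<^esub> act y (b x) \<ominus>\<^bsub>M\<^esub> b (x \<otimes>\<^bsub>L\<^esub> y)) \<oplus>\<^bsub>M\<^esub> g (x, y)"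
    if "x \<in> carrier L" "y \<in> carrier L" for x y
  proof -
    have c: "act x (b y) \<ominus>\<^bsub>M\<^esub> act y (b x) \<ominus>\<^bsub>M\<^esub> b (x \<otimes>\<^bsub>L\<^esub> y) \<in> carrier M"
      using that by (simp add: act_closed module_homs_closed[OF b] bracket_closed)
    show ?thesis
      unfolding ga[OF that] using c cocyclesD(6)[OF f that]
      by (subst M.M.a_comm) (simp_all add: M.M.diff_add_cancel)
  qed
  have "class2_L f = class2_L g" unfolding H2_class_eq_iff[OF f g] using b fa by blast
  then show ?thesis using that g fa ga by metis
qed

lemma H2_1_simps [simp]:
  "\<zero>\<^bsub>H2_1 K L H M act\<^esub> = \<zero>\<^bsub>H2 K L M act\<^esub>"
  "add (H2_1 K L H M act) = add (H2 K L M act)"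
  "smult (H2_1 K L H M act) = smult (H2 K L M act)"
  by (simp_all add: H2_1_def)

text \<open>If the restriction of f is the coboundary of \<open>b0\<close> on \<open>H\<close>, the
  coboundary of a linear extension of \<open>b0\<close> to \<open>L\<close> is subtracted. The class
  over \<open>L\<close> stays the same and the new cocycle vanishes on H \<times> H.\<close>

lemma H2_1_carrier: "carrier (H2_1 K L H M act) = class2_L ` normalized"
proof (intro equalityI subsetI)
  fix c assume "c \<in> carrier (H2_1 K L H M act)"
  then obtain f where f: "f \<in> cocycles_L" "c = class2_L f"
    "H2_class K (subalg L H) M act (restrict f (H \<times> H)) = \<zero>\<^bsub>H2 K (subalg L H) M act\<^esub>"
    by (auto simp: H2_1_def a_kernel_def' H2_carrier res2_class)
  then obtain b0 where b0: "b0 \<in> module_homs K (subalg L H) M"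
    "\<And>z w. \<lbrakk>z \<in> H; w \<in> H\<rbrakk> \<Longrightarrow> f (z, w) = act z (b0 w) \<ominus>\<^bsub>M\<^esub> act w (b0 z) \<ominus>\<^bsub>M\<^esub> b0 (z \<otimes>\<^bsub>L\<^esub> w)"
    using H.H2_class_zero_iff[OF restrict2_cocycle[OF f(1)]] by auto
  obtain b where b: "b \<in> module_homs K L M" "\<And>z. z \<in> H \<Longrightarrow> b z = b0 z"
    using extend_from_H[OF b0(1)] by blast
  obtain g where g: "g \<in> cocycles_L" "class2_L g = class2_L f"
    "\<And>x y. \<lbrakk>x \<in> carrier L; y \<in> carrier L\<rbrakk> \<Longrightarrow>
      g (x, y) = f (x, y) \<ominus>\<^bsub>M\<^esub> (act x (b y) \<ominus>\<^bsub>M\<^esub> act y (b x) \<ominus>\<^bsub>M\<^esub> b (x \<otimes>\<^bsub>L\<^esub> y))"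
    using shift_coboundary[OF f(1) b(1)] by metis
  have "g (z, w) = \<zero>\<^bsub>M\<^esub>" if zw: "z \<in> H" "w \<in> H" for z w
  proof -
    have "g (z, w) = f (z, w) \<ominus>\<^bsub>M\<^esub> f (z, w)"
      using zw H_ideal[OF H_carrier[OF zw(1)] zw(2)] by (simp add: g(3) b b0(2) H_carrier)
    then show ?thesis using cocyclesD(6)[OF f(1) H_carrier[OF zw(1)] H_carrier[OF zw(2)]]
      by (simp add: a_minus_def M.M.r_neg)
  qed
  then have "g \<in> normalized" using g(1) by (simp add: normalized_def)
  then show "c \<in> class2_L ` normalized" using g(2) f(2) by blast
next
  fix c assume "c \<in> class2_L ` normalized"
  then obtain f where f: "f \<in> cocycles_L" "c = class2_L f" "\<And>z w. \<lbrakk>z \<in> H; w \<in> H\<rbrakk> \<Longrightarrow> f (z, w) = \<zero>\<^bsub>M\<^esub>"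
    by (auto simp: normalized_def)
  have "restrict f (H \<times> H) = (\<lambda>u\<in>carrier (subalg L H) \<times> carrier (subalg L H). \<zero>\<^bsub>M\<^esub>)"
    by (auto simp: f(3) restrict_def)
  then have "res2 K L H M act c = \<zero>\<^bsub>H2 K (subalg L H) M act\<^esub>"
    unfolding f(2) res2_class[OF f(1)] H.H2_zero by (rule arg_cong)
  then show "c \<in> carrier (H2_1 K L H M act)"
    using f(1,2) by (auto simp: H2_1_def a_kernel_def' H2_carrier)
qed

text \<open>Two arguments from \<open>H\<close> both have the zero coset, and f is
  alternating.\<close>

lemma infl2_normalized:
  assumes f: "f \<in> cocycles_Q"
  shows "infl2 f \<in> normalized"
proof -
  have "f (H, H) = \<zero>\<^bsub>M\<^esub>"
    using Q.cocyclesD(4)[OF f, of H] coset_closed[of "\<zero>\<^bsub>L\<^esub>"] coset_H[OF H_zero] by simp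
  then show ?thesis by (simp add: normalized_def infl2_cocycle[OF f] infl2_apply H_carrier coset_H)
qed

lemma inf2_hom: "inf2 K L H M act \<in> module_homs K H2_Q (H2_1 K L H M act)"
proof -
  have "inf2 K L H M act \<in> module_homs K H2_Q (H2 K L M act)"
    unfolding inf2_def infl2_def[symmetric, abs_def] H2_def
    by (rule linear_space.induced_hom[OF Q.cocycle_space_linear Q.coboundaries2_submodule infl2_hom
     cocycle_space_linear[unfolded linear_space_iff] coboundaries2_submodule infl2_coboundaries])
  then show ?thesis
    by (auto simp: module_homs_def H2_1_carrier Q.H2_carrier inf2_class infl2_normalized Pi_def)
qed

text \<open>If \<open>infl2 f\<close> is the coboundary of a linear t, this coboundary is zero on L
  \<times> H. There it says that x \<cdot> d = \<delta>(t x) for the restriction d of t to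
  \<open>H\<close>; so d is an invariant derivation, and t together with f is a datum for
  it.\<close>

lemma exact_H2_Q:
  "exact_at K (H1_inv K L H M act) (tr K L H M act) H2_Q (inf2 K L H M act) (H2_1 K L H M act)"
  unfolding exact_at_def
proof (intro conjI tr_hom inf2_hom equalityI subsetI)
  fix c assume "c \<in> tr K L H M act ` carrier (H1_inv K L H M act)"
  then obtain d where d: "d \<in> inv_ders" "c = tr K L H M act (class_H d)"
    by (auto simp: H1_inv_carrier)
  obtain t f where tf: "tr_datum d t f" using tr_datum_exists[OF d(1)] .
  note T = tr_datumD[OF tf]
  have "class2_L (infl2 f) = \<zero>\<^bsub>H2 K L M act\<^esub>"
    unfolding H2_class_zero_iff[OF infl2_cocycle[OF T(4)]]
    by (intro bexI[OF _ T(1)] ballI) (simp add: infl2_apply T(5))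
  then show "c \<in> a_kernel H2_Q (H2_1 K L H M act) (inf2 K L H M act)"
    using T(4) by (auto simp: d(2) tr_class[OF d(1) tf] a_kernel_def' Q.H2_carrier inf2_class)
next
  fix c assume "c \<in> a_kernel H2_Q (H2_1 K L H M act) (inf2 K L H M act)"
  then obtain f where f: "f \<in> cocycles_Q" "c = class2_Q f" "class2_L (infl2 f) = \<zero>\<^bsub>H2 K L M act\<^esub>"
    by (auto simp: a_kernel_def' Q.H2_carrier inf2_class)
  then obtain t where t: "t \<in> module_homs K L M"
    "\<And>x y. \<lbrakk>x \<in> carrier L; y \<in> carrier L\<rbrakk> \<Longrightarrow> f (\<pi> x, \<pi> y) = act x (t y) \<ominus>\<^bsub>M\<^esub> act y (t x) \<ominus>\<^bsub>M\<^esub> t (x \<otimes>\<^bsub>L\<^esub> y)"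
    using H2_class_zero_iff[OF infl2_cocycle[OF f(1)]] by (auto simp: infl2_apply)
  note T = module_homs_closed[OF t(1)]
  have f0: "f (\<pi> x, \<pi> z) = \<zero>\<^bsub>M\<^esub>" if "x \<in> carrier L" "z \<in> H" for x z
    using module_homs_zero[OF Q.cocyclesD(2)[OF f(1) coset_closed[OF that(1)]] Q.L_module
      Q.M_module] that(2)
    by (simp add: coset_H)
  have eq: "act x (t z) \<ominus>\<^bsub>M\<^esub> t (x \<otimes>\<^bsub>L\<^esub> z) = act z (t x)" if x: "x \<in> carrier L" and z: "z \<in> H" for x z
  proof -
    note zc = H_carrier[OF z] and br = bracket_closed[OF x H_carrier[OF z]]
    have "(act x (t z) \<ominus>\<^bsub>M\<^esub> t (x \<otimes>\<^bsub>L\<^esub> z)) \<ominus>\<^bsub>M\<^esub> act z (t x) = act x (t z) \<ominus>\<^bsub>M\<^esub> act z (t x) \<ominus>\<^bsub>M\<^esub> t (x \<otimes>\<^bsub>L\<^esub> z)"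
      using act_closed[OF x T[OF zc]] act_closed[OF zc T[OF x]] T[OF br] by algebra
    also have "\<dots> = \<zero>\<^bsub>M\<^esub>" using t(2)[OF x zc] f0[OF x z] by simp
    finally show ?thesis using x zc T br by (simp add: M.M.minus_eq_zero_iff act_closed)
  qed
  have "(\<lambda>z\<in>carrier (subalg L H). t z) \<in> ders_H"
  proof (rule H.restrict_dersI[OF module_homs_subalg[OF t(1)]])
    fix z w assume "z \<in> carrier (subalg L H)" "w \<in> carrier (subalg L H)"
    then have zw: "z \<in> H" "w \<in> H" by simp_all
    note c = zw[THEN H_carrier]
    \<comment> \<open>With x taken in \<open>H\<close>, the identity \<open>eq\<close> is the
      derivation law of t.\<close>
    have "act z (t w) \<ominus>\<^bsub>M\<^esub> act w (t z) = act z (t w) \<ominus>\<^bsub>M\<^esub> (act z (t w) \<ominus>\<^bsub>M\<^esub> t (z \<otimes>\<^bsub>L\<^esub> w))"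
      using eq[OF c(1) zw(2)] by simp
    also have "\<dots> = t (z \<otimes>\<^bsub>L\<^esub> w)"
      using c T by (intro M.M.diff_diff_cancel) (simp_all add: act_closed bracket_closed)
    finally show "t (z \<otimes>\<^bsub>subalg L H\<^esub> w) = act z (t w) \<ominus>\<^bsub>M\<^esub> act w (t z)" by simp
  qed (auto simp: H_carrier)
  then have d: "restrict t H \<in> ders_H" by simp
  have datum: "tr_datum (restrict t H) t f"
    unfolding tr_datum_def using t f(1) eq by (auto simp: der_act_apply H_ideal)
  have "restrict t H \<in> inv_ders" by (rule tr_datum_inv[OF d datum])
  then show "c \<in> tr K L H M act ` carrier (H1_inv K L H M act)"
    using tr_class[OF _ datum] by (auto simp: f(2) H1_inv_carrier)
qed

end

text \<open>Here \<open>fxyz\<close> is f([x, y], z) and \<open>fx_yz\<close> is f(x, [y, z]). The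
  last assumption is the cocycle identity after use of antisymmetry. Solved for f([x, y], z), it
  gives z \<cdot> f(x, y) plus the value at z of x \<cdot> f(y, -) minus y \<cdot> f(x, -).\<close>

lemma (in abelian_group) rho_der_sum:
  assumes "xfyz \<in> carrier G" "yfxz \<in> carrier G" "zfxy \<in> carrier G" "fxyz \<in> carrier G" "fx_yz \<in>
    carrier G" "fy_xz \<in> carrier G"
    and "xfyz \<oplus> \<ominus> yfxz \<oplus> zfxy = fxyz \<oplus> \<ominus> fx_yz \<oplus> fy_xz"
  shows "fxyz = zfxy \<oplus> ((xfyz \<ominus> fy_xz) \<ominus> (yfxz \<ominus> fx_yz))"
proof -
  have "fxyz = (fxyz \<oplus> \<ominus> fx_yz \<oplus> fy_xz) \<ominus> fy_xz \<oplus> fx_yz" using assms(1-6) by algebra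
  also have "\<dots> = zfxy \<oplus> ((xfyz \<ominus> fy_xz) \<ominus> (yfxz \<ominus> fx_yz))"
    unfolding assms(7)[symmetric] using assms(1-6) by algebra
  finally show ?thesis .
qed

lemma (in abelian_group) rho_indep_sum:
  assumes "xbz \<in> carrier G" "zbx \<in> carrier G" "bxz \<in> carrier G" "fxz \<in> carrier G"
  shows "xbz \<ominus> zbx \<ominus> bxz \<oplus> fxz = \<ominus> zbx \<oplus> ((xbz \<ominus> bxz) \<oplus> fxz)"
  using assms by algebra

section \<open>The map \<open>\<rho>\<close>\<close>

context ideal_rep
begin

abbreviation ders_C where "ders_C \<equiv> ders K (quot_alg L H) H1_H (H1_act K L H M act)"
abbreviation class_C where "class_C \<equiv> H1_class K (quot_alg L H) H1_H (H1_act K L H M act)"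
abbreviation H1_C where "H1_C \<equiv> H1 K (quot_alg L H) H1_H (H1_act K L H M act)"

text \<open>If f is the cocycle of a linear section s that extends the partial splitting, this is
  the derivation d_y of the lift y = s x.\<close>

definition partial_cocycle :: "('a \<times> 'a \<Rightarrow> 'm) \<Rightarrow> 'a \<Rightarrow> 'a \<Rightarrow> 'm" where
  "partial_cocycle f x = (\<lambda>z\<in>H. f (x, z))"

text \<open>The counterpart of \<open>rho_bar\<close> for a normalized cocycle in place of an
  extension with a partial splitting.\<close>

definition rho_der :: "('a \<times> 'a \<Rightarrow> 'm) \<Rightarrow> ('a set \<Rightarrow> ('a \<Rightarrow> 'm) set) \<Rightarrow> bool" where
  "rho_der f r \<longleftrightarrow> r \<in> ders_C \<and> (\<forall>x\<in>carrier L. r (\<pi> x) = class_H (partial_cocycle f x))"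

lemma normalizedD:
  assumes "f \<in> normalized"
  shows "f \<in> cocycles_L" "\<And>z w. \<lbrakk>z \<in> H; w \<in> H\<rbrakk> \<Longrightarrow> f (z, w) = \<zero>\<^bsub>M\<^esub>"
  using assms by (auto simp: normalized_def)

text \<open>In the cocycle identity for x and z, w in \<open>H\<close>, the terms x \<cdot> f(z, w),
  f([x, z], w) and f([w, x], z) vanish because \<open>H\<close> is an ideal and f is normalized; the
  rest is the derivation law for f(x, -).\<close>

lemma partial_cocycle_ders:
  assumes f: "f \<in> normalized" and x: "x \<in> carrier L"
  shows "partial_cocycle f x \<in> ders_H"
proof -
  note F = cocyclesD[OF normalizedD(1)[OF f]] and N = normalizedD(2)[OF f]
  have "(\<lambda>z\<in>carrier (subalg L H). f (x, z)) \<in> ders_H"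
  proof (rule H.restrict_dersI[OF module_homs_subalg[OF F(2)[OF x]]])
    fix z w assume "z \<in> carrier (subalg L H)" "w \<in> carrier (subalg L H)"
    then have zw: "z \<in> H" "w \<in> H" by simp_all
    note c = zw[THEN H_carrier]
    note cl = act_closed[OF c(1) F(6)[OF x c(2)]] act_closed[OF c(2) F(6)[OF x c(1)]] F(6)[OF x
      bracket_closed[OF c]]
    have "act x (f (z, w)) \<oplus>\<^bsub>M\<^esub> act z (f (w, x)) \<oplus>\<^bsub>M\<^esub> act w (f (x, z)) =
      f (x \<otimes>\<^bsub>L\<^esub> z, w) \<oplus>\<^bsub>M\<^esub> f (z \<otimes>\<^bsub>L\<^esub> w, x) \<oplus>\<^bsub>M\<^esub> f (w \<otimes>\<^bsub>L\<^esub> x, z)"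
      by (rule F(5)[OF x c])
    then have "\<ominus>\<^bsub>M\<^esub> act z (f (x, w)) \<oplus>\<^bsub>M\<^esub> act w (f (x, z)) = \<ominus>\<^bsub>M\<^esub> f (x, z \<otimes>\<^bsub>L\<^esub> w)"
      using x zw c cl F(6)[OF x c(1)] F(6)[OF x c(2)]
      unfolding cocycle_antisym[OF normalizedD(1)[OF f] x c(2)] cocycle_antisym[OF normalizedD(1)[OF
        f] x bracket_closed[OF c]]
      by (simp add: N H_ideal H_ideal_r act_zero act_neg)
    then have "\<ominus>\<^bsub>M\<^esub> (\<ominus>\<^bsub>M\<^esub> act z (f (x, w)) \<oplus>\<^bsub>M\<^esub> act w (f (x, z))) = f (x, z \<otimes>\<^bsub>L\<^esub> w)"
      using cl by simp
    then show "f (x, z \<otimes>\<^bsub>subalg L H\<^esub> w) = act z (f (x, w)) \<ominus>\<^bsub>M\<^esub> act w (f (x, z))"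
      using cl by (simp add: M.M.minus_add a_minus_def)
  qed (auto simp: H_carrier)
  then show ?thesis by (simp add: partial_cocycle_def)
qed

lemma partial_cocycle_hom:
  assumes f: "f \<in> normalized"
  shows "partial_cocycle f \<in> module_homs K L (der_space K (subalg L H) M act)"
proof (rule module_homsI)
  note F = cocyclesD[OF normalizedD(1)[OF f]]
  fix x assume x: "x \<in> carrier L"
  show "partial_cocycle f x \<in> carrier (der_space K (subalg L H) M act)"
    using partial_cocycle_ders[OF f x] by simp
  show "partial_cocycle f (a \<odot>\<^bsub>L\<^esub> x) = a \<odot>\<^bsub>der_space K (subalg L H) M act\<^esub> partial_cocycle f x"
    if "a \<in> carrier K" for a
    using that x module_homs_smult[OF F(3)] by (auto simp: partial_cocycle_def H_carrier intro!:
      restrict_ext)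
  show "partial_cocycle f (x \<oplus>\<^bsub>L\<^esub> y) = partial_cocycle f x \<oplus>\<^bsub>der_space K (subalg L H) M act\<^esub>
    partial_cocycle f y"
    if "y \<in> carrier L" for y
    using that x by (auto simp: partial_cocycle_def H_carrier F(8) intro!: restrict_ext)
qed

lemma partial_cocycle_H: "\<lbrakk>f \<in> normalized; z \<in> H\<rbrakk> \<Longrightarrow> partial_cocycle f z = (\<lambda>w\<in>H. \<zero>\<^bsub>M\<^esub>)"
  unfolding partial_cocycle_def by (rule restrict_ext) (simp add: normalizedD)

lemma H1_H_bracket_class:
  assumes "x \<in> carrier L" "y \<in> carrier L" "d \<in> ders_H" "e \<in> ders_H"
  shows "H1_act K L H M act (\<pi> x) (class_H d) \<ominus>\<^bsub>H1_H\<^esub> H1_act K L H M act (\<pi> y) (class_H e) =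
    class_H (\<lambda>z\<in>H. der_act L H M act x d z \<ominus>\<^bsub>M\<^esub> der_act L H M act y e z)"
  using assms H.H1_minus[OF der_act_ders[OF assms(1,3)] der_act_ders[OF assms(2,4)]]
  by (simp add: H1_act_class)

text \<open>Since f vanishes on H \<times> H, x \<mapsto> [f(x, -)] descends to the quotient. For
  f(x, -) itself the derivation law holds only up to the inner derivation of f(x, y), so it is a law
  for classes.\<close>

lemma rho_der_exists:
  assumes f: "f \<in> normalized"
  obtains r where "rho_der f r"
proof -
  note F = cocyclesD[OF normalizedD(1)[OF f]] and anti = cocycle_antisym[OF normalizedD(1)[OF f]]
  let ?P = "partial_cocycle f"
  have hom: "(\<lambda>x. class_H (?P x)) \<in> module_homs K L H1_H"
    by (rule module_homs_comp[OF partial_cocycle_hom[OF f] H.H1_class_hom])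
  obtain r where r: "r \<in> module_homs K (quot_alg L H) H1_H" "r \<in> extensional (carrier (quot_alg L
    H))"
    "\<And>x. x \<in> carrier L \<Longrightarrow> r (\<pi> x) = class_H (?P x)"
  proof (rule descend_hom[OF hom C.M_module])
    show "class_H (?P z) = \<zero>\<^bsub>H1_H\<^esub>" if "z \<in> H" for z
      by (simp add: partial_cocycle_H[OF f that] H.H1_zero)
  qed (rule that)
  have "r \<in> ders_C"
  proof (rule C.dersI[OF r(1,2)])
    fix X Y assume "X \<in> carrier (quot_alg L H)" "Y \<in> carrier (quot_alg L H)"
    then obtain x y where xy: "x \<in> carrier L" "X = \<pi> x" "y \<in> carrier L" "Y = \<pi> y"
      by (auto elim!: cosetE)
    note br = bracket_closed[OF xy(1,3)]
    note P = partial_cocycle_ders[OF f xy(1)] partial_cocycle_ders[OF f xy(3)]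
      partial_cocycle_ders[OF f br]
    let ?D = "\<lambda>z\<in>carrier (subalg L H). der_act L H M act x (?P y) z \<ominus>\<^bsub>M\<^esub> der_act L H M act y (?P x) z"
    have D: "?D \<in> ders_H"
      using abelian_group.minus_closed[OF module.axioms(2)[OF H.der_space_linear[unfolded
        linear_space_iff]],
          of "der_act L H M act x (?P y)" "der_act L H M act y (?P x)"]
        der_act_ders[OF xy(1) P(2)] der_act_ders[OF xy(3) P(1)]
      by (simp only: H.der_space_simps(1) H.der_space_minus)
    have "class_H (?P (x \<otimes>\<^bsub>L\<^esub> y)) = class_H ?D"
      unfolding H.H1_class_eq_iff[OF P(3) D]
    proof (intro bexI ballI)
      \<comment> \<open>The inner correction is the term z \<cdot> f(x, y) of the cocycle
        identity.\<close>
      show "f (x, y) \<in> carrier M" by (rule F(6)[OF xy(1,3)])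
      fix z assume "z \<in> carrier (subalg L H)"
      then have z: "z \<in> H" by simp
      note zc = H_carrier[OF z] and h = H_ideal[OF xy(1) z] H_ideal[OF xy(3) z]
      have "act x (f (y, z)) \<oplus>\<^bsub>M\<^esub> act y (f (z, x)) \<oplus>\<^bsub>M\<^esub> act z (f (x, y)) =
        f (x \<otimes>\<^bsub>L\<^esub> y, z) \<oplus>\<^bsub>M\<^esub> f (y \<otimes>\<^bsub>L\<^esub> z, x) \<oplus>\<^bsub>M\<^esub> f (z \<otimes>\<^bsub>L\<^esub> x, y)"
        by (rule F(5)[OF xy(1,3) zc])
      moreover have "act y (f (z, x)) = \<ominus>\<^bsub>M\<^esub> act y (f (x, z))"
        unfolding anti[OF xy(1) zc] by (rule act_neg[OF xy(3) F(6)[OF xy(1) zc]])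
      moreover have "f (y \<otimes>\<^bsub>L\<^esub> z, x) = \<ominus>\<^bsub>M\<^esub> f (x, y \<otimes>\<^bsub>L\<^esub> z)" by (rule anti[OF xy(1) H_carrier[OF h(2)]])
      moreover have "f (z \<otimes>\<^bsub>L\<^esub> x, y) = f (y, x \<otimes>\<^bsub>L\<^esub> z)"
        using anti[OF xy(3) bracket_closed[OF zc xy(1)]] bracket_antisym[OF xy(1) zc]
          module_homs_neg[OF F(2)[OF xy(3)] L_module M_module H_carrier[OF h(1)]] F(6)[OF xy(3)
            H_carrier[OF h(1)]]
        by (metis M.M.minus_minus)
      ultimately have "act x (f (y, z)) \<oplus>\<^bsub>M\<^esub> \<ominus>\<^bsub>M\<^esub> act y (f (x, z)) \<oplus>\<^bsub>M\<^esub> act z (f (x, y)) =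
          f (x \<otimes>\<^bsub>L\<^esub> y, z) \<oplus>\<^bsub>M\<^esub> \<ominus>\<^bsub>M\<^esub> f (x, y \<otimes>\<^bsub>L\<^esub> z) \<oplus>\<^bsub>M\<^esub> f (y, x \<otimes>\<^bsub>L\<^esub> z)" by simp
      from M.M.rho_der_sum[OF _ _ _ _ _ _ this]
      show "?P (x \<otimes>\<^bsub>L\<^esub> y) z = act z (f (x, y)) \<oplus>\<^bsub>M\<^esub> ?D z"
        using z zc h xy(1,3) by (simp add: partial_cocycle_def der_act_apply act_closed F(6)
          H_carrier bracket_closed)
    qed
    then show "r (X \<otimes>\<^bsub>quot_alg L H\<^esub> Y) = H1_act K L H M act X (r Y) \<ominus>\<^bsub>H1_H\<^esub> H1_act K L H M act Y (r X)"
      unfolding xy(2,4) coset_bracket[OF xy(1,3)] r(3)[OF xy(1)] r(3)[OF xy(3)] r(3)[OF br]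
        H1_H_bracket_class[OF xy(1,3) P(2,1)] by simp
  qed
  then have "rho_der f r" using r(3) by (simp add: rho_der_def)
  then show ?thesis by (rule that)
qed

section \<open>Independence of the choices and computation of \<rho>\<close>

lemma rho_derD:
  assumes "rho_der f r"
  shows "r \<in> ders_C" "\<And>x. x \<in> carrier L \<Longrightarrow> r (\<pi> x) = class_H (partial_cocycle f x)"
  using assms by (auto simp: rho_der_def)

text \<open>If f and g differ by the coboundary of b, then b is a derivation on \<open>H\<close>,
  since both cocycles vanish on H \<times> H. Let e be its restriction to \<open>H\<close>. For z in
  \<open>H\<close>, f(x, z) = - z \<cdot> b x + (x \<cdot> e)(z) + g(x, z); modulo inner derivations
  of \<open>H\<close> the two maps thus differ by the inner derivation of the class [e].\<close>

lemma rho_der_independent: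
  assumes f: "f \<in> normalized" and g: "g \<in> normalized" and eq: "class2_L f = class2_L g"
    and r: "rho_der f r" and q: "rho_der g q"
  shows "class_C r = class_C q"
proof -
  note F = normalizedD[OF f] and G = normalizedD[OF g]
  obtain b where b: "b \<in> module_homs K L M" "\<And>x y. \<lbrakk>x \<in> carrier L; y \<in> carrier L\<rbrakk> \<Longrightarrow>
      f (x, y) = (act x (b y) \<ominus>\<^bsub>M\<^esub> act y (b x) \<ominus>\<^bsub>M\<^esub> b (x \<otimes>\<^bsub>L\<^esub> y)) \<oplus>\<^bsub>M\<^esub> g (x, y)"
    using eq H2_class_eq_iff[OF F(1) G(1)] by auto
  note B = module_homs_closed[OF b(1)]
  have "(\<lambda>z\<in>carrier (subalg L H). b z) \<in> ders_H"
  proof (rule H.restrict_dersI[OF module_homs_subalg[OF b(1)]])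
    fix z w assume "z \<in> carrier (subalg L H)" "w \<in> carrier (subalg L H)"
    then have zw: "z \<in> H" "w \<in> H" by simp_all
    note c = zw[THEN H_carrier]
    have "act z (b w) \<ominus>\<^bsub>M\<^esub> act w (b z) \<ominus>\<^bsub>M\<^esub> b (z \<otimes>\<^bsub>L\<^esub> w) = \<zero>\<^bsub>M\<^esub>"
      using b(2)[OF c] F(2)[OF zw] G(2)[OF zw] c B by (simp add: act_closed bracket_closed)
    then show "b (z \<otimes>\<^bsub>subalg L H\<^esub> w) = act z (b w) \<ominus>\<^bsub>M\<^esub> act w (b z)"
      using c B by (simp add: M.M.minus_eq_zero_iff act_closed bracket_closed)
  qed (auto simp: H_carrier)
  then have e: "restrict b H \<in> ders_H" by simp
  show ?thesis
    unfolding C.H1_class_eq_iff[OF rho_derD(1)[OF r] rho_derD(1)[OF q]]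
  proof (intro bexI ballI)
    show "class_H (restrict b H) \<in> carrier H1_H" using e by (auto simp: H.H1_carrier)
    fix X assume "X \<in> carrier (quot_alg L H)"
    then obtain x where x: "x \<in> carrier L" "X = \<pi> x" by (rule cosetE)
    note P = partial_cocycle_ders[OF f x(1)] partial_cocycle_ders[OF g x(1)] der_act_ders[OF x(1) e]
    have s: "(\<lambda>z\<in>carrier (subalg L H). der_act L H M act x (restrict b H) z \<oplus>\<^bsub>M\<^esub> partial_cocycle g x
      z) \<in> ders_H"
      using abelian_groupE(1)[OF module.axioms(2)[OF H.der_space_linear[unfolded linear_space_iff]]
        , of "der_act L H M act x (restrict b H)" "partial_cocycle g x"] P(2,3)
      by simp
    have "class_H (partial_cocycle f x) =
      class_H (\<lambda>z\<in>carrier (subalg L H). der_act L H M act x (restrict b H) z \<oplus>\<^bsub>M\<^esub> partial_cocycle g x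
        z)"
      unfolding H.H1_class_eq_iff[OF P(1) s]
    proof (intro bexI ballI)
      show "\<ominus>\<^bsub>M\<^esub> b x \<in> carrier M" using B[OF x(1)] by simp
      fix z assume "z \<in> carrier (subalg L H)"
      then have z: "z \<in> H" by simp
      note c = H_carrier[OF z] H_ideal[OF x(1) z]
      show "partial_cocycle f x z = act z (\<ominus>\<^bsub>M\<^esub> b x) \<oplus>\<^bsub>M\<^esub>
        (\<lambda>z\<in>carrier (subalg L H). der_act L H M act x (restrict b H) z \<oplus>\<^bsub>M\<^esub> partial_cocycle g x z) z"
        using z c x(1) B cocyclesD(6)[OF G(1) x(1) c(1)]
        by (simp add: partial_cocycle_def der_act_apply b(2) act_neg act_closed bracket_closed
          M.M.rho_indep_sum)
    qed
    then show "r X = H1_act K L H M act X (class_H (restrict b H)) \<oplus>\<^bsub>H1_H\<^esub> q X"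
      using H.H1_add[OF P(3,2)] x(1)
      by (simp add: x(2) rho_derD(2)[OF r] rho_derD(2)[OF q] H1_act_class[OF x(1) e])
  qed
qed

text \<open>The given splitting is extended to a linear section s by correcting an arbitrary one on
  \<open>H\<close>; its cocycle f is normalized because s is a homomorphism there. An element y of
  \<open>E\<close> has the form i m + s (p y), which gives d_y = f(p y, -) - \<delta>(m); so its
  class depends on the coset of p y only.\<close>

lemma ext_rho_bar:
  fixes E :: "('k, 'e) module"
  assumes ext: "lie_extension K L M act E i p" and s0: "s0 \<in> partial_splittings K L H E p"
  obtains f where "f \<in> normalized" "ext_class K L M act E i p = class2_L f"
    "rho_der f (rho_bar K L H M act E i p s0)"
proof -
  interpret X: lie_ext K L M act E i p
    using ext by (simp add: lie_ext_def lie_ext_axioms_def lie_rep_axioms)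
  have s0': "s0 \<in> module_homs K (subalg L H) E" "\<And>z. z \<in> H \<Longrightarrow> p (s0 z) = z"
    "\<And>z w. \<lbrakk>z \<in> H; w \<in> H\<rbrakk> \<Longrightarrow> s0 (z \<otimes>\<^bsub>L\<^esub> w) = s0 z \<otimes>\<^bsub>E\<^esub> s0 w"
    using s0 by (auto simp: partial_splittings_def lie_homs_def)
  have s0c: "s0 z \<in> carrier E" if "z \<in> H" for z using module_homs_closed[OF s0'(1)] that by simp
  obtain \<sigma>0 where \<sigma>0: "\<sigma>0 \<in> linear_sections K L E p" using X.linear_section_exists .
  note S0 = X.linear_sectionsD[OF \<sigma>0]
  \<comment> \<open>The correction on \<open>H\<close>: the two lifts \<open>s0 z\<close> and
    \<open>\<sigma>0 z\<close> of z differ by an element of the kernel of p.\<close>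
  define b0 where "b0 z = inv_into (carrier M) i (s0 z \<ominus>\<^bsub>E\<^esub> \<sigma>0 z)" for z
  have b0: "b0 z \<in> carrier M" "i (b0 z) = s0 z \<ominus>\<^bsub>E\<^esub> \<sigma>0 z" if z: "z \<in> H" for z
  proof -
    have c: "s0 z \<ominus>\<^bsub>E\<^esub> \<sigma>0 z \<in> carrier E" using s0c[OF z] S0(3)[OF H_carrier[OF z]] by simp
    have "p (s0 z \<ominus>\<^bsub>E\<^esub> \<sigma>0 z) = \<zero>\<^bsub>L\<^esub>"
      using s0c[OF z] S0(2,3)[OF H_carrier[OF z]] s0'(2)[OF z] H_carrier[OF z]
      by (simp add: module_homs_minus[OF X.p_hom X.E_module L_module] L.M.minus_eq_zero_iff)
    then show "b0 z \<in> carrier M" "i (b0 z) = s0 z \<ominus>\<^bsub>E\<^esub> \<sigma>0 z" using X.i_inv[OF c]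
      by (auto simp: b0_def)
  qed
  have "(\<lambda>z. i (b0 z)) \<in> module_homs K (subalg L H) E"
  proof (rule module_homs_cong[OF module_homs_diff[OF s0'(1) module_homs_subalg[OF S0(1)]
    X.E_module] H.L_module])
    show "s0 z \<ominus>\<^bsub>E\<^esub> \<sigma>0 z = i (b0 z)" if "z \<in> carrier (subalg L H)" for z
      using b0(2)[of z] that by simp
  qed (auto simp: H_carrier)
  then have "b0 \<in> module_homs K (subalg L H) M"
    by (rule X.lift_through_i[OF H.L_module]) (simp add: b0)
  then obtain b where b: "b \<in> module_homs K L M" "\<And>z. z \<in> H \<Longrightarrow> b z = b0 z"
    using extend_from_H by blast
  define s where "s x = \<sigma>0 x \<oplus>\<^bsub>E\<^esub> i (b x)" for x
  have s: "s \<in> linear_sections K L E p" unfolding s_def by (rule X.linear_section_shift[OF \<sigma>0 b(1)])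
  note S = X.linear_sectionsD[OF s]
  have sH: "s z = s0 z" if z: "z \<in> H" for z
    unfolding s_def b(2)[OF z] b0(2)[OF z] using s0c[OF z] S0(3)[OF H_carrier[OF z]]
    by (subst X.E.L.M.a_comm) (simp_all add: X.E.L.M.diff_add_cancel)
  define f where "f = section_cocycle L M E i s"
  have fc: "f \<in> cocycles_L" unfolding f_def by (rule X.section_cocycle_cocycle[OF s])
  note fa = X.section_cocycle_apply[OF s, folded f_def]
  have fn: "f \<in> normalized"
    unfolding normalized_def
  proof (intro CollectI conjI ballI fc)
    fix z w assume zw: "z \<in> H" "w \<in> H"
    have h: "z \<otimes>\<^bsub>L\<^esub> w \<in> H" by (rule H_ideal[OF H_carrier[OF zw(1)] zw(2)])
    have "i (f (z, w)) = i \<zero>\<^bsub>M\<^esub>"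
      using fa(2)[OF H_carrier[OF zw(1)] H_carrier[OF zw(2)]] s0c[OF h]
      by (simp add: sH zw h s0'(3) module_homs_zero[OF X.i_hom M_module X.E_module])
        (simp add: a_minus_def X.E.L.M.r_neg X.E.bracket_closed s0c zw)
    then show "f (z, w) = \<zero>\<^bsub>M\<^esub>"
      by (rule X.i_eqD) (simp_all add: fa(1) H_carrier zw)
  qed
  have ed: "class_H (ext_der L H M E i p s0 y) = class_H (partial_cocycle f x)"
    if y: "y \<in> carrier E" and x: "x \<in> carrier L" and eq: "\<pi> (p y) = \<pi> x" for x y
  proof -
    have py: "p y \<in> carrier L" by (rule X.p_closed[OF y])
    have c: "y \<ominus>\<^bsub>E\<^esub> s (p y) \<in> carrier E" using y S(3)[OF py] by simp
    have "p (y \<ominus>\<^bsub>E\<^esub> s (p y)) = \<zero>\<^bsub>L\<^esub>"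
      using y S(2,3)[OF py] py by (simp add: module_homs_minus[OF X.p_hom X.E_module L_module]
        L.M.minus_eq_zero_iff)
    then obtain m where m: "m \<in> carrier M" "i m = y \<ominus>\<^bsub>E\<^esub> s (p y)" using X.i_inv[OF c] by blast
    have y': "y = i m \<oplus>\<^bsub>E\<^esub> s (p y)" unfolding m(2) using y S(3)[OF py]
      by (simp add: X.E.L.M.diff_add_cancel)
    have val: "ext_der L H M E i p s0 y z = act z (\<ominus>\<^bsub>M\<^esub> m) \<oplus>\<^bsub>M\<^esub> partial_cocycle f (p y) z"
      if z: "z \<in> H" for z
    proof -
      note zc = H_carrier[OF z] and h = H_ideal[OF py z]
      note cl = S(3)[OF zc] S(3)[OF py] X.i_closed[OF m(1)] S(3)[OF H_carrier[OF h]]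
      \<comment> \<open>The sign in front of m: [i m, s z] = - [s z, i m] = - i (z \<cdot>
        m).\<close>
      have "i (act z m) = s z \<otimes>\<^bsub>E\<^esub> i m" using X.i_act[OF cl(1) m(1)] S(2)[OF zc] by simp
      then have n: "i (act z (\<ominus>\<^bsub>M\<^esub> m)) = i m \<otimes>\<^bsub>E\<^esub> s z"
        using module_homs_neg[OF X.i_hom M_module X.E_module act_closed[OF zc m(1)]] act_neg[OF zc
          m(1)]
          X.E.bracket_antisym[OF cl(1,3)] by simp
      have "y \<otimes>\<^bsub>E\<^esub> s0 z \<ominus>\<^bsub>E\<^esub> s0 (p y \<otimes>\<^bsub>L\<^esub> z) = (i m \<oplus>\<^bsub>E\<^esub> s (p y)) \<otimes>\<^bsub>E\<^esub> s z \<ominus>\<^bsub>E\<^esub> s (p y \<otimes>\<^bsub>L\<^esub> z)"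
        using y' by (simp add: sH z h)
      also have "\<dots> = i m \<otimes>\<^bsub>E\<^esub> s z \<oplus>\<^bsub>E\<^esub> (s (p y) \<otimes>\<^bsub>E\<^esub> s z \<ominus>\<^bsub>E\<^esub> s (p y \<otimes>\<^bsub>L\<^esub> z))"
        using cl by (simp add: X.E.bracket_l_distr X.E.L.M.a_assoc X.E.bracket_closed a_minus_def)
      also have "\<dots> = i (act z (\<ominus>\<^bsub>M\<^esub> m) \<oplus>\<^bsub>M\<^esub> f (p y, z))"
        using zc m(1) py fa[OF py zc] by (simp add: X.i_add act_closed n)
      finally have "y \<otimes>\<^bsub>E\<^esub> s0 z \<ominus>\<^bsub>E\<^esub> s0 (p y \<otimes>\<^bsub>L\<^esub> z) = i (act z (\<ominus>\<^bsub>M\<^esub> m) \<oplus>\<^bsub>M\<^esub> f (p y, z))" .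
      then have "inv_into (carrier M) i (y \<otimes>\<^bsub>E\<^esub> s0 z \<ominus>\<^bsub>E\<^esub> s0 (p y \<otimes>\<^bsub>L\<^esub> z)) = act z (\<ominus>\<^bsub>M\<^esub> m) \<oplus>\<^bsub>M\<^esub> f (p y, z)"
        using X.inv_i zc m(1) fa(1)[OF py zc] by (simp add: act_closed)
      then show ?thesis using z by (simp add: ext_der_def partial_cocycle_def)
    qed
    note P = partial_cocycle_ders[OF fn py]
    have eder: "ext_der L H M E i p s0 y = (\<lambda>z\<in>carrier (subalg L H). partial_cocycle f (p y) z \<ominus>\<^bsub>M\<^esub>
      act z m)"
    proof (rule extensionalityI[of _ H])
      fix z assume z: "z \<in> H"
      show "ext_der L H M E i p s0 y z = (\<lambda>z\<in>carrier (subalg L H). partial_cocycle f (p y) z \<ominus>\<^bsub>M\<^esub> act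
        z m) z"
        unfolding val[OF z] using z m(1) ders_HD(3)[OF P z]
        by (simp add: act_neg H_carrier a_minus_def M.M.a_comm act_closed)
    qed (auto simp: ext_der_def)
    have "class_H (ext_der L H M E i p s0 y) = class_H (partial_cocycle f (p y))"
      unfolding eder by (rule H.shift_inner_ders(2)[OF P m(1)])
    \<comment> \<open>For a normalized f the partial cocycles of elements of \<open>H\<close> are
      zero, so p y may be replaced by any element of its coset.\<close>
    also have "partial_cocycle f (p y) = partial_cocycle f x"
      by (rule hom_coset_const[OF partial_cocycle_hom[OF fn] _ _ py x eq])
        (use H.der_space_linear linear_space_iff partial_cocycle_H[OF fn] in auto)
    finally show ?thesis .
  qed
  have rb: "rho_bar K L H M act E i p s0 (\<pi> x) = class_H (partial_cocycle f x)"
    if x: "x \<in> carrier L" for x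
  proof -
    have "(THE C. \<exists>y\<in>carrier E. \<pi> (p y) = \<pi> x \<and> C = class_H (ext_der L H M E i p s0 y)) =
      class_H (partial_cocycle f x)"
    proof (rule the_equality)
      show "\<exists>y\<in>carrier E. \<pi> (p y) = \<pi> x \<and> class_H (partial_cocycle f x) =
        class_H (ext_der L H M E i p s0 y)"
        using ed[OF S(3)[OF x] x] S(2,3)[OF x] by (intro bexI[of _ "s x"]) auto
    qed (use ed[OF _ x] in blast)
    then show ?thesis using coset_closed[OF x] by (simp add: rho_bar_def del: quot_alg_simps)
  qed
  obtain r where r: "rho_der f r" using rho_der_exists[OF fn] .
  have "rho_bar K L H M act E i p s0 = r"
  proof (rule extensionalityI)
    show "rho_bar K L H M act E i p s0 \<in> extensional (carrier (quot_alg L H))"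
      by (simp add: rho_bar_def)
    show "r \<in> extensional (carrier (quot_alg L H))" by (rule C.dersD(2)[OF rho_derD(1)[OF r]])
    fix X assume "X \<in> carrier (quot_alg L H)"
    then show "rho_bar K L H M act E i p s0 X = r X"
      by (auto elim!: cosetE simp: rb rho_derD(2)[OF r] simp del: quot_alg_simps)
  qed
  then show ?thesis using that[OF fn] X.ext_class_eq[OF s] r by (simp add: f_def)
qed

text \<open>Existence: the extension twisted by f has class [f], and x \<mapsto> (0, x) is a
  homomorphism on \<open>H\<close> because f vanishes on H \<times> H. Uniqueness: any extension of
  class [f] with a splitting yields a normalized g with [g] = [f], to which
  \<open>rho_der_independent\<close> applies. The same comparison identifies \<open>rho_bar\<close>
  of the twisted extension up to inner derivations, without computing it.\<close>

lemma rho_class: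
  assumes f: "f \<in> normalized" and r: "rho_der f r"
  shows "rho K L H M act (class2_L f) = class_C r"
  unfolding rho_def
proof (rule the_equality)
  note fc = normalizedD(1)[OF f]
  let ?E = "twisted L M act f" and ?i = "\<lambda>m. (m, \<zero>\<^bsub>L\<^esub>)" and ?s = "\<lambda>x. (\<zero>\<^bsub>M\<^esub>, x)"
  interpret X: lie_ext K L M act ?E ?i snd by (rule twisted_extension(1)[OF fc])
  have s: "?s \<in> partial_splittings K L H ?E snd"
    by (auto simp: partial_splittings_def lie_homs_def module_homs_def H_carrier normalizedD(2)[OF
      f]
      act_zero a_minus_def M.M.minus_zero_eq)
  have cl: "ext_class K L M act ?E ?i snd = class2_L f"
    using X.ext_class_eq[OF twisted_extension(2)[OF fc]] twisted_extension(3)[OF fc] by simp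
  obtain g where g: "g \<in> normalized" "ext_class K L M act ?E ?i snd = class2_L g"
    "rho_der g (rho_bar K L H M act ?E ?i snd ?s)"
    using ext_rho_bar[OF X.ext s] .
  have "class_C r = class_C (rho_bar K L H M act ?E ?i snd ?s)"
    using rho_der_independent[OF f g(1) _ r g(3)] g(2) cl by simp
  then show "\<exists>(E :: ('k, 'm \<times> 'a) module) i p s. lie_extension K L M act E i p \<and> ext_class K L M act
    E i p = class2_L f \<and>
     s \<in> partial_splittings K L H E p \<and> class_C r = class_C (rho_bar K L H M act E i p s)"
    using X.ext cl s by blast
next
  fix q assume "\<exists>(E :: ('k, 'm \<times> 'a) module) i p s. lie_extension K L M act E i p \<and> ext_class K L M
    act E i p = class2_L f \<and>
     s \<in> partial_splittings K L H E p \<and> q = class_C (rho_bar K L H M act E i p s)"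
  then obtain E :: "('k, 'm \<times> 'a) module" and i p s where E: "lie_extension K L M act E i p"
     "ext_class K L M act E i p = class2_L f" "s \<in> partial_splittings K L H E p"
     "q = class_C (rho_bar K L H M act E i p s)" by blast
  obtain g where g: "g \<in> normalized" "ext_class K L M act E i p = class2_L g"
    "rho_der g (rho_bar K L H M act E i p s)"
    using ext_rho_bar[OF E(1,3)] .
  show "q = class_C r"
    unfolding E(4) using rho_der_independent[OF g(1) f _ g(3) r] g(2) E(2) by simp
qed

section \<open>Linearity of \<rho> and exactness at the kernel of restriction in degree two\<close>

lemma rho_hom: "rho K L H M act \<in> module_homs K (H2_1 K L H M act) H1_C"
proof (rule module_homsI)
  note modZ = cocycle_space_linear[unfolded linear_space_iff]
  fix c assume "c \<in> carrier (H2_1 K L H M act)"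
  then obtain f where f: "f \<in> normalized" "c = class2_L f" by (auto simp: H2_1_carrier)
  obtain r where r: "rho_der f r" using rho_der_exists[OF f(1)] .
  note F = normalizedD[OF f(1)] and R = rho_derD[OF r]
  show "rho K L H M act c \<in> carrier H1_C" using R(1)
    by (simp add: f(2) rho_class[OF f(1) r] C.H1_carrier)
  show "rho K L H M act (a \<odot>\<^bsub>H2_1 K L H M act\<^esub> c) = a \<odot>\<^bsub>H1_C\<^esub> rho K L H M act c"
    if a: "a \<in> carrier K" for a
  proof -
    define g where "g = a \<odot>\<^bsub>cocycle_space K L M act\<^esub> f"
    have g: "g \<in> normalized"
      using module.smult_closed[OF modZ a, of f] F a by (auto simp: normalized_def g_def H_carrier)
    have pg: "partial_cocycle g x = (\<lambda>z\<in>carrier (subalg L H). a \<odot>\<^bsub>M\<^esub> partial_cocycle f x z)"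
      if "x \<in> carrier L" for x
      using that by (auto simp: partial_cocycle_def g_def H_carrier intro!: restrict_ext)
    define q where "q = a \<odot>\<^bsub>der_space K (quot_alg L H) H1_H (H1_act K L H M act)\<^esub> r"
    have "q \<in> ders_C"
      using module.smult_closed[OF C.der_space_linear[unfolded linear_space_iff] a, of r] R(1)
        by (simp add: q_def)
    moreover have "q (\<pi> x) = class_H (partial_cocycle g x)" if x: "x \<in> carrier L" for x
      using H.H1_smult[OF partial_cocycle_ders[OF f(1) x] a] coset_closed[OF x]
      by (simp add: q_def R(2)[OF x] pg[OF x] del: quot_alg_simps)
    ultimately have q: "rho_der g q" by (simp add: rho_der_def)
    have "a \<odot>\<^bsub>H2_1 K L H M act\<^esub> c = class2_L g" using H2_smult[OF F(1) a] by (simp add: f(2) g_def)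
    moreover have "a \<odot>\<^bsub>H1_C\<^esub> class_C r = class_C q" using C.H1_smult[OF R(1) a]
      by (simp add: q_def del: quot_alg_simps)
    ultimately show ?thesis by (simp add: rho_class[OF g q] rho_class[OF f(1) r] f(2))
  qed
  fix c' assume "c' \<in> carrier (H2_1 K L H M act)"
  then obtain f' where f': "f' \<in> normalized" "c' = class2_L f'" by (auto simp: H2_1_carrier)
  obtain r' where r': "rho_der f' r'" using rho_der_exists[OF f'(1)] .
  note F' = normalizedD[OF f'(1)] and R' = rho_derD[OF r']
  define g where "g = f \<oplus>\<^bsub>cocycle_space K L M act\<^esub> f'"
  have g: "g \<in> normalized"
    using abelian_groupE(1)[OF module.axioms(2)[OF modZ], of f f'] F F'
    by (auto simp: normalized_def g_def H_carrier)
  have pg: "partial_cocycle g x = (\<lambda>z\<in>carrier (subalg L H). partial_cocycle f x z \<oplus>\<^bsub>M\<^esub> partial_cocycle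
    f' x z)"
    if "x \<in> carrier L" for x
    using that by (auto simp: partial_cocycle_def g_def H_carrier intro!: restrict_ext)
  define q where "q = r \<oplus>\<^bsub>der_space K (quot_alg L H) H1_H (H1_act K L H M act)\<^esub> r'"
  have "q \<in> ders_C"
    using abelian_groupE(1)[OF module.axioms(2)[OF C.der_space_linear[unfolded linear_space_iff]],
      of r r'] R(1) R'(1)
    by (simp add: q_def)
  moreover have "q (\<pi> x) = class_H (partial_cocycle g x)" if x: "x \<in> carrier L" for x
    using H.H1_add[OF partial_cocycle_ders[OF f(1) x] partial_cocycle_ders[OF f'(1) x]]
      coset_closed[OF x]
    by (simp add: q_def R(2)[OF x] R'(2)[OF x] pg[OF x] del: quot_alg_simps)
  ultimately have q: "rho_der g q" by (simp add: rho_der_def)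
  have "c \<oplus>\<^bsub>H2_1 K L H M act\<^esub> c' = class2_L g" using H2_add[OF F(1) F'(1)]
    by (simp add: f(2) f'(2) g_def)
  moreover have "class_C r \<oplus>\<^bsub>H1_C\<^esub> class_C r' = class_C q"
    using C.H1_add[OF R(1) R'(1)] by (simp add: q_def del: quot_alg_simps)
  ultimately show "rho K L H M act (c \<oplus>\<^bsub>H2_1 K L H M act\<^esub> c') =
    rho K L H M act c \<oplus>\<^bsub>H1_C\<^esub> rho K L H M act c'"
    by (simp add: rho_class[OF g q] rho_class[OF f(1) r] rho_class[OF f'(1) r'] f(2) f'(2))
qed

text \<open>Killing f on L \<times> H takes two coboundaries. The first removes the classes of the
  derivations f(x, -) of \<open>H\<close>; the second removes the inner derivations that remain, for
  which the elements defining them must depend linearly on x and vanish for x in \<open>H\<close>.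
  Conversely, an inflated cocycle vanishes on L \<times> H, so its image is represented by the zero
  derivation.\<close>

lemma exact_H2_1:
  "exact_at K H2_Q (inf2 K L H M act) (H2_1 K L H M act) (rho K L H M act) H1_C"
  unfolding exact_at_def
proof (intro conjI inf2_hom rho_hom equalityI subsetI)
  fix c assume "c \<in> inf2 K L H M act ` carrier H2_Q"
  then obtain f where f: "f \<in> cocycles_Q" "c = class2_L (infl2 f)"
    by (auto simp: Q.H2_carrier inf2_class)
  note n = infl2_normalized[OF f(1)]
  have f0: "f (\<pi> x, \<pi> z) = \<zero>\<^bsub>M\<^esub>" if "x \<in> carrier L" "z \<in> H" for x z
    using module_homs_zero[OF Q.cocyclesD(2)[OF f(1) coset_closed[OF that(1)]] Q.L_module
      Q.M_module] that(2)
    by (simp add: coset_H)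
  have "partial_cocycle (infl2 f) x = (\<lambda>z\<in>carrier (subalg L H). \<zero>\<^bsub>M\<^esub>)" if x: "x \<in> carrier L" for x
    using x by (auto simp: partial_cocycle_def infl2_apply f0 H_carrier intro!: restrict_ext)
  then have "rho_der (infl2 f) (\<lambda>X\<in>carrier (quot_alg L H). \<zero>\<^bsub>H1_H\<^esub>)"
    unfolding rho_der_def using C.zero_ders coset_closed H.H1_zero by (simp del: quot_alg_simps)
  from rho_class[OF n this] have "rho K L H M act c = \<zero>\<^bsub>H1_C\<^esub>" by (simp add: f(2) C.H1_zero)
  then show "c \<in> a_kernel (H2_1 K L H M act) H1_C (rho K L H M act)"
    using n by (auto simp: a_kernel_def' f(2) H2_1_carrier)
next
  fix c assume "c \<in> a_kernel (H2_1 K L H M act) H1_C (rho K L H M act)"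
  then obtain f where f: "f \<in> normalized" "c = class2_L f" "rho K L H M act (class2_L f) = \<zero>\<^bsub>H1_C\<^esub>"
    by (auto simp: a_kernel_def' H2_1_carrier)
  obtain r where r: "rho_der f r" using rho_der_exists[OF f(1)] .
  note F = normalizedD[OF f(1)] and R = rho_derD[OF r]
  have "class_C r = \<zero>\<^bsub>H1_C\<^esub>" using f(3) by (simp add: rho_class[OF f(1) r])
  then obtain d where d: "d \<in> ders_H"
    "\<And>x. x \<in> carrier L \<Longrightarrow> class_H (partial_cocycle f x) = H1_act K L H M act (\<pi> x) (class_H d)"
    unfolding C.H1_class_zero_iff[OF R(1)] using R(2) by (auto simp: H.H1_carrier)
  note D = ders_HD[OF d(1)]
  obtain b where b: "b \<in> module_homs K L M" "\<And>z. z \<in> H \<Longrightarrow> b z = d z"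
    using extend_from_H[OF D(1)] by blast
  note B = module_homs_closed[OF b(1)]
  obtain g where g: "g \<in> cocycles_L" "class2_L g = class2_L f"
    "\<And>x y. \<lbrakk>x \<in> carrier L; y \<in> carrier L\<rbrakk> \<Longrightarrow>
      g (x, y) = f (x, y) \<ominus>\<^bsub>M\<^esub> (act x (b y) \<ominus>\<^bsub>M\<^esub> act y (b x) \<ominus>\<^bsub>M\<^esub> b (x \<otimes>\<^bsub>L\<^esub> y))"
    using shift_coboundary[OF F(1) b(1)] by metis
  note G = cocyclesD[OF g(1)]
  \<comment> \<open>The first correction keeps the cocycle normalized because b is the derivation d
    on \<open>H\<close>; hence \<phi> vanishes on \<open>H\<close>, as \<open>linear_choice\<close>
    demands.\<close>
  have gH: "g (z, w) = \<zero>\<^bsub>M\<^esub>" if zw: "z \<in> H" "w \<in> H" for z w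
    using zw H_ideal[OF H_carrier[OF zw(1)] zw(2)] D(3)
    by (simp add: g(3) b(2) H_carrier F(2) D(4) a_minus_def M.M.r_neg M.M.minus_zero_eq act_closed)
  have gn: "g \<in> normalized" using g(1) gH by (simp add: normalized_def)
  define \<phi> where "\<phi> = partial_cocycle g"
  have \<phi>: "\<phi> \<in> module_homs K L (fun_space H M)"
    using partial_cocycle_hom[OF gn] unfolding \<phi>_def der_space_def
      module_homs_into_subalg[OF module.submoduleE(1)[OF fun_space_module H.ders_submodule]] by simp
  have inner: "\<exists>m\<in>carrier M. \<forall>z\<in>H. \<phi> x z = act z m" if x: "x \<in> carrier L" for x
  proof -
    have "class_H (partial_cocycle f x) = class_H (der_act L H M act x d)"
      using d(2)[OF x] by (simp add: H1_act_class[OF x d(1)])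
    then obtain m where m: "m \<in> carrier M"
      "\<And>z. z \<in> H \<Longrightarrow> f (x, z) = act z m \<oplus>\<^bsub>M\<^esub> (act x (d z) \<ominus>\<^bsub>M\<^esub> d (x \<otimes>\<^bsub>L\<^esub> z))"
      using H.H1_class_eq_iff[OF partial_cocycle_ders[OF f(1) x] der_act_ders[OF x d(1)]]
      by (auto simp: partial_cocycle_def der_act_apply)
    \<comment> \<open>The terms of x \<cdot> d cancel, and z \<cdot> b x from the coboundary joins z
      \<cdot> m.\<close>
    have "\<phi> x z = act z (m \<oplus>\<^bsub>M\<^esub> b x)" if z: "z \<in> H" for z
    proof -
      note c = act_closed[OF H_carrier[OF z] m(1)] act_closed[OF x D(3)[OF z]] D(3)[OF H_ideal[OF x
        z]]
        act_closed[OF H_carrier[OF z] B[OF x]]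
      have "\<phi> x z = (act z m \<oplus>\<^bsub>M\<^esub> (act x (d z) \<ominus>\<^bsub>M\<^esub> d (x \<otimes>\<^bsub>L\<^esub> z))) \<ominus>\<^bsub>M\<^esub> (act x (d z) \<ominus>\<^bsub>M\<^esub> act z (b x) \<ominus>\<^bsub>M\<^esub> d (x
        \<otimes>\<^bsub>L\<^esub> z))"
        using x z H_ideal[OF x z] by (simp add: \<phi>_def partial_cocycle_def g(3) H_carrier b(2) m(2))
      also have "\<dots> = act z m \<oplus>\<^bsub>M\<^esub> act z (b x)"
        using c by algebra
      finally show ?thesis using z m(1) B[OF x] by (simp add: act_r_distr H_carrier)
    qed
    then show ?thesis using m(1) B[OF x] by (intro bexI[of _ "m \<oplus>\<^bsub>M\<^esub> b x"]) auto
  qed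
  obtain t where t: "t \<in> module_homs K L M" "\<And>z. z \<in> H \<Longrightarrow> t z = \<zero>\<^bsub>M\<^esub>"
    "\<And>x z. \<lbrakk>x \<in> carrier L; z \<in> H\<rbrakk> \<Longrightarrow> \<phi> x z = act z (t x)"
    using linear_choice[OF \<phi> inner] partial_cocycle_H[OF gn] unfolding \<phi>_def by metis
  note T = module_homs_closed[OF t(1)]
  \<comment> \<open>\<open>shift_coboundary\<close> subtracts, so the coboundary of t is added by
    passing to the negative of t. On L \<times> H it contributes only - z \<cdot> t x, since t
    vanishes on \<open>H\<close>.\<close>
  have nt: "(\<lambda>x. \<ominus>\<^bsub>M\<^esub> t x) \<in> module_homs K L M"
    by (rule module_homs_cong[OF module_homs_diff[OF module_homs_const_zero[OF M_module] t(1)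
      M_module] L_module])
      (simp add: a_minus_def T)
  obtain h where h: "h \<in> cocycles_L" "class2_L h = class2_L g"
    "\<And>x y. \<lbrakk>x \<in> carrier L; y \<in> carrier L\<rbrakk> \<Longrightarrow>
      h (x, y) = g (x, y) \<ominus>\<^bsub>M\<^esub> (act x (\<ominus>\<^bsub>M\<^esub> t y) \<ominus>\<^bsub>M\<^esub> act y (\<ominus>\<^bsub>M\<^esub> t x) \<ominus>\<^bsub>M\<^esub> \<ominus>\<^bsub>M\<^esub> t (x \<otimes>\<^bsub>L\<^esub> y))"
    using shift_coboundary[OF g(1) nt] by metis
  have "h (x, z) = \<zero>\<^bsub>M\<^esub>" if x: "x \<in> carrier L" and z: "z \<in> H" for x z
    using t(3)[OF x z] x z T[OF x]
    by (simp add: h(3) H_carrier t(2) H_ideal \<phi>_def partial_cocycle_def act_zero act_neg act_closed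
      a_minus_def M.M.minus_zero_eq M.M.r_neg)
  then obtain k where k: "k \<in> cocycles_Q" "\<And>x y. \<lbrakk>x \<in> carrier L; y \<in> carrier L\<rbrakk> \<Longrightarrow> k (\<pi> x, \<pi> y) =
    h (x, y)"
    using descend_cocycle[OF h(1)] by blast
  have "infl2 k = h"
    by (rule PiE_ext[OF cocyclesD(1)[OF infl2_cocycle[OF k(1)]] cocyclesD(1)[OF h(1)]]) (auto simp:
      infl2_apply k(2))
  then have "c = inf2 K L H M act (class2_Q k)" using h(2) g(2)
    by (simp add: inf2_class[OF k(1)] f(2))
  then show "c \<in> inf2 K L H M act ` carrier H2_Q" using k(1) by (auto simp: Q.H2_carrier)
qed

end

theorem lemma6p8:
  fixes K :: "('k, 'r) ring_scheme" and L :: "('k, 'a) module" and H :: "'a set"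
    and M :: "('k, 'm) module" and act :: "'a \<Rightarrow> 'm \<Rightarrow> 'm"
  assumes "field K"
    and "lie_algebra K L"
    and "lie_ideal K L H"
    and "lie_module K L M act"
  shows
    "a_kernel (H1 K (quot_alg L H) (inv_module L H M act) (inv_act act)) (H1 K L M act)
        (inf1 K L H M act)
      = {\<zero>\<^bsub>H1 K (quot_alg L H) (inv_module L H M act) (inv_act act)\<^esub>} \<and>
     exact_at K
       (H1 K (quot_alg L H) (inv_module L H M act) (inv_act act)) (inf1 K L H M act)
       (H1 K L M act) (res1 K L H M act)
       (H1_inv K L H M act) \<and>
     exact_at K
       (H1 K L M act) (res1 K L H M act)
       (H1_inv K L H M act) (tr K L H M act)
       (H2 K (quot_alg L H) (inv_module L H M act) (inv_act act)) \<and>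
     exact_at K
       (H1_inv K L H M act) (tr K L H M act)
       (H2 K (quot_alg L H) (inv_module L H M act) (inv_act act)) (inf2 K L H M act)
       (H2_1 K L H M act) \<and>
     exact_at K
       (H2 K (quot_alg L H) (inv_module L H M act) (inv_act act)) (inf2 K L H M act)
       (H2_1 K L H M act) (rho K L H M act)
       (H1 K (quot_alg L H) (H1 K (subalg L H) M act) (H1_act K L H M act))"
proof -
  interpret ideal_rep K L M act H
    using assms by (simp add: ideal_rep_def ideal_rep_axioms_def lie_rep_def)
  show ?thesis
    by (intro conjI inf1_kernel exact_H1 exact_H1_inv exact_H2_Q exact_H2_1)
qed

end
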